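(* Let $(V,T,\Theta)$ be a representation of a difference Lie group $(G,\mathcal{D})$. There is a short exact sequence of cochain complexes $$0\longrightarrow\Big(\bigoplus_{n\ge1}\mathfrak{C}^n(\mathcal{D},T),\mathrm{d}^{\Theta_{\mathcal{D}}}\Big)\stackrel{\mathfrak{i}}{\longrightarrow}\Big(\bigoplus_{n\ge1}C^n(G,\mathcal{D},V,T),\delta\Big)\stackrel{\mathfrak{p}}{\longrightarrow}\Big(\bigoplus_{n\ge1}C^n(G,V),\mathrm{d}^{\Theta}\Big)\longrightarrow0,$$ where $\mathfrak{i}(\beta_{n-1})=(0,\beta_{n-1})$ and $\mathfrak{p}(\alpha_n,\beta_{n-1})=\alpha_n$ for all $\beta_{n-1}\in\mathfrak{C}^n(\mathcal{D},T)$ and $\alpha_n\in C^n(G,V)$. Consequently, there is a long exact sequence of cohomology groups $$\cdots\longrightarrow\mathcal{H}^n(\mathcal{D},T)\stackrel{\mathfrak{i}_*}{\longrightarrow}\mathcal{H}^n(G,\mathcal{D},V,T)\stackrel{\mathfrak{p}_*}{\longrightarrow}\mathcal{H}^n(G,V)\stackrel{\mathfrak{k}^n}{\longrightarrow}\mathcal{H}^{n+1}(\mathcal{D},T)\longrightarrow\cdots,$$ where the connecting map $\mathfrak{k}^n$ is given by $\mathfrak{k}^n([\alpha_n])=[\mathfrak{K}(\alpha_n)]$ for all $[\alpha_n]\in\mathcal{H}^n(G,V)$.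
   Context: A difference operator on a Lie group $G$ is a smooth map $\mathcal{D}:G\to G$ with $\mathcal{D}(gh)=\mathcal{D}(g)\,g\,\mathcal{D}(h)\,g^{-1}$ for all $g,h\in G$; the pair $(G,\mathcal{D})$ is called a difference Lie group. A representation $(V,T,\Theta)$ of $(G,\mathcal{D})$ consists of a finite-dimensional real vector space $V$, a linear map $T:V\to V$ and a Lie group homomorphism $\Theta:G\to GL(V)$ such that $T(\Theta(g)u)+\Theta(g)u=\Theta(\mathcal{D}(g)g)T(u)+\Theta(\mathcal{D}(g)g)u$ for all $g\in G$, $u\in V$. Then $\Theta_{\mathcal{D}}:G\to GL(V)$, $\Theta_{\mathcal{D}}(g)=\Theta(\mathcal{D}(g)g)$, is also a representation of the Lie group $G$ on $V$. Normalized cochains: for $n\ge1$, $C^n(G,V)$ is the space of smooth maps $\alpha_n:G^n\to V$ with $\alpha_n(g_1,\dots,g_n)=0$ whenever some $g_i=e_G$. For a representation $\Theta$ of $G$ on $V$, the coboundary operator $\mathrm{d}^{\Theta}:C^n(G,V)\to C^{n+1}(G,V)$ is $$\mathrm{d}^{\Theta}(\alpha_n)(g_1,\dots,g_{n+1})=\Theta(g_1)\alpha_n(g_2,\dots,g_{n+1})+\sum_{i=1}^n(-1)^i\alpha_n(g_1,\dots,g_{i-1},g_ig_{i+1},g_{i+2},\dots,g_{n+1})+(-1)^{n+1}\alpha_n(g_1,\dots,g_n),$$ and $\mathrm{d}^{\Theta_{\mathcal{D}}}$ is defined by the same formula with $\Theta_{\mathcal{D}}$ in place of $\Theta$. All complexes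 start in degree $1$. Put $\mathfrak{C}^1(\mathcal{D},T)=0$ and $\mathfrak{C}^n(\mathcal{D},T)=C^{n-1}(G,V)$ for $n\ge2$, with differential $\mathrm{d}^{\Theta_{\mathcal{D}}}$. Put $C^1(G,\mathcal{D},V,T)=C^1(G,V)$ and $C^n(G,\mathcal{D},V,T)=C^n(G,V)\oplus\mathfrak{C}^n(\mathcal{D},T)$ for $n\ge2$. The coboundary operator $\delta:C^n(G,\mathcal{D},V,T)\to C^{n+1}(G,\mathcal{D},V,T)$ (which satisfies $\delta\circ\delta=0$) is $$\delta(\alpha_n,\beta_{n-1})=\big(\mathrm{d}^{\Theta}\alpha_n,\ \mathrm{d}^{\Theta_{\mathcal{D}}}\beta_{n-1}+\mathfrak{K}(\alpha_n)\big)$$ (with no $\beta$-component when $n=1$), where $\mathfrak{K}:C^n(G,V)\to\mathfrak{C}^{n+1}(\mathcal{D},T)=C^n(G,V)$ is $\mathfrak{K}=\mathfrak{K}'+\widehat{\mathfrak{K}}$ with $$\mathfrak{K}'(\alpha_1)(g_1)=-\Theta(\mathcal{D}(g_1))\alpha_1(g_1)+\alpha_1(\mathcal{D}(g_1)g_1)-\alpha_1(\mathcal{D}(g_1)),$$ $$\mathfrak{K}'(\alpha_2)(g_1,g_2)=\alpha_2(\mathcal{D}(g_1),g_1)-\alpha_2(\mathcal{D}(g_1g_2),g_1g_2)+\Theta(\mathcal{D}(g_1)g_1)\alpha_2(\mathcal{D}(g_2),g_2),$$ $\mathfrak{K}'(\alpha_n)=0$ for $n\ge3$, and for all $n\ge1$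 $$\widehat{\mathfrak{K}}(\alpha_n)(g_1,\dots,g_n)=(-1)^n\Big(\alpha_n(\mathcal{D}(g_1)g_1,\dots,\mathcal{D}(g_n)g_n)-T(\alpha_n(g_1,\dots,g_n))-\alpha_n(g_1,\dots,g_n)\Big).$$ $\mathcal{H}^n(G,V)$, $\mathcal{H}^n(\mathcal{D},T)$ and $\mathcal{H}^n(G,\mathcal{D},V,T)$ denote the $n$-th cohomology groups of $(\bigoplus_{n\ge1}C^n(G,V),\mathrm{d}^{\Theta})$, $(\bigoplus_{n\ge1}\mathfrak{C}^n(\mathcal{D},T),\mathrm{d}^{\Theta_{\mathcal{D}}})$ and $(\bigoplus_{n\ge1}C^n(G,\mathcal{D},V,T),\delta)$ respectively. *)

theory Defs
  imports "HOL-Analysis.Analysis" "HOL-Algebra.Elementary_Groups"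
begin

section \<open>Smooth manifolds\<close>

text \<open>
  The space \<open>\<real>\<^sup>n\<close> is \<^const>\<open>Euclidean_space\<close> \<open>n\<close>, i.e. the functions \<open>nat \<Rightarrow> real\<close> vanishing from
  index \<open>n\<close> on, so that dimensions can vary inside a statement.
  \<open>Ck_on n k U f\<close>: on the open subset \<open>U\<close> of \<open>\<real>\<^sup>n\<close>, all iterated partial derivatives of \<open>f\<close> of
  order at most \<open>k\<close> exist and are continuous. Values of \<open>f\<close> outside \<open>U\<close> are irrelevant.
\<close>

primrec Ck_on :: "nat \<Rightarrow> nat \<Rightarrow> (nat \<Rightarrow> real) set \<Rightarrow> ((nat \<Rightarrow> real) \<Rightarrow> real) \<Rightarrow> bool" where
  "Ck_on n 0 U f \<longleftrightarrow>
     continuous_map (subtopology (Euclidean_space n) U) euclideanreal f"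
| "Ck_on n (Suc k) U f \<longleftrightarrow>
     continuous_map (subtopology (Euclidean_space n) U) euclideanreal f \<and>
     (\<forall>i<n. \<exists>f'. (\<forall>x\<in>U. ((\<lambda>t. f (x(i := t))) has_real_derivative f' x) (at (x i))) \<and>
                 Ck_on n k U f')"

definition smooth_on :: "nat \<Rightarrow> nat \<Rightarrow> (nat \<Rightarrow> real) set \<Rightarrow> ((nat \<Rightarrow> real) \<Rightarrow> (nat \<Rightarrow> real)) \<Rightarrow> bool"
  where "smooth_on n m U f \<longleftrightarrow> (\<forall>j<m. \<forall>k. Ck_on n k U (\<lambda>x. f x j))"

record 'a mfd =
  mtop :: "'a topology"
  mdim :: nat
  charts :: "('a set \<times> ('a \<Rightarrow> nat \<Rightarrow> real)) set"

definition smooth_manifold :: "'a mfd \<Rightarrow> bool" where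
  "smooth_manifold M \<longleftrightarrow>
     Hausdorff_space (mtop M) \<and> second_countable (mtop M) \<and>
     (\<Union>(U, \<phi>)\<in>charts M. U) = topspace (mtop M) \<and>
     (\<forall>(U, \<phi>)\<in>charts M.
        openin (mtop M) U \<and> openin (Euclidean_space (mdim M)) (\<phi> ` U) \<and>
        homeomorphic_map (subtopology (mtop M) U)
          (subtopology (Euclidean_space (mdim M)) (\<phi> ` U)) \<phi>) \<and>
     (\<forall>(U, \<phi>)\<in>charts M. \<forall>(W, \<psi>)\<in>charts M.
        smooth_on (mdim M) (mdim M) (\<phi> ` (U \<inter> W)) (\<psi> \<circ> inv_into U \<phi>))"

definition smooth_map :: "'a mfd \<Rightarrow> 'b mfd \<Rightarrow> ('a \<Rightarrow> 'b) \<Rightarrow> bool" where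
  "smooth_map M N f \<longleftrightarrow>
     continuous_map (mtop M) (mtop N) f \<and>
     (\<forall>(U, \<phi>)\<in>charts M. \<forall>(W, \<psi>)\<in>charts N.
        smooth_on (mdim M) (mdim N) (\<phi> ` (U \<inter> f -` W)) (\<psi> \<circ> f \<circ> inv_into U \<phi>))"

text \<open>The \<open>n\<close>-fold product \<open>M \<times> \<dots> \<times> M\<close>; its points are the lists of length \<open>n\<close>.
  The coordinates of the \<open>n\<close> factors are concatenated.\<close>

definition mfd_power :: "'a mfd \<Rightarrow> nat \<Rightarrow> 'a list mfd" where
  "mfd_power M n =
     \<lparr> mtop = pullback_topology {xs. length xs = n} (\<lambda>xs. \<lambda>i\<in>{..<n}. xs ! i)
                (product_topology (\<lambda>_. mtop M) {..<n}),
       mdim = n * mdim M,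
       charts = {({xs. length xs = n \<and> (\<forall>i<n. xs ! i \<in> fst (cs ! i))},
                  (\<lambda>xs k. if k < n * mdim M
                           then snd (cs ! (k div mdim M)) (xs ! (k div mdim M)) (k mod mdim M)
                           else 0)) | cs. length cs = n \<and> set cs \<subseteq> charts M} \<rparr>"

section \<open>Finite-dimensional vector spaces and their general linear groups\<close>

definition fin_dim :: "'v::real_vector itself \<Rightarrow> bool" where
  "fin_dim _ \<longleftrightarrow> (\<exists>B::'v set. finite B \<and> span B = UNIV)"

text \<open>The charts are all linear isomorphisms onto \<open>\<real>\<^sup>m\<close>; the topology is the coarsest one for
  which all linear functionals are continuous, which in finite dimension is the usual one.\<close>

definition vector_mfd :: "'v::real_vector mfd" where
  "vector_mfd =
     \<lparr> mtop = topology_generated_by {l -` W | (l :: 'v \<Rightarrow> real) W. linear l \<and> open W},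
       mdim = dim (UNIV :: 'v set),
       charts = {(UNIV, \<phi>) | \<phi>. (\<forall>i. linear (\<lambda>v. \<phi> v i)) \<and>
                   bij_betw \<phi> UNIV (topspace (Euclidean_space (dim (UNIV :: 'v set))))} \<rparr>"

definition GL :: "('v::real_vector \<Rightarrow> 'v) monoid" where
  "GL = \<lparr> carrier = {A. linear A \<and> bij A}, monoid.mult = (\<circ>), one = id \<rparr>"

text \<open>\<open>GL(V)\<close> as an open submanifold of \<open>End(V)\<close>, whose dual space is spanned by the functionals
  \<open>A \<mapsto> l (A u)\<close>. The chart attached to linear coordinates \<open>\<phi>\<close> on \<open>V\<close> lists the \<open>m * m\<close>
  entries of the matrix of \<open>A\<close> in these coordinates.\<close>

definition GL_mfd :: "('v::real_vector \<Rightarrow> 'v) mfd" where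
  "GL_mfd = (let m = dim (UNIV :: 'v set) in
     \<lparr> mtop = topology_generated_by
                {{A \<in> carrier GL. l (A u) \<in> W} | (l :: 'v \<Rightarrow> real) u W. linear l \<and> open W},
       mdim = m * m,
       charts = {(carrier GL,
                  (\<lambda>A k. if k < m * m
                          then \<phi> (A (inv_into UNIV \<phi> (\<lambda>i. if i = k mod m then 1 else 0))) (k div m)
                          else 0)) | \<phi>. (UNIV, \<phi>) \<in> charts (vector_mfd :: 'v mfd)} \<rparr>)"

section \<open>Difference Lie groups and their representations\<close>

definition lie_group :: "'g monoid \<Rightarrow> 'g mfd \<Rightarrow> bool" where
  "lie_group G M \<longleftrightarrow>
     group G \<and> smooth_manifold M \<and> topspace (mtop M) = carrier G \<and>
     smooth_map (mfd_power M 2) M (\<lambda>gs. gs ! 0 \<otimes>\<^bsub>G\<^esub> gs ! 1) \<and>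
     smooth_map M M (\<lambda>g. inv\<^bsub>G\<^esub> g)"

definition difference_operator :: "'g monoid \<Rightarrow> 'g mfd \<Rightarrow> ('g \<Rightarrow> 'g) \<Rightarrow> bool" where
  "difference_operator G M D \<longleftrightarrow>
     smooth_map M M D \<and>
     (\<forall>g\<in>carrier G. \<forall>h\<in>carrier G.
        D (g \<otimes>\<^bsub>G\<^esub> h) = D g \<otimes>\<^bsub>G\<^esub> g \<otimes>\<^bsub>G\<^esub> D h \<otimes>\<^bsub>G\<^esub> inv\<^bsub>G\<^esub> g)"

definition difference_lie_group :: "'g monoid \<Rightarrow> 'g mfd \<Rightarrow> ('g \<Rightarrow> 'g) \<Rightarrow> bool" where
  "difference_lie_group G M D \<longleftrightarrow> lie_group G M \<and> difference_operator G M D"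

definition difference_rep ::
  "'g monoid \<Rightarrow> 'g mfd \<Rightarrow> ('g \<Rightarrow> 'g) \<Rightarrow> ('v::real_vector \<Rightarrow> 'v) \<Rightarrow> ('g \<Rightarrow> 'v \<Rightarrow> 'v) \<Rightarrow> bool" where
  "difference_rep G M D T \<Theta> \<longleftrightarrow>
     fin_dim TYPE('v) \<and> linear T \<and>
     \<Theta> \<in> hom G GL \<and> smooth_map M GL_mfd \<Theta> \<and>
     (\<forall>g\<in>carrier G. \<forall>u.
        T (\<Theta> g u) + \<Theta> g u = \<Theta> (D g \<otimes>\<^bsub>G\<^esub> g) (T u) + \<Theta> (D g \<otimes>\<^bsub>G\<^esub> g) u)"

definition twisted_rep :: "'g monoid \<Rightarrow> ('g \<Rightarrow> 'g) \<Rightarrow> ('g \<Rightarrow> 'v \<Rightarrow> 'v) \<Rightarrow> 'g \<Rightarrow> 'v \<Rightarrow> 'v" where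
  "twisted_rep G D \<Theta> g = \<Theta> (D g \<otimes>\<^bsub>G\<^esub> g)"

section \<open>Cochain complexes and cohomology\<close>

text \<open>Complexes of abelian groups, in the multiplicative notation of HOL-Algebra. A complex that
  starts in degree 1 has the zero group in degree 0.\<close>

record 'a cochains =
  grp :: "nat \<Rightarrow> 'a monoid"
  diff :: "nat \<Rightarrow> 'a \<Rightarrow> 'a"

definition cochain_complex :: "'a cochains \<Rightarrow> bool" where
  "cochain_complex A \<longleftrightarrow>
     (\<forall>n. comm_group (grp A n) \<and> diff A n \<in> hom (grp A n) (grp A (Suc n)) \<and>
          (\<forall>x\<in>carrier (grp A n).
             diff A (Suc n) (diff A n x) = \<one>\<^bsub>grp A (Suc (Suc n))\<^esub>))"

definition cochain_map :: "'a cochains \<Rightarrow> 'b cochains \<Rightarrow> (nat \<Rightarrow> 'a \<Rightarrow> 'b) \<Rightarrow> bool" where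
  "cochain_map A B f \<longleftrightarrow>
     (\<forall>n. f n \<in> hom (grp A n) (grp B n) \<and>
          (\<forall>x\<in>carrier (grp A n). f (Suc n) (diff A n x) = diff B n (f n x)))"

text \<open>\<open>exact_seq\<close> and \<open>short_exact_sequence\<close> of HOL-Algebra require all groups to have elements
  of the same type.\<close>

definition exact_at ::
  "'a monoid \<Rightarrow> 'b monoid \<Rightarrow> 'c monoid \<Rightarrow> ('a \<Rightarrow> 'b) \<Rightarrow> ('b \<Rightarrow> 'c) \<Rightarrow> bool" where
  "exact_at A B C f g \<longleftrightarrow>
     group A \<and> group B \<and> group C \<and> f \<in> hom A B \<and> g \<in> hom B C \<and>
     f ` carrier A = kernel B C g"

definition short_exact_complexes ::
  "'a cochains \<Rightarrow> 'b cochains \<Rightarrow> 'c cochains \<Rightarrow> (nat \<Rightarrow> 'a \<Rightarrow> 'b) \<Rightarrow> (nat \<Rightarrow> 'b \<Rightarrow> 'c) \<Rightarrow> bool" where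
  "short_exact_complexes A B C i p \<longleftrightarrow>
     cochain_complex A \<and> cochain_complex B \<and> cochain_complex C \<and>
     cochain_map A B i \<and> cochain_map B C p \<and>
     (\<forall>n. i n \<in> mon (grp A n) (grp B n) \<and>
          exact_at (grp A n) (grp B n) (grp C n) (i n) (p n) \<and>
          p n \<in> epi (grp B n) (grp C n))"

definition cocycles :: "'a cochains \<Rightarrow> nat \<Rightarrow> 'a set" where
  "cocycles A n = kernel (grp A n) (grp A (Suc n)) (diff A n)"

definition coboundaries :: "'a cochains \<Rightarrow> nat \<Rightarrow> 'a set" where
  "coboundaries A n =
     (if n = 0 then {\<one>\<^bsub>grp A 0\<^esub>} else diff A (n - 1) ` carrier (grp A (n - 1)))"

definition cohomology :: "'a cochains \<Rightarrow> nat \<Rightarrow> 'a set monoid" where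
  "cohomology A n = (subgroup_generated (grp A n) (cocycles A n)) Mod (coboundaries A n)"

definition coclass :: "'a cochains \<Rightarrow> nat \<Rightarrow> 'a \<Rightarrow> 'a set" where
  "coclass A n x = coboundaries A n #>\<^bsub>grp A n\<^esub> x"

text \<open>For a cochain map \<open>f\<close>, this sends the class of \<open>x\<close> to the class of \<open>f x\<close>: the product of the
  image of the class with the coboundaries is the full class.\<close>

definition induced_map :: "'b cochains \<Rightarrow> (nat \<Rightarrow> 'a \<Rightarrow> 'b) \<Rightarrow> nat \<Rightarrow> 'a set \<Rightarrow> 'b set" where
  "induced_map B f n c = coboundaries B n <#>\<^bsub>grp B n\<^esub> (f n ` c)"

text \<open>The connecting map \<open>i\<^sup>-\<^sup>1 \<circ> d \<circ> p\<^sup>-\<^sup>1\<close> of a short exact sequence. The set of all elements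
  obtained from all representatives of \<open>c\<close> and all their lifts is a full cohomology class.\<close>

definition connecting_map ::
  "'a cochains \<Rightarrow> 'b cochains \<Rightarrow> (nat \<Rightarrow> 'a \<Rightarrow> 'b) \<Rightarrow> (nat \<Rightarrow> 'b \<Rightarrow> 'c) \<Rightarrow> nat \<Rightarrow> 'c set \<Rightarrow> 'a set" where
  "connecting_map A B i p n c =
     {x \<in> carrier (grp A (Suc n)).
        \<exists>y\<in>carrier (grp B n). p n y \<in> c \<and> i (Suc n) x = diff B n y}"

section \<open>The complexes of a difference Lie group\<close>

definition tuples :: "'g monoid \<Rightarrow> nat \<Rightarrow> 'g list set" where
  "tuples G n = {gs. length gs = n \<and> set gs \<subseteq> carrier G}"

text \<open>Functions on \<open>G\<^sup>n\<close> are represented by total functions on lists that vanish off \<open>G\<^sup>n\<close>.\<close>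

definition cochain_group :: "'g monoid \<Rightarrow> 'g mfd \<Rightarrow> nat \<Rightarrow> ('g list \<Rightarrow> 'v::real_vector) monoid" where
  "cochain_group G M n =
     \<lparr> carrier =
         (if n = 0 then {\<lambda>_. 0}
          else {\<alpha>. smooth_map (mfd_power M n) vector_mfd \<alpha> \<and>
                   (\<forall>gs\<in>tuples G n. \<one>\<^bsub>G\<^esub> \<in> set gs \<longrightarrow> \<alpha> gs = 0) \<and>
                   (\<forall>gs. gs \<notin> tuples G n \<longrightarrow> \<alpha> gs = 0)}),
       monoid.mult = (\<lambda>\<alpha> \<beta> gs. \<alpha> gs + \<beta> gs),
       one = (\<lambda>_. 0) \<rparr>"

definition group_coboundary ::
  "'g monoid \<Rightarrow> ('g \<Rightarrow> 'v::real_vector \<Rightarrow> 'v) \<Rightarrow> nat \<Rightarrow> ('g list \<Rightarrow> 'v) \<Rightarrow> 'g list \<Rightarrow> 'v" where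
  "group_coboundary G \<Theta> n \<alpha> = (\<lambda>gs. if gs \<in> tuples G (Suc n) then
       \<Theta> (gs ! 0) (\<alpha> (tl gs))
       + (\<Sum>i = 1..n. (- 1) ^ i *\<^sub>R
            \<alpha> (take (i - 1) gs @ [gs ! (i - 1) \<otimes>\<^bsub>G\<^esub> gs ! i] @ drop (i + 1) gs))
       + (- 1) ^ (n + 1) *\<^sub>R \<alpha> (take n gs)
     else 0)"

definition group_complex ::
  "'g monoid \<Rightarrow> 'g mfd \<Rightarrow> ('g \<Rightarrow> 'v::real_vector \<Rightarrow> 'v) \<Rightarrow> ('g list \<Rightarrow> 'v) cochains" where
  "group_complex G M \<Theta> = \<lparr> grp = cochain_group G M, diff = group_coboundary G \<Theta> \<rparr>"

text \<open>The complex of the operator: \<open>C\<^sup>n\<^sup>-\<^sup>1(G,V)\<close> in degree \<open>n \<ge> 2\<close> and zero in degree \<open>n \<le> 1\<close>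
  (\<open>cochain_group G M 0\<close> is the zero group).\<close>

definition operator_complex ::
  "'g monoid \<Rightarrow> 'g mfd \<Rightarrow> ('g \<Rightarrow> 'g) \<Rightarrow> ('g \<Rightarrow> 'v::real_vector \<Rightarrow> 'v) \<Rightarrow> ('g list \<Rightarrow> 'v) cochains" where
  "operator_complex G M D \<Theta> =
     \<lparr> grp = (\<lambda>n. cochain_group G M (n - 1)),
       diff = (\<lambda>n. group_coboundary G (twisted_rep G D \<Theta>) (n - 1)) \<rparr>"

definition K_prime ::
  "'g monoid \<Rightarrow> ('g \<Rightarrow> 'g) \<Rightarrow> ('g \<Rightarrow> 'v::real_vector \<Rightarrow> 'v) \<Rightarrow> nat \<Rightarrow> ('g list \<Rightarrow> 'v) \<Rightarrow> 'g list \<Rightarrow> 'v" where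
  "K_prime G D \<Theta> n \<alpha> gs =
     (if n = 1 then
        (let g = gs ! 0 in
           - \<Theta> (D g) (\<alpha> [g]) + \<alpha> [D g \<otimes>\<^bsub>G\<^esub> g] - \<alpha> [D g])
      else if n = 2 then
        (let g = gs ! 0; h = gs ! 1 in
           \<alpha> [D g, g] - \<alpha> [D (g \<otimes>\<^bsub>G\<^esub> h), g \<otimes>\<^bsub>G\<^esub> h] + \<Theta> (D g \<otimes>\<^bsub>G\<^esub> g) (\<alpha> [D h, h]))
      else 0)"

definition K_hat ::
  "'g monoid \<Rightarrow> ('g \<Rightarrow> 'g) \<Rightarrow> ('v::real_vector \<Rightarrow> 'v) \<Rightarrow> nat \<Rightarrow> ('g list \<Rightarrow> 'v) \<Rightarrow> 'g list \<Rightarrow> 'v" where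
  "K_hat G D T n \<alpha> gs =
     (- 1) ^ n *\<^sub>R (\<alpha> (map (\<lambda>g. D g \<otimes>\<^bsub>G\<^esub> g) gs) - T (\<alpha> gs) - \<alpha> gs)"

definition K_map ::
  "'g monoid \<Rightarrow> ('g \<Rightarrow> 'g) \<Rightarrow> ('v::real_vector \<Rightarrow> 'v) \<Rightarrow> ('g \<Rightarrow> 'v \<Rightarrow> 'v) \<Rightarrow>
     nat \<Rightarrow> ('g list \<Rightarrow> 'v) \<Rightarrow> 'g list \<Rightarrow> 'v" where
  "K_map G D T \<Theta> n \<alpha> =
     (\<lambda>gs. if gs \<in> tuples G n then K_prime G D \<Theta> n \<alpha> gs + K_hat G D T n \<alpha> gs else 0)"

text \<open>In degree 1 the second summand is the zero group, so this is \<open>C\<^sup>1(G,V)\<close>, and the first summand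
  of the second component of the differential vanishes there.\<close>

definition total_complex ::
  "'g monoid \<Rightarrow> 'g mfd \<Rightarrow> ('g \<Rightarrow> 'g) \<Rightarrow> ('v::real_vector \<Rightarrow> 'v) \<Rightarrow> ('g \<Rightarrow> 'v \<Rightarrow> 'v) \<Rightarrow>
     (('g list \<Rightarrow> 'v) \<times> ('g list \<Rightarrow> 'v)) cochains" where
  "total_complex G M D T \<Theta> =
     \<lparr> grp = (\<lambda>n. grp (group_complex G M \<Theta>) n \<times>\<times> grp (operator_complex G M D \<Theta>) n),
       diff = (\<lambda>n (\<alpha>, \<beta>).
         (diff (group_complex G M \<Theta>) n \<alpha>,
          (\<lambda>gs. diff (operator_complex G M D \<Theta>) n \<beta> gs + K_map G D T \<Theta> n \<alpha> gs))) \<rparr>"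

definition i_map :: "nat \<Rightarrow> ('g list \<Rightarrow> 'v::real_vector) \<Rightarrow> ('g list \<Rightarrow> 'v) \<times> ('g list \<Rightarrow> 'v)" where
  "i_map n \<beta> = ((\<lambda>_. 0), \<beta>)"

definition p_map :: "nat \<Rightarrow> ('g list \<Rightarrow> 'v) \<times> ('g list \<Rightarrow> 'v) \<Rightarrow> ('g list \<Rightarrow> 'v)" where
  "p_map n = fst"

end

theory Submission
  imports Defs
begin

text \<open>
  Smoothness of maps into \<open>V\<close> and \<open>GL(V)\<close> is tested on linear functionals and matrix entries, so that
  smoothness of all cochains reduces to composing real-valued functions with smooth maps
  between powers of \<open>G\<close>, i.e. to the chain rule.

  Put \<open>F(g) = D(g) g\<close>, an endomorphism of \<open>G\<close>, and \<open>L = T + id\<close>. The part \<open>K_hat\<close> of \<open>K\<close> is, up to sign,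
  \<open>F\<^sup>* - L\<close>, where \<open>F\<^sup>*\<close> and \<open>L\<close> both intertwine the two coboundary operators. With
  \<open>c(\<alpha>)(g) = \<alpha>(D(g), g)\<close>, the part \<open>K_prime\<close> is \<open>- c \<circ> d\<close> in degree 1 and \<open>d\<^sub>D \<circ> c\<close> in degree 2, so
  \<open>d\<^sub>D K + K d = 0\<close> follows from \<open>d\<^sub>D\<^sup>2 = 0\<close>. The total complex is thus the cone of \<open>K\<close>, the sequence of
  complexes splits in each degree, and lifting a cocycle \<open>\<alpha>\<close> to \<open>(\<alpha>, 0)\<close> identifies the connecting
  map with \<open>K\<close>.
\<close>

section \<open>Differentiable functions on open subsets of Euclidean spaces\<close>

text \<open>\<open>K_prime\<close> is the commutator \<open>dD c - c d\<close>, where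
  \<open>c\<close> acts on 2-cochains and is zero in all other degrees. This is why it stops after
  degree 2, and it anticommutes with the differentials for formal reasons. \<open>K_hat\<close> owes
  its anticommutation to the sign \<open>(- 1) ^ n\<close>: a difference of two intertwining maps
  commutes with the differentials, while a cone asks for the opposite sign.

  Two obstacles shape the analytic half. \<open>Ck_on\<close> speaks of partial derivatives only, so
  the chain rule has to be derived from the continuity of the partials, by induction on the order.
  And the charts of \<open>mfd_power\<close> are just products of charts of the base; maps between
  powers are therefore treated factor by factor, through projections and lists of smooth maps.

  The complexes are indexed by all natural numbers, with the zero group in degree 0. Truncated
  subtraction makes the operator complex zero in degrees 0 and 1, and the general long exact
  sequence then applies to complexes that start in degree 1.\<close>

lemma Euclidean_space_eq: "Euclidean_space n = top_of_set {x. \<forall>i\<ge>n. x i = 0}"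
  by (simp add: Euclidean_space_def euclidean_product_topology)

lemma continuous_map_Euclidean_subset_iff:
  fixes f :: "(nat \<Rightarrow> real) \<Rightarrow> 'b::topological_space"
  assumes "U \<subseteq> topspace (Euclidean_space n)"
  shows "continuous_map (subtopology (Euclidean_space n) U) euclidean f \<longleftrightarrow> continuous_on U f"
  using assms
  by (simp add: Euclidean_space_eq subtopology_subtopology topspace_Euclidean_space inf_absorb2)

text \<open>A basic open set of the product topology may restrict any coordinate. Points of
  \<open>Euclidean_space n\<close> have zeros from \<open>n\<close> on, so the minimum of the first
  \<open>n\<close> radii suffices.\<close>

lemma openin_Euclidean_box:
  assumes "openin (Euclidean_space n) U" "x \<in> U"
  obtains e where "e > 0"
    "\<And>y. y \<in> topspace (Euclidean_space n) \<Longrightarrow> (\<And>i. i < n \<Longrightarrow> \<bar>y i - x i\<bar> < e) \<Longrightarrow> y \<in> U"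
proof -
  obtain S where S: "open S" "U = {x. \<forall>i\<ge>n. x i = 0} \<inter> S"
    using assms(1) unfolding Euclidean_space_eq openin_open by blast
  have "openin (product_topology (\<lambda>i. euclidean) UNIV) S" "x \<in> S"
    using S assms(2) by (auto simp: euclidean_product_topology)
  then obtain X where X: "x \<in> Pi\<^sub>E UNIV X" "\<And>i. open (X i)" "Pi\<^sub>E UNIV X \<subseteq> S"
    using product_topology_open_contains_basis[of "\<lambda>i. euclidean" UNIV S x] by auto
  have "\<forall>i. \<exists>e>0. \<forall>y. \<bar>y - x i\<bar> < e \<longrightarrow> y \<in> X i"
    using X(1,2) by (auto simp: open_real PiE_iff dist_real_def open_dist)
  then obtain e where e: "\<And>i. e i > 0" "\<And>i y. \<bar>y - x i\<bar> < e i \<Longrightarrow> y \<in> X i"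
    by metis
  \<comment> \<open>The entry 1 keeps the minimum defined for \<open>n = 0\<close>.\<close>
  define d where "d = Min (insert 1 (e ` {..<n}))"
  show thesis
  proof
    show "d > 0" unfolding d_def using e(1) by (subst Min_gr_iff) auto
    fix y assume y: "y \<in> topspace (Euclidean_space n)" "\<And>i. i < n \<Longrightarrow> \<bar>y i - x i\<bar> < d"
    have "y i \<in> X i" for i
    proof (cases "i < n")
      case True
      then have "d \<le> e i" unfolding d_def by (intro Min_le) auto
      with y(2)[OF True] e(2)[of "y i" i] show ?thesis by linarith
    next
      case False
      then have "y i = x i"
        using y(1) assms(2) S(2) by (auto simp: topspace_Euclidean_space)
      then show ?thesis using e by auto
    qed
    then have "y \<in> S" using X(3) by auto
    then show "y \<in> U" using S(2) y(1) by (auto simp: topspace_Euclidean_space)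
  qed
qed

text \<open>Partial derivatives are those of a total function along a coordinate line; this keeps
  the line inside \<open>U\<close> near its base point, where the function is under control.\<close>

lemma openin_Euclidean_upd:
  assumes "openin (Euclidean_space n) U" "x \<in> U" "i < n"
  shows "\<forall>\<^sub>F t in nhds (x i). x(i := t) \<in> U"
proof -
  obtain e where e: "e > 0"
    "\<And>y. y \<in> topspace (Euclidean_space n) \<Longrightarrow> (\<And>i. i < n \<Longrightarrow> \<bar>y i - x i\<bar> < e) \<Longrightarrow> y \<in> U"
    using openin_Euclidean_box[OF assms(1,2)] by blast
  have x: "x \<in> topspace (Euclidean_space n)"
    using assms openin_subset by blast
  have "x(i := t) \<in> U" if "dist t (x i) < e" for t
    using that x assms(3) e(1) by (intro e(2)) (auto simp: topspace_Euclidean_space dist_real_def)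
  then show ?thesis
    unfolding eventually_nhds_metric using e(1) by blast
qed

lemma tendsto_fun_iff:
  fixes f :: "'a \<Rightarrow> 'b \<Rightarrow> 'c::topological_space"
  shows "(f \<longlongrightarrow> l) F \<longleftrightarrow> (\<forall>i. ((\<lambda>x. f x i) \<longlongrightarrow> l i) F)"
  using limitin_componentwise[of "\<lambda>_. euclidean" UNIV f l F]
  by (simp add: euclidean_product_topology)

text \<open>Continuous partial derivatives suffice: replace the coordinates of \<open>c t0\<close> by those of \<open>c t\<close> one
  at a time (\<open>h j t\<close> has the first \<open>j\<close> replaced) and apply the mean value theorem to each step.\<close>

lemma DERIV_along_curve:
  assumes U: "openin (Euclidean_space n) U"
    and fd: "\<And>i x. i < n \<Longrightarrow> x \<in> U \<Longrightarrow> ((\<lambda>t. f (x(i := t))) has_real_derivative fd i x) (at (x i))"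
    and cont: "\<And>i. i < n \<Longrightarrow> continuous_on U (fd i)"
    and c0: "c t0 \<in> U"
    and ct: "\<forall>\<^sub>F t in nhds t0. c t \<in> topspace (Euclidean_space n)"
    and cd: "\<And>i. i < n \<Longrightarrow> ((\<lambda>t. c t i) has_real_derivative c' i) (at t0)"
  shows "((\<lambda>t. f (c t)) has_real_derivative (\<Sum>i<n. fd i (c t0) * c' i)) (at t0)"
proof -
  define h where "h j t = (\<lambda>i. if i < j then c t i else c t0 i)" for j t
  obtain e where e: "e > 0"
    "\<And>y. y \<in> topspace (Euclidean_space n) \<Longrightarrow> (\<And>i. i < n \<Longrightarrow> \<bar>y i - c t0 i\<bar> < e) \<Longrightarrow> y \<in> U"
    using openin_Euclidean_box[OF U c0] by blast
  have c0z: "c t0 i = 0" if "i \<ge> n" for i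
    using c0 openin_subset[OF U] that by (auto simp: topspace_Euclidean_space)
  have clim: "((\<lambda>t. c t i) \<longlongrightarrow> c t0 i) (at t0)" if "i < n" for i
    using DERIV_isCont[OF cd[OF that]] by (simp add: isCont_def)
  have near: "\<forall>\<^sub>F t in at t0. \<forall>i<n. \<bar>c t i - c t0 i\<bar> < e"
  proof -
    have "\<forall>\<^sub>F t in at t0. \<forall>i\<in>{..<n}. \<bar>c t i - c t0 i\<bar> < e"
      using clim e(1) by (intro eventually_ball_finite) (auto simp: tendsto_iff dist_real_def)
    then show ?thesis by (simp add: Ball_def)
  qed
  have "((\<lambda>t. f (h j t)) has_real_derivative (\<Sum>i<j. fd i (c t0) * c' i)) (at t0)" if "j \<le> n" for j
    using that
  proof (induction j)
    case 0
    then show ?case by (simp add: h_def)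
  next
    case (Suc j)
    then have j: "j < n" by simp
    define g where "g t s = f ((h j t)(j := s))" for t s
    have hS: "h (Suc j) t = (h j t)(j := c t j)" and hj: "h j t = (h j t)(j := c t0 j)" for t
      by (auto simp: h_def fun_eq_iff less_Suc_eq)
    \<comment> \<open>Each coordinate of \<open>h j t\<close> is one of \<open>c t\<close> or of
      \<open>c t0\<close>, and \<open>s\<close> is no farther from \<open>c t0 j\<close> than
      \<open>c t j\<close> is. Hence the box around \<open>c t0\<close> contains all points of the
      mean value argument.\<close>
    have inU: "(h j t)(j := s) \<in> U"
      if "\<forall>i<n. \<bar>c t i - c t0 i\<bar> < e" "\<bar>s - c t0 j\<bar> \<le> \<bar>c t j - c t0 j\<bar>" for t s
    proof (rule e(2))
      show "(h j t)(j := s) \<in> topspace (Euclidean_space n)"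
        using j c0z by (auto simp: topspace_Euclidean_space h_def)
      show "\<bar>((h j t)(j := s)) i - c t0 i\<bar> < e" if "i < n" for i
        using that \<open>\<forall>i<n. _\<close> \<open>\<bar>s - _\<bar> \<le> _\<close> j e(1) by (auto simp: h_def intro: le_less_trans)
    qed
    have mvt: "\<exists>s. \<bar>s - c t0 j\<bar> \<le> \<bar>c t j - c t0 j\<bar> \<and>
        g t (c t j) - g t (c t0 j) = (c t j - c t0 j) * fd j ((h j t)(j := s))"
      if t: "\<forall>i<n. \<bar>c t i - c t0 i\<bar> < e" for t
    proof -
      have d: "(g t has_real_derivative fd j ((h j t)(j := s))) (at s)"
        if "\<bar>s - c t0 j\<bar> \<le> \<bar>c t j - c t0 j\<bar>" for s
        using fd[OF j inU[OF t that]] unfolding g_def by simp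
      consider "c t j = c t0 j" | "c t j < c t0 j" | "c t j > c t0 j" by linarith
      then show ?thesis
      proof cases
        case 2
        with MVT2[OF 2, of "g t" "\<lambda>s. fd j ((h j t)(j := s))"] d
        obtain s where "c t j < s" "s < c t0 j"
          "g t (c t0 j) - g t (c t j) = (c t0 j - c t j) * fd j ((h j t)(j := s))"
          by auto
        then show ?thesis by (intro exI[of _ s]) (auto simp: algebra_simps)
      next
        case 3
        with MVT2[OF 3, of "g t" "\<lambda>s. fd j ((h j t)(j := s))"] d
        obtain s where "c t0 j < s" "s < c t j"
          "g t (c t j) - g t (c t0 j) = (c t j - c t0 j) * fd j ((h j t)(j := s))"
          by auto
        then show ?thesis by (intro exI[of _ s]) auto
      qed auto
    qed
    \<comment> \<open>The intermediate point is chosen separately for each \<open>t\<close>, with no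
      regularity in \<open>t\<close>. Its distance bound alone forces it to converge to
      \<open>c t0 j\<close>.\<close>
    define \<xi> where "\<xi> t = (SOME s. \<bar>s - c t0 j\<bar> \<le> \<bar>c t j - c t0 j\<bar> \<and>
        g t (c t j) - g t (c t0 j) = (c t j - c t0 j) * fd j ((h j t)(j := s)))" for t
    have \<xi>: "\<bar>\<xi> t - c t0 j\<bar> \<le> \<bar>c t j - c t0 j\<bar>"
        "g t (c t j) - g t (c t0 j) = (c t j - c t0 j) * fd j ((h j t)(j := \<xi> t))"
      if "\<forall>i<n. \<bar>c t i - c t0 i\<bar> < e" for t
      using someI_ex[OF mvt[OF that]] by (auto simp: \<xi>_def)
    have ev_le: "\<forall>\<^sub>F t in at t0. \<bar>\<xi> t - c t0 j\<bar> \<le> \<bar>c t j - c t0 j\<bar>"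
      using near by eventually_elim (rule \<xi>)
    have "((\<lambda>t. \<xi> t - c t0 j) \<longlongrightarrow> 0) (at t0)"
    proof (rule Lim_null_comparison[where g = "\<lambda>t. \<bar>c t j - c t0 j\<bar>"])
      show "\<forall>\<^sub>F t in at t0. norm (\<xi> t - c t0 j) \<le> \<bar>c t j - c t0 j\<bar>"
        using ev_le by simp
      show "((\<lambda>t. \<bar>c t j - c t0 j\<bar>) \<longlongrightarrow> 0) (at t0)"
        using clim[OF j] by (simp add: LIM_zero tendsto_rabs_zero)
    qed
    then have \<xi>lim: "(\<xi> \<longlongrightarrow> c t0 j) (at t0)"
      by (rule LIM_zero_cancel)
    have plim: "((\<lambda>t. (h j t)(j := \<xi> t)) \<longlongrightarrow> c t0) (at t0)"
      unfolding tendsto_fun_iff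
    proof
      fix i
      show "((\<lambda>t. ((h j t)(j := \<xi> t)) i) \<longlongrightarrow> c t0 i) (at t0)"
        using \<xi>lim clim[of i] j by (cases "i = j"; cases "i < j") (simp_all add: h_def)
    qed
    have pU: "\<forall>\<^sub>F t in at t0. (h j t)(j := \<xi> t) \<in> U"
      using near ev_le by eventually_elim (rule inU)
    \<comment> \<open>The continuity of the partial derivatives enters here: \<open>fd j\<close> is
      evaluated at moving points that converge to \<open>c t0\<close>.\<close>
    have fdlim: "((\<lambda>t. fd j ((h j t)(j := \<xi> t))) \<longlongrightarrow> fd j (c t0)) (at t0)"
      by (rule continuous_on_tendsto_compose[OF cont[OF j] plim c0 pU])
    have quot: "((\<lambda>t. (c t j - c t0 j) / (t - t0)) \<longlongrightarrow> c' j) (at t0)"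
      using cd[OF j] by (simp add: has_field_derivative_iff)
    have "((\<lambda>t. (g t (c t j) - g t (c t0 j)) / (t - t0)) \<longlongrightarrow> fd j (c t0) * c' j) (at t0)"
    proof (rule Lim_transform_eventually[OF tendsto_mult[OF fdlim quot]])
      show "\<forall>\<^sub>F t in at t0. fd j ((h j t)(j := \<xi> t)) * ((c t j - c t0 j) / (t - t0)) =
          (g t (c t j) - g t (c t0 j)) / (t - t0)"
        using near by eventually_elim (simp add: \<xi>(2))
    qed
    then have "((\<lambda>t. g t (c t j) - g t (c t0 j)) has_real_derivative fd j (c t0) * c' j) (at t0)"
      by (simp add: has_field_derivative_iff)
    from DERIV_add[OF Suc.IH this] j
    have "((\<lambda>t. f (h j t) + (g t (c t j) - g t (c t0 j))) has_real_derivative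
        (\<Sum>i<Suc j. fd i (c t0) * c' i)) (at t0)"
      by simp
    moreover have "f (h j t) + (g t (c t j) - g t (c t0 j)) = f (h (Suc j) t)" for t
      using hj[of t] by (simp add: g_def hS)
    ultimately show ?case by simp
  qed
  \<comment> \<open>\<open>h n t\<close> is \<open>c t\<close> only if the coordinates of
    \<open>c t\<close> from \<open>n\<close> on vanish. By \<open>ct\<close> they do so for
    \<open>t\<close> near \<open>t0\<close>, hence the transfer along an eventual equality.\<close>
  from this[OF order_refl] show ?thesis
  proof (rule DERIV_cong_ev[OF refl _ refl, THEN iffD1, rotated])
    show "\<forall>\<^sub>F t in nhds t0. f (h n t) = f (c t)"
      using ct
    proof eventually_elim
      case (elim t)
      then have "h n t = c t" using c0z by (auto simp: h_def fun_eq_iff topspace_Euclidean_space)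
      then show ?case by simp
    qed
  qed
qed

section \<open>Functions of class C^k: algebra, locality and composition\<close>

lemma Ck_on_continuous: "Ck_on n k U f \<Longrightarrow> continuous_map (subtopology (Euclidean_space n) U) euclideanreal f"
  by (cases k) auto

lemma Ck_on_SucD: "Ck_on n (Suc k) U f \<Longrightarrow> Ck_on n k U f"
  by (induction k arbitrary: f) (auto, blast)

lemma Ck_on_Suc_ex:
  "Ck_on n (Suc k) U f \<Longrightarrow> i < n \<Longrightarrow>
    \<exists>f'. (\<forall>x\<in>U. ((\<lambda>t. f (x(i := t))) has_real_derivative f' x) (at (x i))) \<and> Ck_on n k U f'"
  by simp

lemma Ck_on_subset: "Ck_on n k U f \<Longrightarrow> W \<subseteq> U \<Longrightarrow> Ck_on n k W f"
  by (induction k arbitrary: f) (auto intro: continuous_map_from_subtopology_mono, blast intro: continuous_map_from_subtopology_mono)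

lemma Ck_on_const: "Ck_on n k U (\<lambda>_. c)"
  by (induction k arbitrary: c) (auto intro!: exI[of _ "\<lambda>_. 0"])

lemma Ck_on_coord: "Ck_on n k U (\<lambda>x. x i)"
proof -
  have c: "continuous_map (subtopology (Euclidean_space n) U) euclideanreal (\<lambda>x. x i)"
    unfolding Euclidean_space_def
    by (intro continuous_map_from_subtopology continuous_map_product_projection) auto
  show ?thesis
  proof (cases k)
    case (Suc l)
    have "((\<lambda>t. (x(j := t)) i) has_real_derivative (if i = j then 1 else 0)) (at (x j))" for x :: "nat \<Rightarrow> real" and j
      by (cases "i = j") auto
    then show ?thesis
      using c Suc Ck_on_const by (auto intro!: exI[of _ "\<lambda>_. if i = _ then 1 else 0"])
  qed (use c in simp)
qed

lemma Ck_on_add: "Ck_on n k U f \<Longrightarrow> Ck_on n k U g \<Longrightarrow> Ck_on n k U (\<lambda>x. f x + g x)"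
proof (induction k arbitrary: f g)
  case (Suc k)
  have "\<exists>h. (\<forall>x\<in>U. ((\<lambda>t. f (x(i := t)) + g (x(i := t))) has_real_derivative h x) (at (x i))) \<and> Ck_on n k U h"
    if i: "i < n" for i
  proof -
    obtain f' where "\<And>x. x \<in> U \<Longrightarrow> ((\<lambda>t. f (x(i := t))) has_real_derivative f' x) (at (x i))" "Ck_on n k U f'"
      using Ck_on_Suc_ex[OF Suc.prems(1) i] by blast
    moreover obtain g' where "\<And>x. x \<in> U \<Longrightarrow> ((\<lambda>t. g (x(i := t))) has_real_derivative g' x) (at (x i))" "Ck_on n k U g'"
      using Ck_on_Suc_ex[OF Suc.prems(2) i] by blast
    ultimately show ?thesis
      by (intro exI[of _ "\<lambda>x. f' x + g' x"] conjI ballI DERIV_add Suc.IH) auto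
  qed
  with Suc.prems show ?case by (auto intro: continuous_map_add)
qed (auto intro: continuous_map_add)

lemma Ck_on_mult: "Ck_on n k U f \<Longrightarrow> Ck_on n k U g \<Longrightarrow> Ck_on n k U (\<lambda>x. f x * g x)"
proof (induction k arbitrary: f g)
  case (Suc k)
  have "\<exists>h. (\<forall>x\<in>U. ((\<lambda>t. f (x(i := t)) * g (x(i := t))) has_real_derivative h x) (at (x i))) \<and> Ck_on n k U h"
    if i: "i < n" for i
  proof -
    obtain f' where f': "\<And>x. x \<in> U \<Longrightarrow> ((\<lambda>t. f (x(i := t))) has_real_derivative f' x) (at (x i))" "Ck_on n k U f'"
      using Ck_on_Suc_ex[OF Suc.prems(1) i] by blast
    obtain g' where g': "\<And>x. x \<in> U \<Longrightarrow> ((\<lambda>t. g (x(i := t))) has_real_derivative g' x) (at (x i))" "Ck_on n k U g'"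
      using Ck_on_Suc_ex[OF Suc.prems(2) i] by blast
    show ?thesis
    proof (intro exI[of _ "\<lambda>x. f' x * g x + g' x * f x"] conjI ballI)
      fix x assume "x \<in> U"
      with f' g' DERIV_mult[of "\<lambda>t. f (x(i := t))" "f' x" "x i" UNIV "\<lambda>t. g (x(i := t))" "g' x"]
      show "((\<lambda>t. f (x(i := t)) * g (x(i := t))) has_real_derivative f' x * g x + g' x * f x) (at (x i))"
        by simp
    qed (intro Ck_on_add Suc.IH f' g' Ck_on_SucD[OF Suc.prems(1)] Ck_on_SucD[OF Suc.prems(2)])
  qed
  with Suc.prems show ?case by (auto intro: continuous_map_real_mult)
qed (auto intro: continuous_map_real_mult)

lemma Ck_on_sum: "(\<And>i. i \<in> I \<Longrightarrow> Ck_on n k U (f i)) \<Longrightarrow> Ck_on n k U (\<lambda>x. \<Sum>i\<in>I. f i x)"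
  by (induction I rule: infinite_finite_induct) (auto intro: Ck_on_add Ck_on_const)

text \<open>The derivatives are those of total functions and also see values away from
  \<open>x\<close>. Openness of \<open>U\<close> turns equality on \<open>U\<close> into equality
  along the coordinate line near \<open>x i\<close>.\<close>

lemma Ck_on_cong:
  assumes U: "openin (Euclidean_space n) U" and "Ck_on n k U f" and eq: "\<And>x. x \<in> U \<Longrightarrow> f x = g x"
  shows "Ck_on n k U g"
proof -
  have c: "continuous_map (subtopology (Euclidean_space n) U) euclideanreal g"
    using Ck_on_continuous[OF assms(2)] by (rule continuous_map_eq) (simp add: eq)
  show ?thesis
  proof (cases k)
    case (Suc l)
    have "\<exists>h. (\<forall>x\<in>U. ((\<lambda>t. g (x(i := t))) has_real_derivative h x) (at (x i))) \<and> Ck_on n l U h"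
      if i: "i < n" for i
    proof -
      obtain f' where f':
        "\<And>x. x \<in> U \<Longrightarrow> ((\<lambda>t. f (x(i := t))) has_real_derivative f' x) (at (x i))" "Ck_on n l U f'"
        using Ck_on_Suc_ex[OF assms(2)[unfolded Suc] i] by blast
      have "((\<lambda>t. g (x(i := t))) has_real_derivative f' x) (at (x i))" if "x \<in> U" for x
      proof -
        have "\<forall>\<^sub>F t in nhds (x i). f (x(i := t)) = g (x(i := t))"
          using openin_Euclidean_upd[OF U that i] by eventually_elim (rule eq)
        then show ?thesis
          using f'(1)[OF that] by (rule DERIV_cong_ev[OF refl _ refl, THEN iffD1])
      qed
      with f'(2) show ?thesis by blast
    qed
    with c Suc show ?thesis by simp
  qed (use c in simp)
qed

lemma Ck_on_local:
  assumes loc: "\<And>x. x \<in> U \<Longrightarrow> \<exists>W. openin (Euclidean_space n) W \<and> x \<in> W \<and> W \<subseteq> U \<and> Ck_on n k W f"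
  shows "Ck_on n k U f"
  using loc
proof (induction k arbitrary: f)
  case (0 f)
  have U: "openin (Euclidean_space n) U"
    using 0 by (subst openin_subopen) blast
  have "U \<subseteq> topspace (Euclidean_space n)" using U openin_subset by blast
  have "continuous_on U f"
    unfolding continuous_on_eq_continuous_within
  proof
    fix x assume "x \<in> U"
    with 0 obtain W where W: "openin (Euclidean_space n) W" "x \<in> W" "W \<subseteq> U" "Ck_on n 0 W f" by blast
    then have "continuous_on W f"
      using continuous_map_Euclidean_subset_iff[of W n f] openin_subset by auto
    then have cw: "continuous (at x within W) f"
      using W(2) by (simp add: continuous_on_eq_continuous_within)
    obtain S where S: "open S" "W = {x. \<forall>i\<ge>n. x i = 0} \<inter> S"
      using W(1) unfolding Euclidean_space_eq openin_open by blast
    have "W = U \<inter> S" using S W(3) \<open>U \<subseteq> _\<close> by (auto simp: topspace_Euclidean_space)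
    then have "at x within W = at x within U"
      using S(1) W(2) by (intro at_within_nhd[of _ S]) auto
    with cw show "continuous (at x within U) f" by (simp add: continuous_within)
  qed
  then show ?case
    using continuous_map_Euclidean_subset_iff[of U n f] \<open>U \<subseteq> _\<close> by simp
next
  case (Suc k f)
  have c: "Ck_on n k U f"
    using Suc.prems by (intro Suc.IH) (meson Ck_on_SucD)
  have "\<exists>h. (\<forall>x\<in>U. ((\<lambda>t. f (x(i := t))) has_real_derivative h x) (at (x i))) \<and> Ck_on n k U h"
    if i: "i < n" for i
  proof -
    \<comment> \<open>The derivatives supplied by different sets \<open>W\<close> are unrelated as
      total functions; \<open>deriv\<close> selects one function that agrees with each of them on
      its \<open>W\<close>.\<close>
    define h where "h x = deriv (\<lambda>t. f (x(i := t))) (x i)" for x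
    have *: "\<exists>W. openin (Euclidean_space n) W \<and> x \<in> W \<and> W \<subseteq> U \<and> Ck_on n k W h \<and>
        ((\<lambda>t. f (x(i := t))) has_real_derivative h x) (at (x i))" if x: "x \<in> U" for x
    proof -
      from Suc.prems[OF x] obtain W where W: "openin (Euclidean_space n) W" "x \<in> W" "W \<subseteq> U" "Ck_on n (Suc k) W f"
        by blast
      obtain f' where f': "\<And>x. x \<in> W \<Longrightarrow> ((\<lambda>t. f (x(i := t))) has_real_derivative f' x) (at (x i))"
         "Ck_on n k W f'"
        using Ck_on_Suc_ex[OF W(4) i] by blast
      have eq: "f' x = h x" if "x \<in> W" for x
        unfolding h_def using DERIV_imp_deriv[OF f'(1)[OF that]] by simp
      show ?thesis
        using W eq f'(1)[OF W(2)] Ck_on_cong[OF W(1) f'(2) eq] by auto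
    qed
    have "Ck_on n k U h" using * by (intro Suc.IH) blast
    with * show ?thesis by blast
  qed
  with c show ?case by (simp add: Ck_on_continuous)
qed

text \<open>By the chain rule each partial derivative of the composite is a sum of products
  \<open>fd i (g y) * gd i y\<close>, whose first factor is a composite of one order less with the
  same \<open>g\<close>. Hence the induction on \<open>k\<close> fixes \<open>g\<close> and varies
  \<open>f\<close>.\<close>

lemma Ck_on_compose:
  assumes U: "openin (Euclidean_space n) U" and W: "openin (Euclidean_space p) W"
    and gU: "\<And>y. y \<in> W \<Longrightarrow> g y \<in> U"
    and "\<And>i. i < n \<Longrightarrow> Ck_on p k W (\<lambda>y. g y i)" and "Ck_on n k U f"
  shows "Ck_on p k W (\<lambda>y. f (g y))"
  using assms(4,5)
proof (induction k arbitrary: f)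
  have UE: "U \<subseteq> topspace (Euclidean_space n)" and WE: "W \<subseteq> topspace (Euclidean_space p)"
    using U W openin_subset by blast+
  note cm = continuous_map_Euclidean_subset_iff[OF UE] continuous_map_Euclidean_subset_iff[OF WE]
  {
    case 0
    have "continuous_on W g"
    proof (rule continuous_on_coordinatewise_then_product)
      fix i
      show "continuous_on W (\<lambda>y. g y i)"
      proof (cases "i < n")
        case True
        then show ?thesis using 0(1)[OF True] by (simp add: cm(2))
      next
        case False
        then have "\<And>y. y \<in> W \<Longrightarrow> g y i = 0"
          using gU UE by (force simp: topspace_Euclidean_space)
        then show ?thesis using continuous_on_cong[of W W "\<lambda>y. g y i" "\<lambda>_. 0"] by simp
      qed
    qed
    moreover have "continuous_on U f" using 0(2) by (simp add: cm(1))
    ultimately have "continuous_on W (\<lambda>y. f (g y))"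
      using gU by (intro continuous_on_compose2[of U f W g]) auto
    then show ?case by (simp add: cm(2))
  next
    case (Suc k)
    have IH: "Ck_on p k W (\<lambda>y. f (g y))" if "Ck_on n k U f" for f
      by (rule Suc.IH[OF Ck_on_SucD[OF Suc.prems(1)] that])
    have "\<forall>i. \<exists>f'. i < n \<longrightarrow>
       (\<forall>x\<in>U. ((\<lambda>t. f (x(i := t))) has_real_derivative f' x) (at (x i))) \<and> Ck_on n k U f'"
      using Ck_on_Suc_ex[OF Suc.prems(2)] by blast
    then obtain fd where fd: "\<And>i x. i < n \<Longrightarrow> x \<in> U \<Longrightarrow> ((\<lambda>t. f (x(i := t))) has_real_derivative fd i x) (at (x i))"
        "\<And>i. i < n \<Longrightarrow> Ck_on n k U (fd i)"
      by metis
    have fdc: "continuous_on U (fd i)" if "i < n" for i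
      using Ck_on_continuous[OF fd(2)[OF that]] by (simp add: cm(1))
    have "\<exists>h. (\<forall>y\<in>W. ((\<lambda>t. f (g (y(j := t)))) has_real_derivative h y) (at (y j))) \<and> Ck_on p k W h"
      if j: "j < p" for j
    proof -
      have "\<forall>i. \<exists>f'. i < n \<longrightarrow>
         (\<forall>x\<in>W. ((\<lambda>t. g (x(j := t)) i) has_real_derivative f' x) (at (x j))) \<and> Ck_on p k W f'"
        using Ck_on_Suc_ex[OF Suc.prems(1) j] by blast
      then obtain gd where gd: "\<And>i y. i < n \<Longrightarrow> y \<in> W \<Longrightarrow> ((\<lambda>t. g (y(j := t)) i) has_real_derivative gd i y) (at (y j))"
          "\<And>i. i < n \<Longrightarrow> Ck_on p k W (gd i)"
        by metis
      show ?thesis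
      proof (intro exI[of _ "\<lambda>y. \<Sum>i<n. fd i (g y) * gd i y"] conjI ballI)
        fix y assume y: "y \<in> W"
        have ev: "\<forall>\<^sub>F t in nhds (y j). g (y(j := t)) \<in> topspace (Euclidean_space n)"
          using openin_Euclidean_upd[OF W y j] by eventually_elim (use gU UE in blast)
        show "((\<lambda>t. f (g (y(j := t)))) has_real_derivative (\<Sum>i<n. fd i (g y) * gd i y)) (at (y j))"
          using DERIV_along_curve[OF U fd(1) fdc _ ev gd(1)[OF _ y]] gU[OF y] by simp
      qed (auto intro!: Ck_on_sum Ck_on_mult IH fd gd)
    qed
    moreover have "continuous_map (subtopology (Euclidean_space p) W) euclideanreal (\<lambda>y. f (g y))"
      using IH[OF Ck_on_SucD[OF Suc.prems(2)]] by (rule Ck_on_continuous)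
    ultimately show ?case by simp
  }
qed

section \<open>Smooth maps between manifolds\<close>

text \<open>One real coordinate of the chart condition in \<open>smooth_map\<close>. The set
  \<open>S\<close> need not lie inside the manifold, because preimages of chart domains are formed
  in the whole type.\<close>

definition smooth_real :: "'a mfd \<Rightarrow> 'a set \<Rightarrow> ('a \<Rightarrow> real) \<Rightarrow> bool" where
  "smooth_real A S h \<longleftrightarrow>
     (\<forall>(U, \<phi>)\<in>charts A. \<forall>k. Ck_on (mdim A) k (\<phi> ` (U \<inter> S)) (h \<circ> inv_into U \<phi>))"

text \<open>The conditions of \<^const>\<open>smooth_manifold\<close> on single charts. They suffice for composing smooth
  maps, so the compatibility of the charts of a power is never needed.\<close>

definition charted :: "'a mfd \<Rightarrow> bool" where
  "charted A \<longleftrightarrow>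
     (\<Union>(U, \<phi>)\<in>charts A. U) = topspace (mtop A) \<and>
     (\<forall>(U, \<phi>)\<in>charts A.
        openin (mtop A) U \<and> openin (Euclidean_space (mdim A)) (\<phi> ` U) \<and>
        homeomorphic_map (subtopology (mtop A) U)
          (subtopology (Euclidean_space (mdim A)) (\<phi> ` U)) \<phi>)"

lemma smooth_manifold_charted: "smooth_manifold M \<Longrightarrow> charted M"
  unfolding smooth_manifold_def charted_def by blast

lemma smooth_map_iff:
  "smooth_map M N f \<longleftrightarrow> continuous_map (mtop M) (mtop N) f \<and>
     (\<forall>(W, \<psi>)\<in>charts N. \<forall>j<mdim N. smooth_real M (f -` W) (\<lambda>x. \<psi> (f x) j))"
  unfolding smooth_map_def smooth_real_def smooth_on_def
  by (simp only: case_prod_unfold o_def) meson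

lemma smooth_map_realD:
  "smooth_map M N f \<Longrightarrow> (W, \<psi>) \<in> charts N \<Longrightarrow> j < mdim N \<Longrightarrow> smooth_real M (f -` W) (\<lambda>x. \<psi> (f x) j)"
  unfolding smooth_map_iff by blast

lemma charted_cover:
  assumes "charted A" "x \<in> topspace (mtop A)"
  obtains U \<phi> where "(U, \<phi>) \<in> charts A" "x \<in> U"
proof -
  have "x \<in> (\<Union>(U, \<phi>)\<in>charts A. U)" using assms unfolding charted_def by blast
  then show thesis using that by blast
qed

lemma chart_open: "charted A \<Longrightarrow> (U, \<phi>) \<in> charts A \<Longrightarrow> openin (mtop A) U"
  and chart_image_open: "charted A \<Longrightarrow> (U, \<phi>) \<in> charts A \<Longrightarrow> openin (Euclidean_space (mdim A)) (\<phi> ` U)"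
  and chart_homeo: "charted A \<Longrightarrow> (U, \<phi>) \<in> charts A \<Longrightarrow> homeomorphic_map (subtopology (mtop A) U)
          (subtopology (Euclidean_space (mdim A)) (\<phi> ` U)) \<phi>"
  unfolding charted_def by blast+

lemma chart_subset: "charted A \<Longrightarrow> (U, \<phi>) \<in> charts A \<Longrightarrow> U \<subseteq> topspace (mtop A)"
  using chart_open openin_subset by blast

lemma chart_inj:
  assumes "charted A" "(U, \<phi>) \<in> charts A"
  shows "inj_on \<phi> U"
  using homeomorphic_imp_injective_map[OF chart_homeo[OF assms]] chart_subset[OF assms]
  by (simp add: inf_absorb2)

lemma chart_open_image:
  assumes "charted A" "(U, \<phi>) \<in> charts A" "openin (mtop A) S"
  shows "openin (Euclidean_space (mdim A)) (\<phi> ` (U \<inter> S))"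
proof -
  have "open_map (subtopology (mtop A) U) (subtopology (Euclidean_space (mdim A)) (\<phi> ` U)) \<phi>"
    using chart_homeo[OF assms(1,2)] homeomorphic_imp_open_map by blast
  moreover have "openin (subtopology (mtop A) U) (U \<inter> S)"
    using assms(3) by (auto simp: openin_subtopology)
  ultimately show ?thesis
    using chart_image_open[OF assms(1,2)] openin_trans_full unfolding open_map_def by blast
qed

lemma chart_continuous:
  assumes "charted A" "(U, \<phi>) \<in> charts A"
  shows "continuous_map (subtopology (mtop A) U) (Euclidean_space (mdim A)) \<phi>"
  using homeomorphic_imp_continuous_map[OF chart_homeo[OF assms]] continuous_map_into_fulltopology by blast

lemma chart_topspace: "charted A \<Longrightarrow> (U, \<phi>) \<in> charts A \<Longrightarrow> x \<in> U \<Longrightarrow> \<phi> x \<in> topspace (Euclidean_space (mdim A))"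
  using chart_image_open openin_subset by blast

lemma smooth_realD:
  "smooth_real A S h \<Longrightarrow> (U, \<phi>) \<in> charts A \<Longrightarrow> Ck_on (mdim A) k (\<phi> ` (U \<inter> S)) (h \<circ> inv_into U \<phi>)"
  unfolding smooth_real_def by blast

lemma smooth_realI:
  "(\<And>U \<phi> k. (U, \<phi>) \<in> charts A \<Longrightarrow> Ck_on (mdim A) k (\<phi> ` (U \<inter> S)) (\<lambda>y. h (inv_into U \<phi> y)))
    \<Longrightarrow> smooth_real A S h"
  unfolding smooth_real_def o_def by blast

lemma smooth_real_subset: "smooth_real A S h \<Longrightarrow> S' \<subseteq> S \<Longrightarrow> smooth_real A S' h"
  by (rule smooth_realI, drule (1) smooth_realD, unfold o_def, erule Ck_on_subset) auto

text \<open>\<open>S'\<close> is typically a preimage formed in the whole type and may contain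
  points off the manifold; only its trace \<open>S\<close> meets chart domains, and the openness of
  \<open>S\<close> admits \<open>Ck_on_cong\<close>.\<close>

lemma smooth_real_cong:
  assumes A: "charted A" and S: "openin (mtop A) S" and h: "smooth_real A S h"
    and eq: "\<And>x. x \<in> S \<Longrightarrow> h x = h' x" and S': "S' \<inter> topspace (mtop A) = S"
  shows "smooth_real A S' h'"
  unfolding smooth_real_def
proof (intro ballI allI, clarify)
  fix U \<phi> k assume c: "(U, \<phi>) \<in> charts A"
  have US: "U \<inter> S' = U \<inter> S" using chart_subset[OF A c] S' by auto
  have "Ck_on (mdim A) k (\<phi> ` (U \<inter> S)) (h \<circ> inv_into U \<phi>)"
    using h c unfolding smooth_real_def by blast
  then have "Ck_on (mdim A) k (\<phi> ` (U \<inter> S)) (h' \<circ> inv_into U \<phi>)"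
    by (rule Ck_on_cong[OF chart_open_image[OF A c S]]) (use eq chart_inj[OF A c] in auto)
  then show "Ck_on (mdim A) k (\<phi> ` (U \<inter> S')) (h' \<circ> inv_into U \<phi>)" by (simp add: US)
qed

lemma smooth_real_cong_UNIV:
  assumes "charted A" "smooth_real A UNIV h" "\<And>x. x \<in> topspace (mtop A) \<Longrightarrow> h x = h' x"
  shows "smooth_real A UNIV h'"
  by (rule smooth_real_cong[of A "topspace (mtop A)" h])
     (use assms in \<open>auto intro: smooth_real_subset\<close>)

lemma smooth_real_local:
  assumes A: "charted A"
    and loc: "\<And>x. x \<in> S \<Longrightarrow> x \<in> topspace (mtop A) \<Longrightarrow>
       \<exists>V. openin (mtop A) V \<and> x \<in> V \<and> V \<subseteq> S \<and> smooth_real A V h"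
  shows "smooth_real A S h"
  unfolding smooth_real_def
proof (intro ballI allI, clarify)
  fix U \<phi> k assume c: "(U, \<phi>) \<in> charts A"
  show "Ck_on (mdim A) k (\<phi> ` (U \<inter> S)) (h \<circ> inv_into U \<phi>)"
  proof (rule Ck_on_local)
    fix y assume "y \<in> \<phi> ` (U \<inter> S)"
    then obtain x where x: "x \<in> U" "x \<in> S" "y = \<phi> x" by auto
    then obtain V where V: "openin (mtop A) V" "x \<in> V" "V \<subseteq> S" "smooth_real A V h"
      using loc chart_subset[OF A c] by blast
    then show "\<exists>W. openin (Euclidean_space (mdim A)) W \<and> y \<in> W \<and> W \<subseteq> \<phi> ` (U \<inter> S) \<and>
        Ck_on (mdim A) k W (h \<circ> inv_into U \<phi>)"
      using x c chart_open_image[OF A c V(1)]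
      by (intro exI[of _ "\<phi> ` (U \<inter> V)"]) (auto simp: smooth_real_def)
  qed
qed

lemma smooth_real_const: "smooth_real A S (\<lambda>_. c)"
  unfolding smooth_real_def by (auto simp: o_def Ck_on_const)

lemma smooth_real_add: "smooth_real A S f \<Longrightarrow> smooth_real A S g \<Longrightarrow> smooth_real A S (\<lambda>x. f x + g x)"
  by (rule smooth_realI) (intro Ck_on_add; drule (1) smooth_realD, simp add: o_def)

lemma smooth_real_mult: "smooth_real A S f \<Longrightarrow> smooth_real A S g \<Longrightarrow> smooth_real A S (\<lambda>x. f x * g x)"
  by (rule smooth_realI) (intro Ck_on_mult; drule (1) smooth_realD, simp add: o_def)

lemma smooth_real_sum:
  "(\<And>i. i \<in> I \<Longrightarrow> smooth_real A S (f i)) \<Longrightarrow> smooth_real A S (\<lambda>x. \<Sum>i\<in>I. f i x)"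
  by (induction I rule: infinite_finite_induct) (auto intro: smooth_real_add smooth_real_const)

lemma smooth_real_continuous:
  assumes A: "charted A" and h: "smooth_real A UNIV h"
  shows "continuous_map (mtop A) euclideanreal h"
  unfolding continuous_map_def
proof (intro conjI allI impI)
  fix S assume S: "openin euclideanreal S"
  show "openin (mtop A) {x \<in> topspace (mtop A). h x \<in> S}"
  proof (subst openin_subopen, intro ballI)
    fix x assume x: "x \<in> {x \<in> topspace (mtop A). h x \<in> S}"
    then obtain U \<phi> where c: "(U, \<phi>) \<in> charts A" "x \<in> U" using charted_cover[OF A] by blast
    have "Ck_on (mdim A) 0 (\<phi> ` U) (h \<circ> inv_into U \<phi>)"
      using smooth_realD[OF h c(1), of 0] by simp
    then have "continuous_map (subtopology (Euclidean_space (mdim A)) (\<phi> ` U)) euclideanreal (h \<circ> inv_into U \<phi>)"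
      by simp
    with homeomorphic_imp_continuous_map[OF chart_homeo[OF A c(1)]]
    have "continuous_map (subtopology (mtop A) U) euclideanreal ((h \<circ> inv_into U \<phi>) \<circ> \<phi>)"
      by (rule continuous_map_compose)
    then have "continuous_map (subtopology (mtop A) U) euclideanreal h"
      by (rule continuous_map_eq) (use chart_inj[OF A c(1)] in auto)
    from openin_continuous_map_preimage[OF this S]
    have "openin (mtop A) {x \<in> U. h x \<in> S}"
      using openin_trans_full[OF _ chart_open[OF A c(1)]] chart_subset[OF A c(1)]
      by (simp add: inf_absorb2)
    then show "\<exists>T. openin (mtop A) T \<and> x \<in> T \<and> T \<subseteq> {x \<in> topspace (mtop A). h x \<in> S}"
      using x c chart_subset[OF A c(1)] by (intro exI[of _ "{x \<in> U. h x \<in> S}"]) auto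
  qed
qed auto

text \<open>The image of a chart of \<open>A\<close> need not fit into one chart of
  \<open>B\<close>, so the argument is local. Near a given point the composite factors through a
  single chart of \<open>B\<close>, and the chain rule applies there.\<close>

lemma smooth_real_compose:
  assumes A: "charted A" and B: "charted B" and f: "smooth_map A B f"
    and S: "openin (mtop B) S" and h: "smooth_real B S h"
  shows "smooth_real A (f -` S) (\<lambda>x. h (f x))"
proof (rule smooth_real_local[OF A])
  fix x assume x: "x \<in> f -` S" "x \<in> topspace (mtop A)"
  have fc: "continuous_map (mtop A) (mtop B) f" using f by (simp add: smooth_map_iff)
  with x have "f x \<in> topspace (mtop B)" by (auto simp: continuous_map_def)
  then obtain W \<psi> where W: "(W, \<psi>) \<in> charts B" "f x \<in> W" using charted_cover[OF B] by blast
  define V where "V = {x \<in> topspace (mtop A). f x \<in> W \<inter> S}"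
  have V: "openin (mtop A) V"
    unfolding V_def using fc chart_open[OF B W(1)] S by (intro openin_continuous_map_preimage) auto
  have "smooth_real A V (\<lambda>x. h (f x))"
  proof (rule smooth_realI)
    fix U \<phi> k assume c: "(U, \<phi>) \<in> charts A"
    let ?V = "\<phi> ` (U \<inter> V)" and ?W = "\<psi> ` (W \<inter> S)"
    have oV: "openin (Euclidean_space (mdim A)) ?V" by (rule chart_open_image[OF A c V])
    have inv: "inv_into U \<phi> y \<in> U \<inter> V" if "y \<in> ?V" for y
      using that chart_inj[OF A c] by auto
    have "Ck_on (mdim A) k ?V (\<lambda>y. (h \<circ> inv_into W \<psi>) (\<psi> (f (inv_into U \<phi> y))))"
    proof (rule Ck_on_compose[OF chart_open_image[OF B W(1) S] oV,
          where g = "\<lambda>y. \<psi> (f (inv_into U \<phi> y))" and f = "h \<circ> inv_into W \<psi>"])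
      show "\<psi> (f (inv_into U \<phi> y)) \<in> ?W" if "y \<in> ?V" for y
        using inv[OF that] by (auto simp: V_def)
      fix i assume "i < mdim B"
      from smooth_realD[OF smooth_map_realD[OF f W(1) this] c]
      have "Ck_on (mdim A) k (\<phi> ` (U \<inter> f -` W)) (\<lambda>y. \<psi> (f (inv_into U \<phi> y)) i)"
        by (simp add: o_def)
      then show "Ck_on (mdim A) k ?V (\<lambda>y. \<psi> (f (inv_into U \<phi> y)) i)"
        by (rule Ck_on_subset) (auto simp: V_def)
    next
      show "Ck_on (mdim B) k ?W (h \<circ> inv_into W \<psi>)"
        by (rule smooth_realD[OF h W(1)])
    qed
    then show "Ck_on (mdim A) k ?V (\<lambda>y. h (f (inv_into U \<phi> y)))"
    proof (rule Ck_on_cong[OF oV])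
      fix y assume "y \<in> ?V"
      with inv have "f (inv_into U \<phi> y) \<in> W" by (auto simp: V_def)
      then show "(h \<circ> inv_into W \<psi>) (\<psi> (f (inv_into U \<phi> y))) = h (f (inv_into U \<phi> y))"
        using chart_inj[OF B W(1)] by simp
    qed
  qed
  then show "\<exists>V. openin (mtop A) V \<and> x \<in> V \<and> V \<subseteq> f -` S \<and> smooth_real A V (\<lambda>x. h (f x))"
    using V x W by (intro exI[of _ V]) (auto simp: V_def)
qed

lemma smooth_real_compose_UNIV:
  assumes A: "charted A" and B: "charted B" and f: "smooth_map A B f" and h: "smooth_real B UNIV h"
  shows "smooth_real A UNIV (\<lambda>x. h (f x))"
proof (rule smooth_real_cong[OF A openin_topspace])
  have "smooth_real A (f -` topspace (mtop B)) (\<lambda>x. h (f x))"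
    using smooth_real_compose[OF A B f openin_topspace smooth_real_subset[OF h]] by simp
  then show "smooth_real A (topspace (mtop A)) (\<lambda>x. h (f x))"
    by (rule smooth_real_subset) (use f in \<open>auto simp: smooth_map_iff continuous_map_def\<close>)
qed auto

lemma smooth_map_compose:
  assumes A: "charted A" and B: "charted B" and C: "charted C"
    and f: "smooth_map A B f" and g: "smooth_map B C g"
  shows "smooth_map A C (\<lambda>x. g (f x))"
  unfolding smooth_map_iff
proof (intro conjI ballI, safe)
  have fc: "continuous_map (mtop A) (mtop B) f" and gc: "continuous_map (mtop B) (mtop C) g"
    using f g by (simp_all add: smooth_map_iff)
  show gf: "continuous_map (mtop A) (mtop C) (\<lambda>x. g (f x))"
    using continuous_map_compose[OF fc gc] by (simp add: o_def)
  fix Z \<zeta> j assume c: "(Z, \<zeta>) \<in> charts C" and j: "j < mdim C"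
  let ?S = "{b \<in> topspace (mtop B). g b \<in> Z}"
  have S: "openin (mtop B) ?S" using gc chart_open[OF C c] by (rule openin_continuous_map_preimage)
  have "smooth_real B ?S (\<lambda>b. \<zeta> (g b) j)"
    by (rule smooth_real_subset[OF smooth_map_realD[OF g c j]]) auto
  from smooth_real_compose[OF A B f S this]
  have s: "smooth_real A (f -` ?S) (\<lambda>x. \<zeta> (g (f x)) j)" .
  show "smooth_real A ((\<lambda>x. g (f x)) -` Z) (\<lambda>x. \<zeta> (g (f x)) j)"
  proof (rule smooth_real_cong[OF A])
    show "openin (mtop A) {x \<in> topspace (mtop A). g (f x) \<in> Z}"
      using gf chart_open[OF C c] by (rule openin_continuous_map_preimage)
    show "smooth_real A {x \<in> topspace (mtop A). g (f x) \<in> Z} (\<lambda>x. \<zeta> (g (f x)) j)"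
      by (rule smooth_real_subset[OF s]) (use fc in \<open>auto simp: continuous_map_def\<close>)
  qed auto
qed

lemma smooth_map_cong:
  assumes A: "charted A" and N: "charted N" and f: "smooth_map A N f"
    and eq: "\<And>x. x \<in> topspace (mtop A) \<Longrightarrow> f x = f' x"
  shows "smooth_map A N f'"
  unfolding smooth_map_iff
proof (intro conjI ballI, safe)
  have fc: "continuous_map (mtop A) (mtop N) f" using f by (simp_all add: smooth_map_iff)
  show fc': "continuous_map (mtop A) (mtop N) f'"
    using fc by (rule continuous_map_eq) (rule eq)
  fix Z \<zeta> j assume c: "(Z, \<zeta>) \<in> charts N" and j: "j < mdim N"
  show "smooth_real A (f' -` Z) (\<lambda>x. \<zeta> (f' x) j)"
  proof (rule smooth_real_cong[OF A])
    show "openin (mtop A) {x \<in> topspace (mtop A). f' x \<in> Z}"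
      using fc' chart_open[OF N c] by (rule openin_continuous_map_preimage)
    show "smooth_real A {x \<in> topspace (mtop A). f' x \<in> Z} (\<lambda>x. \<zeta> (f x) j)"
      by (rule smooth_real_subset[OF smooth_map_realD[OF f c j]]) (auto simp: eq)
  qed (auto simp: eq)
qed

text \<open>Read in charts the identity is a transition map, so this is the chart compatibility of
  \<open>smooth_manifold\<close>. It is what makes the projections of a power smooth.\<close>

lemma smooth_map_id:
  assumes "smooth_manifold M"
  shows "smooth_map M M (\<lambda>x. x)"
proof -
  have "\<forall>(U, \<phi>)\<in>charts M. \<forall>(W, \<psi>)\<in>charts M. smooth_on (mdim M) (mdim M) (\<phi> ` (U \<inter> W)) (\<psi> \<circ> inv_into U \<phi>)"
    using assms unfolding smooth_manifold_def by blast
  then show ?thesis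
    unfolding smooth_map_def vimage_ident by (simp add: o_def)
qed

section \<open>Powers of a manifold as products\<close>

lemma mdim_power [simp]: "mdim (mfd_power M n) = n * mdim M"
  by (simp add: mfd_power_def)

lemma topspace_power:
  "topspace (mtop (mfd_power M n)) = {xs. length xs = n \<and> set xs \<subseteq> topspace (mtop M)}"
proof -
  have "set xs \<subseteq> S \<longleftrightarrow> (\<forall>i<length xs. xs ! i \<in> S)" for xs and S :: "'a set"
    by (auto simp: set_conv_nth)
  then show ?thesis
    unfolding mfd_power_def mfd.simps topspace_pullback_topology
    by (auto simp: PiE_iff)
qed

lemma continuous_map_power_nth:
  assumes "i < n"
  shows "continuous_map (mtop (mfd_power M n)) (mtop M) (\<lambda>xs. xs ! i)"
proof -
  have "continuous_map (mtop (mfd_power M n)) (mtop M) ((\<lambda>f. f i) \<circ> (\<lambda>xs. \<lambda>i\<in>{..<n}. xs ! i))"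
    unfolding mfd_power_def mfd.simps
    by (intro continuous_map_pullback continuous_map_product_projection) (use assms in simp)
  then show ?thesis
    by (rule continuous_map_eq) (use assms in simp)
qed

lemma continuous_map_into_power:
  assumes "\<And>x. x \<in> topspace X \<Longrightarrow> length (F x) = n"
    and "\<And>i. i < n \<Longrightarrow> continuous_map X (mtop M) (\<lambda>x. F x ! i)"
  shows "continuous_map X (mtop (mfd_power M n)) F"
  unfolding mfd_power_def mfd.simps
proof (rule continuous_map_pullback')
  show "continuous_map X (product_topology (\<lambda>_. mtop M) {..<n}) ((\<lambda>xs. \<lambda>i\<in>{..<n}. xs ! i) \<circ> F)"
    unfolding continuous_map_componentwise using assms(2) by (simp add: o_def image_subset_iff)
qed (use assms(1) in auto)

text \<open>The coordinate expression of the projection to factor \<open>i\<close> when coordinates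
  are concatenated. The zero padding makes the value a point of
  \<open>Euclidean_space m\<close>.\<close>

definition coord_block :: "nat \<Rightarrow> nat \<Rightarrow> (nat \<Rightarrow> real) \<Rightarrow> nat \<Rightarrow> real" where
  "coord_block m i y = (\<lambda>k. if k < m then y (i * m + k) else 0)"

text \<open>This and \<open>power_chart\<close> name the two parts of a chart of
  \<open>mfd_power\<close>, with the exponent read off as \<open>length cs\<close>.\<close>

definition power_dom :: "('a set \<times> ('a \<Rightarrow> nat \<Rightarrow> real)) list \<Rightarrow> 'a list set" where
  "power_dom cs = {xs. length xs = length cs \<and> (\<forall>i<length cs. xs ! i \<in> fst (cs ! i))}"

definition power_chart :: "nat \<Rightarrow> ('a set \<times> ('a \<Rightarrow> nat \<Rightarrow> real)) list \<Rightarrow> 'a list \<Rightarrow> nat \<Rightarrow> real" where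
  "power_chart m cs xs = (\<lambda>k. if k < length cs * m
     then snd (cs ! (k div m)) (xs ! (k div m)) (k mod m) else 0)"

lemma charts_power:
  "charts (mfd_power M n) = {(power_dom cs, power_chart (mdim M) cs) | cs. length cs = n \<and> set cs \<subseteq> charts M}"
  unfolding mfd_power_def mfd.simps power_dom_def[abs_def] power_chart_def[abs_def]
  by (rule Collect_cong, rule ex_cong1, rule iffI; elim conjE; intro conjI; simp only:)

lemma block_index_less: "i < n \<Longrightarrow> k < m \<Longrightarrow> i * m + k < n * (m::nat)"
  using mult_le_mono1[of "Suc i" n m] by simp

lemma continuous_map_coord_block:
  assumes "i < n"
  shows "continuous_map (Euclidean_space (n * m)) (Euclidean_space m) (coord_block m i)"
proof -
  have "continuous_map (Euclidean_space (n * m)) euclideanreal (\<lambda>y. y j)" for j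
    unfolding Euclidean_space_def
    by (intro continuous_map_from_subtopology continuous_map_product_projection) auto
  then show ?thesis
    unfolding coord_block_def by (simp add: continuous_map_componentwise_Euclidean_space)
qed

text \<open>Beyond \<open>mdim M\<close> the zero padding of the block is correct because chart
  values lie in \<open>Euclidean_space (mdim M)\<close>.\<close>

lemma coord_block_power_chart:
  assumes M: "charted M" and cs: "set cs \<subseteq> charts M" and xs: "xs \<in> power_dom cs" and i: "i < length cs"
  shows "coord_block (mdim M) i (power_chart (mdim M) cs xs) = snd (cs ! i) (xs ! i)"
proof
  fix k
  have "(fst (cs ! i), snd (cs ! i)) \<in> charts M" using cs i by auto
  moreover have "xs ! i \<in> fst (cs ! i)" using xs i by (auto simp: power_dom_def)
  ultimately have "snd (cs ! i) (xs ! i) \<in> topspace (Euclidean_space (mdim M))"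
    using chart_topspace[OF M] by blast
  then show "coord_block (mdim M) i (power_chart (mdim M) cs xs) k = snd (cs ! i) (xs ! i) k"
    using block_index_less[OF i] by (auto simp: coord_block_def power_chart_def topspace_Euclidean_space)
qed

text \<open>The inverse of a product chart cuts the coordinates into blocks and inverts the chart of
  each factor on its block. Domain and image are finite intersections of open preimages, and
  continuity is checked componentwise.\<close>

lemma charted_power:
  assumes M: "charted M"
  shows "charted (mfd_power M n)"
proof -
  let ?P = "mfd_power M n" and ?m = "mdim M"
  let ?E = "Euclidean_space (mdim ?P)"
  have chart: "case c of (U, \<phi>) \<Rightarrow> openin (mtop ?P) U \<and> openin ?E (\<phi> ` U) \<and>
        homeomorphic_map (subtopology (mtop ?P) U) (subtopology ?E (\<phi> ` U)) \<phi>"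
    if "c \<in> charts ?P" for c
  proof -
    from that
    obtain cs where c: "c = (power_dom cs, power_chart ?m cs)" "length cs = n" "set cs \<subseteq> charts M"
      unfolding charts_power by blast
    have ch: "(fst (cs ! i), snd (cs ! i)) \<in> charts M" if "i < n" for i
      using c that by auto
    let ?D = "power_dom cs" and ?\<Phi> = "power_chart ?m cs"
    define I where "I = {y \<in> topspace ?E. \<forall>i<n. coord_block ?m i y \<in> snd (cs ! i) ` fst (cs ! i)}"
    define \<Psi> where "\<Psi> y = map (\<lambda>i. inv_into (fst (cs ! i)) (snd (cs ! i)) (coord_block ?m i y)) [0..<n]" for y
    have inv: "inv_into (fst (cs ! i)) (snd (cs ! i)) (snd (cs ! i) x) = x" if "i < n" "x \<in> fst (cs ! i)" for i x
      using chart_inj[OF M ch[OF that(1)]] that by simp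
    have \<Phi>top: "?\<Phi> xs \<in> topspace ?E" for xs
      by (auto simp: power_chart_def topspace_Euclidean_space c)
    have \<Phi>I: "?\<Phi> xs \<in> I" if "xs \<in> ?D" for xs
      using that \<Phi>top coord_block_power_chart[OF M c(3) that] by (auto simp: I_def c(2) power_dom_def)
    have \<Psi>D: "\<Psi> y \<in> ?D" if "y \<in> I" for y
      using that by (auto simp: \<Psi>_def power_dom_def c(2) I_def intro!: inv_into_into)
    have \<Psi>\<Phi>: "\<Psi> (?\<Phi> xs) = xs" if "xs \<in> ?D" for xs
      using that coord_block_power_chart[OF M c(3) that] inv
      by (auto simp: \<Psi>_def power_dom_def c(2) intro!: nth_equalityI)
    have \<Phi>\<Psi>: "?\<Phi> (\<Psi> y) = y" if "y \<in> I" for y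
    proof
      fix k
      show "?\<Phi> (\<Psi> y) k = y k"
      proof (cases "k < n * ?m")
        case True
        then have k: "k div ?m < n" "k mod ?m < ?m"
          using less_mult_imp_div_less by (auto intro!: mod_less_divisor gr_zeroI)
        have "snd (cs ! (k div ?m)) (\<Psi> y ! (k div ?m)) = coord_block ?m (k div ?m) y"
          using that k by (auto simp: \<Psi>_def I_def f_inv_into_f)
        then show ?thesis using True k by (simp add: power_chart_def c(2) coord_block_def)
      next
        case False
        then show ?thesis using that by (simp add: power_chart_def c(2) I_def topspace_Euclidean_space)
      qed
    qed
    have image: "?\<Phi> ` ?D = I"
    proof
      show "I \<subseteq> ?\<Phi> ` ?D" using \<Psi>D \<Phi>\<Psi> by (metis image_eqI subsetI)
    qed (use \<Phi>I in blast)
    have Dtop: "?D \<subseteq> topspace (mtop ?P)"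
      using ch chart_subset[OF M ch] by (auto simp: power_dom_def topspace_power c(2) set_conv_nth)
    \<comment> \<open>The intersection with the whole space covers \<open>n = 0\<close>, where the
      intersection over no index is \<open>UNIV\<close>.\<close>
    have "openin (mtop ?P) ((\<Inter>i\<in>{..<n}. {xs \<in> topspace (mtop ?P). xs ! i \<in> fst (cs ! i)}) \<inter> topspace (mtop ?P))"
      using openin_continuous_map_preimage[OF continuous_map_power_nth chart_open[OF M ch]]
      by (intro openin_INT) auto
    also have "(\<Inter>i\<in>{..<n}. {xs \<in> topspace (mtop ?P). xs ! i \<in> fst (cs ! i)}) \<inter> topspace (mtop ?P) = ?D"
      using Dtop by (auto simp: power_dom_def c(2) topspace_power)
    finally have openD: "openin (mtop ?P) ?D" .
    have "openin ?E ((\<Inter>i\<in>{..<n}. {y \<in> topspace ?E. coord_block ?m i y \<in> snd (cs ! i) ` fst (cs ! i)}) \<inter> topspace ?E)"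
      using openin_continuous_map_preimage[OF continuous_map_coord_block chart_image_open[OF M ch]]
      unfolding mdim_power by (intro openin_INT) auto
    also have "(\<Inter>i\<in>{..<n}. {y \<in> topspace ?E. coord_block ?m i y \<in> snd (cs ! i) ` fst (cs ! i)}) \<inter> topspace ?E = I"
      by (auto simp: I_def)
    finally have openI: "openin ?E I" .
    have "homeomorphic_maps (subtopology (mtop ?P) ?D) (subtopology ?E I) ?\<Phi> \<Psi>"
      unfolding homeomorphic_maps_def
    proof (intro conjI ballI)
      show "continuous_map (subtopology (mtop ?P) ?D) (subtopology ?E I) ?\<Phi>"
        unfolding continuous_map_in_subtopology
      proof
        have "continuous_map (subtopology (mtop ?P) ?D) euclideanreal
            (\<lambda>xs. snd (cs ! (k div ?m)) (xs ! (k div ?m)) (k mod ?m))" if k: "k < n * ?m" for k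
        proof -
          have i: "k div ?m < n" using k less_mult_imp_div_less by auto
          have "continuous_map (subtopology (mtop ?P) ?D) (subtopology (mtop M) (fst (cs ! (k div ?m)))) (\<lambda>xs. xs ! (k div ?m))"
            unfolding continuous_map_in_subtopology using i
            by (auto intro!: continuous_map_from_subtopology continuous_map_power_nth simp: power_dom_def c(2))
          from continuous_map_compose[OF this chart_continuous[OF M ch[OF i]]]
          have "continuous_map (subtopology (mtop ?P) ?D) (Euclidean_space ?m)
             (\<lambda>xs. snd (cs ! (k div ?m)) (xs ! (k div ?m)))" by (simp add: o_def)
          then show ?thesis
            unfolding Euclidean_space_def continuous_map_in_subtopology
            by (simp add: continuous_map_componentwise_UNIV)
        qed
        then show "continuous_map (subtopology (mtop ?P) ?D) ?E ?\<Phi>"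
          unfolding power_chart_def c(2) mdim_power by (simp add: continuous_map_componentwise_Euclidean_space)
      qed (use \<Phi>I in auto)
      show "continuous_map (subtopology ?E I) (subtopology (mtop ?P) ?D) \<Psi>"
        unfolding continuous_map_in_subtopology
      proof
        show "continuous_map (subtopology ?E I) (mtop ?P) \<Psi>"
        proof (rule continuous_map_into_power)
          fix i assume i: "i < n"
          let ?U = "fst (cs ! i)" and ?\<phi> = "snd (cs ! i)"
          \<comment> \<open>\<open>inv_into\<close> is merely a set-theoretic inverse. The
            homeomorphism supplies a continuous \<open>g\<close> that agrees with it on the chart
            image.\<close>
          obtain g where g: "homeomorphic_maps (subtopology (mtop M) ?U) (subtopology (Euclidean_space ?m) (?\<phi> ` ?U)) ?\<phi> g"
            using chart_homeo[OF M ch[OF i]] homeomorphic_map_maps by blast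
          have gc: "continuous_map (subtopology (Euclidean_space ?m) (?\<phi> ` ?U)) (mtop M) g"
            using g unfolding homeomorphic_maps_def by (blast intro: continuous_map_into_fulltopology)
          have gi: "g (?\<phi> x) = x" if "x \<in> ?U" for x
            using g that chart_subset[OF M ch[OF i]] unfolding homeomorphic_maps_def by auto
          have "continuous_map (subtopology ?E I) (subtopology (Euclidean_space ?m) (?\<phi> ` ?U)) (coord_block ?m i)"
            unfolding continuous_map_in_subtopology mdim_power using i
            by (auto intro!: continuous_map_from_subtopology continuous_map_coord_block simp: I_def)
          from continuous_map_compose[OF this gc]
          show "continuous_map (subtopology ?E I) (mtop M) (\<lambda>y. \<Psi> y ! i)"
          proof (rule continuous_map_eq)
            fix y assume "y \<in> topspace (subtopology ?E I)"
            then obtain x where "x \<in> ?U" "coord_block ?m i y = ?\<phi> x" using i by (auto simp: I_def)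
            then show "(g \<circ> coord_block ?m i) y = \<Psi> y ! i"
              using i gi inv[OF i] by (simp add: \<Psi>_def)
          qed
        qed (simp add: \<Psi>_def)
      qed (use \<Psi>D in auto)
    qed (use \<Psi>\<Phi> \<Phi>\<Psi> in auto)
    then show ?thesis
      using openD openI homeomorphic_map_maps by (auto simp: c(1) image)
  qed
  have "(\<Union>(U, \<phi>)\<in>charts ?P. U) = topspace (mtop ?P)"
  proof
    show "(\<Union>(U, \<phi>)\<in>charts ?P. U) \<subseteq> topspace (mtop ?P)"
    proof (rule UN_least, clarify)
      fix U \<phi> xs assume "(U, \<phi>) \<in> charts ?P" "xs \<in> U"
      then have "openin (mtop ?P) U" using chart[of "(U, \<phi>)"] by simp
      then show "xs \<in> topspace (mtop ?P)" using \<open>xs \<in> U\<close> openin_subset by blast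
    qed
    show "topspace (mtop ?P) \<subseteq> (\<Union>(U, \<phi>)\<in>charts ?P. U)"
    proof
      fix xs assume xs: "xs \<in> topspace (mtop ?P)"
      have "\<exists>c\<in>charts M. xs ! i \<in> fst c" if "i < n" for i
      proof -
        have "xs ! i \<in> topspace (mtop M)" using xs that nth_mem by (auto simp: topspace_power)
        then obtain U \<phi> where "(U, \<phi>) \<in> charts M" "xs ! i \<in> U" by (rule charted_cover[OF M])
        then show ?thesis by (intro bexI[of _ "(U, \<phi>)"]) auto
      qed
      then obtain c where c: "\<And>i. i < n \<Longrightarrow> c i \<in> charts M \<and> xs ! i \<in> fst (c i)" by metis
      let ?cs = "map c [0..<n]"
      have "(power_dom ?cs, power_chart ?m ?cs) \<in> charts ?P"
        unfolding charts_power using c by (intro CollectI exI[of _ ?cs]) auto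
      moreover have "xs \<in> power_dom ?cs" using c xs by (auto simp: power_dom_def topspace_power)
      ultimately show "xs \<in> (\<Union>(U, \<phi>)\<in>charts ?P. U)" by blast
    qed
  qed
  with chart show ?thesis unfolding charted_def by blast
qed

text \<open>In a product chart the projection is \<open>coord_block\<close> followed by the
  transition map from the chart of factor \<open>j\<close> to the target chart.\<close>

lemma smooth_map_power_nth:
  assumes M: "smooth_manifold M" and j: "j < n"
  shows "smooth_map (mfd_power M n) M (\<lambda>xs. xs ! j)"
  unfolding smooth_map_iff
proof (intro conjI ballI, safe)
  have cM: "charted M" by (rule smooth_manifold_charted[OF M])
  note cP = charted_power[OF cM, of n]
  show "continuous_map (mtop (mfd_power M n)) (mtop M) (\<lambda>xs. xs ! j)"
    by (rule continuous_map_power_nth[OF j])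
  fix W \<psi> l assume W: "(W, \<psi>) \<in> charts M" and l: "l < mdim M"
  show "smooth_real (mfd_power M n) ((\<lambda>xs. xs ! j) -` W) (\<lambda>xs. \<psi> (xs ! j) l)"
  proof (rule smooth_realI)
    fix D \<Phi> k assume "(D, \<Phi>) \<in> charts (mfd_power M n)"
    then obtain cs where cs: "D = power_dom cs" "\<Phi> = power_chart (mdim M) cs" "length cs = n" "set cs \<subseteq> charts M"
      unfolding charts_power by blast
    define U \<phi> where "U = fst (cs ! j)" and "\<phi> = snd (cs ! j)"
    have U: "(U, \<phi>) \<in> charts M" using cs j by (auto simp: U_def \<phi>_def)
    have D: "(D, \<Phi>) \<in> charts (mfd_power M n)" by fact
    let ?S = "{xs \<in> topspace (mtop (mfd_power M n)). xs ! j \<in> W}"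
    have S: "openin (mtop (mfd_power M n)) ?S"
      by (rule openin_continuous_map_preimage[OF continuous_map_power_nth[OF j] chart_open[OF cM W]])
    let ?V = "\<Phi> ` (D \<inter> (\<lambda>xs. xs ! j) -` W)"
    have V: "openin (Euclidean_space (mdim (mfd_power M n))) ?V"
    proof -
      have "D \<inter> (\<lambda>xs. xs ! j) -` W = D \<inter> ?S" using chart_subset[OF cP D] by auto
      then show ?thesis using chart_open_image[OF cP D S] by simp
    qed
    have y: "inv_into D \<Phi> y ! j \<in> U \<inter> W" "coord_block (mdim M) j y = \<phi> (inv_into D \<Phi> y ! j)" if y: "y \<in> ?V" for y
    proof -
      obtain xs where xs: "y = \<Phi> xs" "xs \<in> D" "xs ! j \<in> W" using y by auto
      then have i: "inv_into D \<Phi> y = xs" using chart_inj[OF cP D] by simp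
      have "xs \<in> power_dom cs" using xs cs by simp
      then have "xs ! j \<in> U" using j by (simp add: power_dom_def cs U_def)
      then show "inv_into D \<Phi> y ! j \<in> U \<inter> W" using i xs by simp
      show "coord_block (mdim M) j y = \<phi> (inv_into D \<Phi> y ! j)"
        unfolding i unfolding \<phi>_def xs(1) cs(2)
        using coord_block_power_chart[OF cM cs(4) \<open>xs \<in> power_dom cs\<close>] j cs(3) by simp
    qed
    have UW: "openin (Euclidean_space (mdim M)) (\<phi> ` (U \<inter> W))"
      by (rule chart_open_image[OF cM U chart_open[OF cM W]])
    have tr: "Ck_on (mdim M) k (\<phi> ` (U \<inter> W)) (\<lambda>z. \<psi> (inv_into U \<phi> z) l)"
      using smooth_realD[OF smooth_map_realD[OF smooth_map_id[OF M] W l] U, of k] by (simp add: o_def)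
    have "Ck_on (mdim (mfd_power M n)) k ?V (\<lambda>y. \<psi> (inv_into U \<phi> (coord_block (mdim M) j y)) l)"
    proof (rule Ck_on_compose[OF UW V, where g = "coord_block (mdim M) j" and f = "\<lambda>z. \<psi> (inv_into U \<phi> z) l"])
      fix y assume "y \<in> ?V"
      then show "coord_block (mdim M) j y \<in> \<phi> ` (U \<inter> W)" using y[of y] by simp
    next
      fix i assume "i < mdim M"
      then show "Ck_on (mdim (mfd_power M n)) k ?V (\<lambda>y. coord_block (mdim M) j y i)"
        by (simp add: coord_block_def Ck_on_coord)
    qed (rule tr)
    then show "Ck_on (mdim (mfd_power M n)) k ?V (\<lambda>y. \<psi> (inv_into D \<Phi> y ! j) l)"
    proof (rule Ck_on_cong[OF V])
      fix y assume "y \<in> ?V"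
      with y[of y] chart_inj[OF cM U]
      show "\<psi> (inv_into U \<phi> (coord_block (mdim M) j y)) l = \<psi> (inv_into D \<Phi> y ! j) l" by simp
    qed
  qed
qed

text \<open>Coordinate \<open>k\<close> of a list is coordinate \<open>k mod mdim M\<close> of its
  entry \<open>k div mdim M\<close>, so the charts of the power test the entries one by one.
  Together with the projections this is the universal property of a product.\<close>

lemma smooth_map_into_power:
  assumes "\<And>x. x \<in> topspace (mtop N) \<Longrightarrow> length (F x) = p"
    and F: "\<And>i. i < p \<Longrightarrow> smooth_map N M (\<lambda>x. F x ! i)"
  shows "smooth_map N (mfd_power M p) F"
  unfolding smooth_map_iff
proof (intro conjI ballI, safe)
  show "continuous_map (mtop N) (mtop (mfd_power M p)) F"
    using F by (intro continuous_map_into_power assms(1)) (simp_all add: smooth_map_iff)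
  fix D \<Phi> k assume "(D, \<Phi>) \<in> charts (mfd_power M p)" and "k < mdim (mfd_power M p)"
  then obtain cs where cs: "D = power_dom cs" "\<Phi> = power_chart (mdim M) cs" "length cs = p" "set cs \<subseteq> charts M"
    and k: "k < p * mdim M"
    unfolding charts_power mdim_power by blast
  have i: "k div mdim M < p" "k mod mdim M < mdim M"
    using k less_mult_imp_div_less by (auto intro!: mod_less_divisor gr_zeroI)
  let ?c = "cs ! (k div mdim M)"
  have "(fst ?c, snd ?c) \<in> charts M" using cs i by auto
  from smooth_map_realD[OF F[OF i(1)] this i(2)]
  have "smooth_real N ((\<lambda>x. F x ! (k div mdim M)) -` fst ?c) (\<lambda>x. \<Phi> (F x) k)"
    using k by (simp add: cs power_chart_def)
  then show "smooth_real N (F -` D) (\<lambda>x. \<Phi> (F x) k)"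
    by (rule smooth_real_subset) (use cs i in \<open>auto simp: power_dom_def\<close>)
qed

section \<open>Smooth maps into V and GL(V)\<close>

lemma fin_dim_coords:
  assumes "fin_dim TYPE('v::real_vector)"
  obtains \<phi> :: "'v::real_vector \<Rightarrow> nat \<Rightarrow> real" and b :: "nat \<Rightarrow> 'v::real_vector"
  where "(UNIV, \<phi>) \<in> charts (vector_mfd :: 'v mfd)"
    and "\<forall>i. linear (\<lambda>v. \<phi> v i)"
    and "\<forall>v. v = (\<Sum>i<dim (UNIV :: 'v set). \<phi> v i *\<^sub>R b i)"
    and "\<forall>i < dim (UNIV :: 'v set). b i = inv_into UNIV \<phi> (\<lambda>k. if k = i then 1 else 0)"
proof -
  let ?n = "dim (UNIV :: 'v set)"
  obtain B :: "'v set" where B: "independent B" "span B = UNIV" "card B = ?n"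
    using basis_exists[of "UNIV :: 'v set"] by (metis top.extremum_uniqueI)
  have "finite B"
    using assms B(1) independent_span_bound unfolding fin_dim_def by blast
  then obtain b where b: "bij_betw b {..<?n} B"
    using ex_bij_betw_nat_finite[of B] B(3) atLeast0LessThan by metis
  have binj: "inj_on b {..<?n}" and bim: "b ` {..<?n} = B" using b by (auto simp: bij_betw_def)
  \<comment> \<open>Coordinates in the basis \<open>B\<close>, padded by zeros so that they fill
    \<open>Euclidean_space ?n\<close>.\<close>
  define \<phi> where "\<phi> v i = (if i < ?n then representation B v (b i) else 0)" for v i
  have lin: "linear (\<lambda>v. \<phi> v i)" for i
    unfolding \<phi>_def using B
    by (cases "i < ?n") (auto intro!: linearI simp: representation_add representation_scale)
  have sum: "(\<Sum>i<?n. \<phi> v i *\<^sub>R b i) = v" for v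
  proof -
    have "(\<Sum>i<?n. \<phi> v i *\<^sub>R b i) = (\<Sum>i<?n. representation B v (b i) *\<^sub>R b i)" by (simp add: \<phi>_def)
    also have "\<dots> = (\<Sum>c\<in>B. representation B v c *\<^sub>R c)"
      using b by (rule sum.reindex_bij_betw)
    also have "\<dots> = v"
      using B \<open>finite B\<close> by (intro sum_representation_eq) auto
    finally show ?thesis .
  qed
  have coord: "\<phi> (\<Sum>i<?n. y i *\<^sub>R b i) = y" if y: "\<forall>i\<ge>?n. y i = 0" for y
  proof
    fix j
    have "\<phi> (\<Sum>i<?n. y i *\<^sub>R b i) j = (\<Sum>i<?n. y i * \<phi> (b i) j)"
      by (simp add: linear_sum[OF lin] linear_scale[OF lin])
    also have "\<dots> = y j"
    proof (cases "j < ?n")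
      case True
      have "\<phi> (b i) j = (if i = j then 1 else 0)" if "i < ?n" for i
        using representation_basis[OF B(1), of "b i"] bim that True binj
        by (auto simp: \<phi>_def inj_on_def)
      then have "(\<Sum>i<?n. y i * \<phi> (b i) j) = (\<Sum>i<?n. if i = j then y i else 0)"
        by (intro sum.cong) auto
      then show ?thesis using True by simp
    next
      case False
      then show ?thesis using y by (simp add: \<phi>_def)
    qed
    finally show "\<phi> (\<Sum>i<?n. y i *\<^sub>R b i) j = y j" .
  qed
  have inj: "inj \<phi>" 
  proof (rule injI)
    fix v w assume eq: "\<phi> v = \<phi> w"
    have "v = (\<Sum>i<?n. \<phi> v i *\<^sub>R b i)" by (rule sum[symmetric])
    also have "\<dots> = w" unfolding eq by (rule sum)
    finally show "v = w" .
  qed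
  have "\<phi> ` UNIV = topspace (Euclidean_space ?n)"
  proof
    show "\<phi> ` UNIV \<subseteq> topspace (Euclidean_space ?n)" by (auto simp: \<phi>_def topspace_Euclidean_space)
    show "topspace (Euclidean_space ?n) \<subseteq> \<phi> ` UNIV"
    proof
      fix y assume "y \<in> topspace (Euclidean_space ?n)"
      then have "\<phi> (\<Sum>i<?n. y i *\<^sub>R b i) = y" by (intro coord) (simp add: topspace_Euclidean_space)
      then show "y \<in> \<phi> ` UNIV" by (metis rangeI)
    qed
  qed
  with inj have bij: "bij_betw \<phi> UNIV (topspace (Euclidean_space ?n))" by (simp add: bij_betw_def)
  show thesis
  proof
    show "(UNIV, \<phi>) \<in> charts (vector_mfd :: 'v mfd)" using lin bij by (auto simp: vector_mfd_def)
    \<comment> \<open>The charts of \<open>GL_mfd\<close> describe the basis vectors in this form;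
      it lets matrix entries be read as coordinates of images of \<open>b\<close>.\<close>
    show "\<forall>i<?n. b i = inv_into UNIV \<phi> (\<lambda>k. if k = i then 1 else 0)"
    proof (intro allI impI)
      fix i assume i: "i < ?n"
      have "\<phi> (\<Sum>l<?n. (if l = i then 1 else 0) *\<^sub>R b l) = (\<lambda>k. if k = i then 1 else 0)"
        using i by (intro coord) auto
      moreover have "(\<Sum>l<?n. (if l = i then 1 else 0) *\<^sub>R b l) = b i"
      proof -
        have "(\<Sum>l<?n. (if l = i then 1 else 0) *\<^sub>R b l) = (\<Sum>l<?n. if l = i then b l else 0)"
          by (intro sum.cong) auto
        then show ?thesis using i by simp
      qed
      ultimately show "b i = inv_into UNIV \<phi> (\<lambda>k. if k = i then 1 else 0)" using inj inv_f_f by metis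
    qed
  qed (use lin sum in auto)
qed

text \<open>In finite dimension this is \<^const>\<open>smooth_map\<close> into \<^const>\<open>vector_mfd\<close>, without reference to charts of \<open>V\<close>.\<close>

definition smooth_vec :: "'a mfd \<Rightarrow> ('a \<Rightarrow> 'v::real_vector) \<Rightarrow> bool" where
  "smooth_vec A f \<longleftrightarrow> (\<forall>l. linear l \<longrightarrow> smooth_real A UNIV (\<lambda>x. l (f x)))"

text \<open>Chart coordinates are functionals, and every functional is a combination of the
  coordinates of one chart. Continuity follows because functionals generate the topology and smooth
  real functions are continuous.\<close>

lemma smooth_map_vector_iff:
  fixes f :: "'a \<Rightarrow> 'v::real_vector"
  assumes A: "charted A" and fin: "fin_dim TYPE('v)"
  shows "smooth_map A vector_mfd f \<longleftrightarrow> smooth_vec A f"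
proof
  assume f: "smooth_map A vector_mfd f"
  obtain \<phi> and b :: "nat \<Rightarrow> 'v" where \<phi>: "(UNIV, \<phi>) \<in> charts (vector_mfd :: 'v mfd)"
    and lin\<phi>: "\<forall>i. linear (\<lambda>v. \<phi> v i)"
    and b: "\<forall>v. v = (\<Sum>i<dim (UNIV :: 'v set). \<phi> v i *\<^sub>R b i)"
    and bi: "\<forall>i<dim (UNIV :: 'v set). b i = inv_into UNIV \<phi> (\<lambda>k. if k = i then 1 else 0)"
    by (rule fin_dim_coords[OF fin])
  have comp: "smooth_real A UNIV (\<lambda>x. \<phi> (f x) i)" if "i < dim (UNIV :: 'v set)" for i
    using smooth_map_realD[OF f \<phi>, of i] that by (simp add: vector_mfd_def)
  show "smooth_vec A f"
    unfolding smooth_vec_def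
  proof (intro allI impI)
    fix l :: "'v \<Rightarrow> real" assume l: "linear l"
    have "l (f x) = (\<Sum>i<dim (UNIV :: 'v set). \<phi> (f x) i * l (b i))" for x
      by (subst b[rule_format, of "f x"]) (simp add: linear_sum[OF l] linear_scale[OF l])
    then show "smooth_real A UNIV (\<lambda>x. l (f x))"
      using comp by (auto intro!: smooth_real_sum smooth_real_mult smooth_real_const)
  qed
next
  assume f: "smooth_vec A f"
  show "smooth_map A vector_mfd f"
    unfolding smooth_map_iff
  proof (intro conjI ballI, safe)
    show "continuous_map (mtop A) (mtop vector_mfd) f"
      unfolding vector_mfd_def mfd.simps
    proof (rule continuous_on_generated_topo)
      fix U assume "U \<in> {l -` W | (l :: 'v \<Rightarrow> real) W. linear l \<and> open W}"
      then obtain l :: "'v \<Rightarrow> real" and W where U: "U = l -` W" "linear l" "open W" by blast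
      have "continuous_map (mtop A) euclideanreal (\<lambda>x. l (f x))"
        using f U(2) smooth_real_continuous[OF A] by (auto simp: smooth_vec_def)
      from openin_continuous_map_preimage[OF this, of W] U(3)
      have "openin (mtop A) {x \<in> topspace (mtop A). l (f x) \<in> W}" by simp
      also have "{x \<in> topspace (mtop A). l (f x) \<in> W} = f -` U \<inter> topspace (mtop A)" using U(1) by auto
      finally show "openin (mtop A) (f -` U \<inter> topspace (mtop A))" .
    next
      \<comment> \<open>The zero functional contributes the generating set \<open>UNIV\<close>, so
        the generated topology lives on all of V.\<close>
      have "linear (\<lambda>_::'v. 0::real)" by (rule linearI) auto
      then have "UNIV \<in> {l -` W | (l :: 'v \<Rightarrow> real) W. linear l \<and> open W}"
        by (intro CollectI exI[of _ "\<lambda>_. 0"] exI[of _ UNIV]) simp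
      then show "f ` topspace (mtop A) \<subseteq> \<Union> {l -` W | (l :: 'v \<Rightarrow> real) W. linear l \<and> open W}" by blast
    qed
    fix W \<psi> j assume "(W, \<psi>) \<in> charts (vector_mfd :: 'v mfd)"
    then have W: "W = UNIV" "linear (\<lambda>v. \<psi> v j)" by (auto simp: vector_mfd_def)
    show "smooth_real A (f -` W) (\<lambda>x. \<psi> (f x) j)"
      using f[unfolded smooth_vec_def, rule_format, OF W(2)] by (simp add: W(1))
  qed
qed

text \<open>For fixed \<open>l\<close> and \<open>u\<close>, the number
  \<open>l (\<Theta> x u)\<close> is a combination with constant coefficients of the matrix entries
  listed by a chart of \<open>GL_mfd\<close>.\<close>

lemma smooth_map_GL_entries:
  fixes \<Theta> :: "'a \<Rightarrow> 'v::real_vector \<Rightarrow> 'v"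
  assumes A: "charted A" and fin: "fin_dim TYPE('v)" and \<Theta>: "smooth_map A GL_mfd \<Theta>"
    and GL: "\<And>x. x \<in> topspace (mtop A) \<Longrightarrow> \<Theta> x \<in> carrier GL"
  shows "smooth_vec A (\<lambda>x. \<Theta> x u)"
  unfolding smooth_vec_def
proof (intro allI impI)
  fix l :: "'v \<Rightarrow> real" assume l: "linear l"
  let ?m = "dim (UNIV :: 'v set)"
  obtain \<phi> and b :: "nat \<Rightarrow> 'v" where \<phi>: "(UNIV, \<phi>) \<in> charts (vector_mfd :: 'v mfd)"
    and lin\<phi>: "\<forall>i. linear (\<lambda>v. \<phi> v i)"
    and b: "\<forall>v. v = (\<Sum>i<dim (UNIV :: 'v set). \<phi> v i *\<^sub>R b i)"
    and bi: "\<forall>i<dim (UNIV :: 'v set). b i = inv_into UNIV \<phi> (\<lambda>k. if k = i then 1 else 0)"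
    by (rule fin_dim_coords[OF fin])
  let ?\<Phi> = "\<lambda>A k. if k < ?m * ?m then \<phi> (A (inv_into UNIV \<phi> (\<lambda>i. if i = k mod ?m then 1 else 0))) (k div ?m) else 0"
  have ch: "(carrier GL, ?\<Phi>) \<in> charts (GL_mfd :: ('v \<Rightarrow> 'v) mfd)"
    unfolding GL_mfd_def Let_def using \<phi> by auto
  have entry: "smooth_real A UNIV (\<lambda>x. \<phi> (\<Theta> x (b j)) i)" if "i < ?m" "j < ?m" for i j
  proof -
    \<comment> \<open>Row \<open>i\<close>, column \<open>j\<close> of the matrix sits at position
      \<open>i * ?m + j\<close> of the chart.\<close>
    have k: "i * ?m + j < ?m * ?m" using that by (rule block_index_less)
    then have "smooth_real A (\<Theta> -` carrier GL) (\<lambda>x. ?\<Phi> (\<Theta> x) (i * ?m + j))"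
      by (intro smooth_map_realD[OF \<Theta> ch]) (simp add: GL_mfd_def Let_def)
    then have "smooth_real A (\<Theta> -` carrier GL) (\<lambda>x. \<phi> (\<Theta> x (b j)) i)"
      using k that bi that(2) by simp
    then have "smooth_real A (topspace (mtop A)) (\<lambda>x. \<phi> (\<Theta> x (b j)) i)"
      by (rule smooth_real_subset) (use GL in auto)
    then show ?thesis by (rule smooth_real_cong[OF A openin_topspace]) auto
  qed
  have eq: "l (\<Theta> x u) = (\<Sum>j<?m. \<phi> u j * (\<Sum>i<?m. \<phi> (\<Theta> x (b j)) i * l (b i)))"
    if "x \<in> topspace (mtop A)" for x
  proof -
    have lin: "linear (\<Theta> x)" using GL[OF that] by (simp add: GL_def)
    have 1: "l (\<Theta> x u) = (\<Sum>j<?m. \<phi> u j * l (\<Theta> x (b j)))"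
      by (subst b[rule_format, of u])
         (simp add: linear_sum[OF l] linear_scale[OF l] linear_sum[OF lin] linear_scale[OF lin])
    have 2: "l v = (\<Sum>i<?m. \<phi> v i * l (b i))" for v
      by (subst b[rule_format, of v]) (simp add: linear_sum[OF l] linear_scale[OF l])
    show ?thesis unfolding 1 by (rule sum.cong[OF refl], rule arg_cong[OF 2])
  qed
  have "smooth_real A UNIV (\<lambda>x. \<Sum>j<?m. \<phi> u j * (\<Sum>i<?m. \<phi> (\<Theta> x (b j)) i * l (b i)))"
    by (auto intro!: smooth_real_sum smooth_real_mult smooth_real_const entry)
  then show "smooth_real A UNIV (\<lambda>x. l (\<Theta> x u))"
    by (rule smooth_real_cong_UNIV[OF A]) (rule eq[symmetric])
qed

lemma smooth_vec_compose:
  "charted A \<Longrightarrow> charted B \<Longrightarrow> smooth_map A B F \<Longrightarrow> smooth_vec B f \<Longrightarrow> smooth_vec A (\<lambda>x. f (F x))"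
  unfolding smooth_vec_def by (auto intro: smooth_real_compose_UNIV)

lemma smooth_vec_cong:
  "charted A \<Longrightarrow> smooth_vec A f \<Longrightarrow> (\<And>x. x \<in> topspace (mtop A) \<Longrightarrow> f x = f' x) \<Longrightarrow> smooth_vec A f'"
  unfolding smooth_vec_def by (auto elim!: smooth_real_cong_UNIV)

lemma smooth_vec_add: "smooth_vec A f \<Longrightarrow> smooth_vec A g \<Longrightarrow> smooth_vec A (\<lambda>x. f x + g x)"
  unfolding smooth_vec_def by (auto simp: linear_add intro: smooth_real_add)

lemma smooth_vec_linear: "linear T \<Longrightarrow> smooth_vec A f \<Longrightarrow> smooth_vec A (\<lambda>x. T (f x))"
  unfolding smooth_vec_def using linear_compose[of T] by (auto simp: o_def)

lemma smooth_vec_scale: "smooth_vec A f \<Longrightarrow> smooth_vec A (\<lambda>x. c *\<^sub>R f x)"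
  by (rule smooth_vec_linear) (auto intro: linearI simp: algebra_simps)

lemma smooth_vec_minus: "smooth_vec A f \<Longrightarrow> smooth_vec A (\<lambda>x. - f x)"
  using smooth_vec_scale[of A f "-1"] by simp

lemma smooth_vec_diff: "smooth_vec A f \<Longrightarrow> smooth_vec A g \<Longrightarrow> smooth_vec A (\<lambda>x. f x - g x)"
  using smooth_vec_add[OF _ smooth_vec_minus] by fastforce

lemma smooth_vec_zero: "smooth_vec A (\<lambda>x. 0)"
  unfolding smooth_vec_def by (auto simp: linear_0 intro: smooth_real_const)

lemma smooth_vec_sum: "(\<And>i. i \<in> I \<Longrightarrow> smooth_vec A (f i)) \<Longrightarrow> smooth_vec A (\<lambda>x. \<Sum>i\<in>I. f i x)"
  by (induction I rule: infinite_finite_induct) (auto intro: smooth_vec_add smooth_vec_zero)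

text \<open>Evaluation is bilinear: expanding \<open>f x\<close> in a basis turns
  \<open>l (\<Theta> x (f x))\<close> into a sum of products of smooth real functions. This avoids a
  product manifold of GL(V) and V.\<close>

lemma smooth_vec_apply:
  fixes \<Theta> :: "'a \<Rightarrow> 'v::real_vector \<Rightarrow> 'v"
  assumes A: "charted A" and fin: "fin_dim TYPE('v)"
    and lin: "\<And>x. x \<in> topspace (mtop A) \<Longrightarrow> linear (\<Theta> x)"
    and \<Theta>: "\<And>u. smooth_vec A (\<lambda>x. \<Theta> x u)" and f: "smooth_vec A f"
  shows "smooth_vec A (\<lambda>x. \<Theta> x (f x))"
  unfolding smooth_vec_def
proof (intro allI impI)
  fix l :: "'v \<Rightarrow> real" assume l: "linear l"
  let ?m = "dim (UNIV :: 'v set)"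
  obtain \<phi> and b :: "nat \<Rightarrow> 'v" where \<phi>: "(UNIV, \<phi>) \<in> charts (vector_mfd :: 'v mfd)"
    and lin\<phi>: "\<forall>i. linear (\<lambda>v. \<phi> v i)"
    and b: "\<forall>v. v = (\<Sum>i<dim (UNIV :: 'v set). \<phi> v i *\<^sub>R b i)"
    and bi: "\<forall>i<dim (UNIV :: 'v set). b i = inv_into UNIV \<phi> (\<lambda>k. if k = i then 1 else 0)"
    by (rule fin_dim_coords[OF fin])
  have "smooth_real A UNIV (\<lambda>x. \<Sum>j<?m. \<phi> (f x) j * l (\<Theta> x (b j)))"
    using \<Theta> f lin\<phi> l unfolding smooth_vec_def by (auto intro!: smooth_real_sum smooth_real_mult)
  then show "smooth_real A UNIV (\<lambda>x. l (\<Theta> x (f x)))"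
  proof (rule smooth_real_cong_UNIV[OF A])
    fix x assume "x \<in> topspace (mtop A)"
    note L = lin[OF this]
    show "(\<Sum>j<?m. \<phi> (f x) j * l (\<Theta> x (b j))) = l (\<Theta> x (f x))"
      by (subst (2) b[rule_format, of "f x"])
         (simp add: linear_sum[OF l] linear_scale[OF l] linear_sum[OF L] linear_scale[OF L])
  qed
qed

section \<open>The long exact cohomology sequence\<close>

lemma cochain_complexD:
  assumes "cochain_complex A"
  shows "comm_group (grp A n)" "diff A n \<in> hom (grp A n) (grp A (Suc n))"
    and "x \<in> carrier (grp A n) \<Longrightarrow> diff A (Suc n) (diff A n x) = \<one>\<^bsub>grp A (Suc (Suc n))\<^esub>"
  using assms unfolding cochain_complex_def by blast+

lemma cochain_complex_group: "cochain_complex A \<Longrightarrow> group (grp A n)"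
  using cochain_complexD(1) comm_group.axioms(2) by blast

lemma cochain_complex_group_hom:
  "cochain_complex A \<Longrightarrow> group_hom (grp A n) (grp A (Suc n)) (diff A n)"
  by (simp add: group_hom_def group_hom_axioms_def cochain_complex_group cochain_complexD)

lemma cocycles_iff:
  "x \<in> cocycles A n \<longleftrightarrow> x \<in> carrier (grp A n) \<and> diff A n x = \<one>\<^bsub>grp A (Suc n)\<^esub>"
  by (auto simp: cocycles_def kernel_def)

lemma subgroup_cocycles: "cochain_complex A \<Longrightarrow> subgroup (cocycles A n) (grp A n)"
  unfolding cocycles_def by (rule group_hom.subgroup_kernel[OF cochain_complex_group_hom])

lemma subgroup_coboundaries:
  assumes "cochain_complex A"
  shows "subgroup (coboundaries A n) (grp A n)"
proof (cases n)
  case 0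
  then show ?thesis
    using group.triv_subgroup[OF cochain_complex_group[OF assms]] by (simp add: coboundaries_def)
next
  case (Suc m)
  then show ?thesis
    using group_hom.img_is_subgroup[OF cochain_complex_group_hom[OF assms, of m]]
    by (simp add: coboundaries_def)
qed

lemma coboundaries_subset_cocycles:
  assumes A: "cochain_complex A"
  shows "coboundaries A n \<subseteq> cocycles A n"
proof (cases n)
  case 0
  then show ?thesis
    using subgroup.one_closed[OF subgroup_cocycles[OF A]] by (simp add: coboundaries_def)
next
  case (Suc m)
  then show ?thesis
    using cochain_complexD(3)[OF A] hom_in_carrier[OF cochain_complexD(2)[OF A]]
    by (auto simp: coboundaries_def cocycles_iff)
qed

lemma coclass_eq_iff:
  assumes A: "cochain_complex A" and x: "x \<in> carrier (grp A n)" and y: "y \<in> carrier (grp A n)"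
  shows "coclass A n x = coclass A n y \<longleftrightarrow> x \<otimes>\<^bsub>grp A n\<^esub> inv\<^bsub>grp A n\<^esub> y \<in> coboundaries A n"
proof -
  note G = cochain_complex_group[OF A, of n] and S = subgroup_coboundaries[OF A, of n]
  have "x \<in> coclass A n x"
    unfolding coclass_def by (rule group.rcos_self[OF G x S])
  then have "coclass A n x = coclass A n y \<longleftrightarrow> x \<in> coclass A n y"
    unfolding coclass_def using group.repr_independence[OF G _ y S] by auto
  also have "\<dots> \<longleftrightarrow> x \<otimes>\<^bsub>grp A n\<^esub> inv\<^bsub>grp A n\<^esub> y \<in> coboundaries A n"
    unfolding coclass_def by (rule subgroup.rcos_module[OF S G y x])
  finally show ?thesis .
qed

lemma coclass_one: "cochain_complex A \<Longrightarrow> coclass A n \<one>\<^bsub>grp A n\<^esub> = coboundaries A n"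
  unfolding coclass_def
  by (rule group.coset_mult_one[OF cochain_complex_group]) (auto dest: subgroup_coboundaries subgroup.subset)

lemma coclass_eq_coboundaries_iff:
  assumes A: "cochain_complex A" and x: "x \<in> carrier (grp A n)"
  shows "coclass A n x = coboundaries A n \<longleftrightarrow> x \<in> coboundaries A n"
  using group.coset_join1[OF cochain_complex_group[OF A] _ x subgroup_coboundaries[OF A]]
    group.coset_join2[OF cochain_complex_group[OF A] x subgroup_coboundaries[OF A]]
  unfolding coclass_def by blast

text \<open>The subgroup generated by the cocycles has the cocycles as carrier and the
  multiplication of the cochain group, so cosets of the coboundaries are the same sets in both
  groups. Commutativity makes the coboundaries normal.\<close>

lemma
  assumes A: "cochain_complex A"
  shows cohomology_group: "group (cohomology A n)"
    and carrier_cohomology: "carrier (cohomology A n) = coclass A n ` cocycles A n"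
    and one_cohomology: "\<one>\<^bsub>cohomology A n\<^esub> = coboundaries A n"
    and mult_cohomology: "x \<in> cocycles A n \<Longrightarrow> y \<in> cocycles A n \<Longrightarrow>
      coclass A n x \<otimes>\<^bsub>cohomology A n\<^esub> coclass A n y = coclass A n (x \<otimes>\<^bsub>grp A n\<^esub> y)"
proof -
  interpret G: comm_group "grp A n" by (rule cochain_complexD(1)[OF A])
  let ?Z = "subgroup_generated (grp A n) (cocycles A n)"
  have cZ: "carrier ?Z = cocycles A n"
    using subgroup_cocycles[OF A] by (rule subgroup.carrier_subgroup_generated_subgroup)
  have Z: "comm_group ?Z"
    using G.abelian_subgroup_generated[OF G.comm_group_axioms] .
  have B: "subgroup (coboundaries A n) ?Z"
    using G.subgroup_subgroup_generated_iff[of "coboundaries A n" "cocycles A n"]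
      subgroup_coboundaries[OF A] coboundaries_subset_cocycles[OF A] by (simp add: cZ)
  have rc: "coboundaries A n #>\<^bsub>?Z\<^esub> x = coclass A n x" for x
    by (simp add: r_coset_def coclass_def)
  show "group (cohomology A n)"
    unfolding cohomology_def by (rule comm_group.axioms(2)[OF comm_group.abelian_FactGroup[OF Z B]])
  show "carrier (cohomology A n) = coclass A n ` cocycles A n"
    unfolding cohomology_def carrier_FactGroup cZ rc ..
  show "\<one>\<^bsub>cohomology A n\<^esub> = coboundaries A n" by (simp add: cohomology_def)
  have "coboundaries A n \<lhd> ?Z"
    using comm_group.normal_iff_subgroup[OF Z] B by simp
  from normal.rcos_sum[OF this] show "coclass A n x \<otimes>\<^bsub>cohomology A n\<^esub> coclass A n y = coclass A n (x \<otimes>\<^bsub>grp A n\<^esub> y)"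
    if "x \<in> cocycles A n" "y \<in> cocycles A n"
    using that by (simp add: cohomology_def rc cZ)
qed

text \<open>\<open>R x y\<close> reads: \<open>y\<close> is an admissible representative of the
  image of the class of \<open>x\<close>. A relation takes the place of a function because for the
  connecting map \<open>y\<close> depends on a choice of lift.\<close>

lemma cohomology_homI:
  assumes A: "cochain_complex A" and B: "cochain_complex B"
    and F: "\<And>x. x \<in> cocycles A n \<Longrightarrow> \<exists>y\<in>cocycles B m. R x y \<and> F (coclass A n x) = coclass B m y"
    and R: "\<And>x y x' y'. x \<in> cocycles A n \<Longrightarrow> y \<in> cocycles B m \<Longrightarrow> R x y \<Longrightarrow>
       x' \<in> cocycles A n \<Longrightarrow> y' \<in> cocycles B m \<Longrightarrow> R x' y' \<Longrightarrow>
       F (coclass A n (x \<otimes>\<^bsub>grp A n\<^esub> x')) = coclass B m (y \<otimes>\<^bsub>grp B m\<^esub> y')"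
  shows "F \<in> hom (cohomology A n) (cohomology B m)"
proof (rule homI)
  fix c assume "c \<in> carrier (cohomology A n)"
  then obtain x where x: "x \<in> cocycles A n" "c = coclass A n x"
    unfolding carrier_cohomology[OF A] by blast
  with F[OF x(1)] show "F c \<in> carrier (cohomology B m)"
    unfolding carrier_cohomology[OF B] by auto
  fix c' assume "c' \<in> carrier (cohomology A n)"
  then obtain x' where x': "x' \<in> cocycles A n" "c' = coclass A n x'"
    unfolding carrier_cohomology[OF A] by blast
  obtain y where y: "y \<in> cocycles B m" "R x y" "F c = coclass B m y" using F[OF x(1)] x(2) by blast
  obtain y' where y': "y' \<in> cocycles B m" "R x' y'" "F c' = coclass B m y'" using F[OF x'(1)] x'(2) by blast
  show "F (c \<otimes>\<^bsub>cohomology A n\<^esub> c') = F c \<otimes>\<^bsub>cohomology B m\<^esub> F c'"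
    unfolding y(3) y'(3) mult_cohomology[OF B y(1) y'(1)]
    unfolding x(2) x'(2) mult_cohomology[OF A x(1) x'(1)]
    using R[OF x(1) y(1,2) x'(1) y'(1,2)] .
qed

section \<open>Maps induced on cohomology\<close>

lemma cochain_mapD:
  assumes "cochain_map A B f"
  shows "f n \<in> hom (grp A n) (grp B n)"
    and "x \<in> carrier (grp A n) \<Longrightarrow> f (Suc n) (diff A n x) = diff B n (f n x)"
  using assms unfolding cochain_map_def by blast+

lemma cochain_map_group_hom:
  "cochain_complex A \<Longrightarrow> cochain_complex B \<Longrightarrow> cochain_map A B f \<Longrightarrow> group_hom (grp A n) (grp B n) (f n)"
  by (simp add: group_hom_def group_hom_axioms_def cochain_complex_group cochain_mapD)

lemma cochain_map_cocycles:
  assumes A: "cochain_complex A" and B: "cochain_complex B" and f: "cochain_map A B f"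
    and x: "x \<in> cocycles A n"
  shows "f n x \<in> cocycles B n"
proof -
  interpret f: group_hom "grp A n" "grp B n" "f n" by (rule cochain_map_group_hom[OF A B f])
  interpret f': group_hom "grp A (Suc n)" "grp B (Suc n)" "f (Suc n)" by (rule cochain_map_group_hom[OF A B f])
  show ?thesis
    using x cochain_mapD(2)[OF f, of x n] f'.hom_one by (auto simp: cocycles_iff)
qed

lemma cochain_map_coboundaries:
  assumes A: "cochain_complex A" and B: "cochain_complex B" and f: "cochain_map A B f"
    and x: "x \<in> coboundaries A n"
  shows "f n x \<in> coboundaries B n"
proof (cases n)
  case 0
  then show ?thesis
    using x group_hom.hom_one[OF cochain_map_group_hom[OF A B f, of 0]] by (simp add: coboundaries_def)
next
  case (Suc m)
  then obtain z where z: "z \<in> carrier (grp A m)" "x = diff A m z"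
    using x by (auto simp: coboundaries_def)
  then have "f n x = diff B m (f m z)" "f m z \<in> carrier (grp B m)"
    using cochain_mapD[OF f] hom_in_carrier Suc by fastforce+
  then show ?thesis using Suc by (auto simp: coboundaries_def)
qed

text \<open>\<open>f\<close> maps coboundaries to coboundaries, so the image of a class lies in one
  class, but it need not fill it. The product with all coboundaries of \<open>B\<close> does, since
  \<open>x\<close> belongs to its own class.\<close>

lemma induced_map_coclass:
  assumes A: "cochain_complex A" and B: "cochain_complex B" and f: "cochain_map A B f"
    and x: "x \<in> carrier (grp A n)"
  shows "induced_map B f n (coclass A n x) = coclass B n (f n x)"
proof -
  interpret f: group_hom "grp A n" "grp B n" "f n" by (rule cochain_map_group_hom[OF A B f])
  note SA = subgroup_coboundaries[OF A, of n] and SB = subgroup_coboundaries[OF B, of n]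
  have *: "b \<otimes>\<^bsub>grp B n\<^esub> f n (a \<otimes>\<^bsub>grp A n\<^esub> x) = (b \<otimes>\<^bsub>grp B n\<^esub> f n a) \<otimes>\<^bsub>grp B n\<^esub> f n x"
      "b \<otimes>\<^bsub>grp B n\<^esub> f n a \<in> coboundaries B n"
    if "a \<in> coboundaries A n" "b \<in> coboundaries B n" for a b
    using that x subgroup.mem_carrier[OF SA] subgroup.mem_carrier[OF SB] f.H.m_assoc
      cochain_map_coboundaries[OF A B f that(1)] subgroup.m_closed[OF SB] by auto
  show ?thesis
  proof
    show "induced_map B f n (coclass A n x) \<subseteq> coclass B n (f n x)"
    proof
      fix z assume "z \<in> induced_map B f n (coclass A n x)"
      then obtain a b where "a \<in> coboundaries A n" "b \<in> coboundaries B n"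
        "z = b \<otimes>\<^bsub>grp B n\<^esub> f n (a \<otimes>\<^bsub>grp A n\<^esub> x)"
        by (auto simp: induced_map_def coclass_def set_mult_def r_coset_def)
      with * show "z \<in> coclass B n (f n x)"
        unfolding coclass_def r_coset_def by blast
    qed
    show "coclass B n (f n x) \<subseteq> induced_map B f n (coclass A n x)"
    proof
      fix z assume "z \<in> coclass B n (f n x)"
      then obtain b where b: "b \<in> coboundaries B n" "z = b \<otimes>\<^bsub>grp B n\<^esub> f n x"
        by (auto simp: coclass_def r_coset_def)
      have "x \<in> coclass A n x"
        unfolding coclass_def by (rule f.G.rcos_self[OF x SA])
      with b show "z \<in> induced_map B f n (coclass A n x)"
        by (auto simp: induced_map_def set_mult_def)
    qed
  qed
qed

lemma induced_map_hom:
  assumes A: "cochain_complex A" and B: "cochain_complex B" and f: "cochain_map A B f"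
  shows "induced_map B f n \<in> hom (cohomology A n) (cohomology B n)"
proof (rule cohomology_homI[OF A B, where R = "\<lambda>x y. y = f n x"])
  fix x assume x: "x \<in> cocycles A n"
  then show "\<exists>y\<in>cocycles B n. y = f n x \<and> induced_map B f n (coclass A n x) = coclass B n y"
    using cochain_map_cocycles[OF A B f x] induced_map_coclass[OF A B f] by (auto simp: cocycles_iff)
next
  fix x y x' y' assume x: "x \<in> cocycles A n" "x' \<in> cocycles A n" and y: "y = f n x" "y' = f n x'"
  have "x \<otimes>\<^bsub>grp A n\<^esub> x' \<in> carrier (grp A n)"
    using x subgroup.m_closed[OF subgroup_cocycles[OF A]] by (auto simp: cocycles_iff)
  then show "induced_map B f n (coclass A n (x \<otimes>\<^bsub>grp A n\<^esub> x')) = coclass B n (y \<otimes>\<^bsub>grp B n\<^esub> y')"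
    using induced_map_coclass[OF A B f] hom_mult[OF cochain_mapD(1)[OF f]] x
    by (simp add: y cocycles_iff)
qed

section \<open>The connecting map of a short exact sequence of complexes\<close>

locale short_exact =
  fixes A :: "'a cochains" and B :: "'b cochains" and C :: "'c cochains"
    and i :: "nat \<Rightarrow> 'a \<Rightarrow> 'b" and p :: "nat \<Rightarrow> 'b \<Rightarrow> 'c"
  assumes ses: "short_exact_complexes A B C i p"
begin

lemma A: "cochain_complex A" and B: "cochain_complex B" and C: "cochain_complex C"
  and i: "cochain_map A B i" and p: "cochain_map B C p"
  using ses unfolding short_exact_complexes_def by blast+

lemma i_inj: "inj_on (i n) (carrier (grp A n))"
  using ses unfolding short_exact_complexes_def mon_def by blast

lemma p_surj: "p n ` carrier (grp B n) = carrier (grp C n)"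
  using ses unfolding short_exact_complexes_def epi_def by blast

lemma image_i: "i n ` carrier (grp A n) = kernel (grp B n) (grp C n) (p n)"
  using ses unfolding short_exact_complexes_def exact_at_def by blast

sublocale A: comm_group "grp A n" for n by (rule cochain_complexD(1)[OF A])
sublocale B: comm_group "grp B n" for n by (rule cochain_complexD(1)[OF B])
sublocale C: comm_group "grp C n" for n by (rule cochain_complexD(1)[OF C])
sublocale dA: group_hom "grp A n" "grp A (Suc n)" "diff A n" for n by (rule cochain_complex_group_hom[OF A])
sublocale dB: group_hom "grp B n" "grp B (Suc n)" "diff B n" for n by (rule cochain_complex_group_hom[OF B])
sublocale dC: group_hom "grp C n" "grp C (Suc n)" "diff C n" for n by (rule cochain_complex_group_hom[OF C])
sublocale i: group_hom "grp A n" "grp B n" "i n" for n by (rule cochain_map_group_hom[OF A B i])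
sublocale p: group_hom "grp B n" "grp C n" "p n" for n by (rule cochain_map_group_hom[OF B C p])

lemma p_i: "a \<in> carrier (grp A n) \<Longrightarrow> p n (i n a) = \<one>\<^bsub>grp C n\<^esub>"
  using image_i[of n] by (auto simp: kernel_def)

lemma i_lift:
  assumes "y \<in> carrier (grp B n)" "p n y = \<one>\<^bsub>grp C n\<^esub>"
  obtains a where "a \<in> carrier (grp A n)" "i n a = y"
proof -
  have "y \<in> i n ` carrier (grp A n)" using assms by (simp add: image_i kernel_def)
  then show thesis using that by blast
qed

lemma p_lift:
  assumes "c \<in> carrier (grp C n)"
  obtains y where "y \<in> carrier (grp B n)" "p n y = c"
proof -
  have "c \<in> p n ` carrier (grp B n)" using assms by (simp add: p_surj)
  then show thesis using that by blast
qed

lemma i_one: "a \<in> carrier (grp A n) \<Longrightarrow> i n a = \<one>\<^bsub>grp B n\<^esub> \<Longrightarrow> a = \<one>\<^bsub>grp A n\<^esub>"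
  using inj_onD[OF i_inj, of n a "\<one>\<^bsub>grp A n\<^esub>"] by simp

lemmas i_diff = cochain_mapD(2)[OF i] and p_diff = cochain_mapD(2)[OF p]

lemma boundary_iff: "x \<in> coboundaries X (Suc n) \<longleftrightarrow> (\<exists>z\<in>carrier (grp X n). x = diff X n z)"
  by (auto simp: coboundaries_def)

text \<open>Injectivity of \<open>i\<close> reduces the claim on \<open>x\<close> to
  \<open>diff B (Suc n) (diff B n y)\<close> being trivial. For \<open>p n y\<close>, the
  differential is \<open>p (Suc n) (i (Suc n) x)\<close>, which is trivial by exactness.\<close>

lemma connecting_cocycle:
  assumes y: "y \<in> carrier (grp B n)" and x: "x \<in> carrier (grp A (Suc n))" "i (Suc n) x = diff B n y"
  shows "x \<in> cocycles A (Suc n)" "p n y \<in> cocycles C n"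
proof -
  have "i (Suc (Suc n)) (diff A (Suc n) x) = \<one>\<^bsub>grp B (Suc (Suc n))\<^esub>"
    using i_diff[OF x(1)] x(2) cochain_complexD(3)[OF B y] by simp
  then show "x \<in> cocycles A (Suc n)"
    using x i_one by (simp add: cocycles_iff)
  show "p n y \<in> cocycles C n"
    using p_diff[OF y] p_i[OF x(1)] x(2) y by (simp add: cocycles_iff)
qed

lemma connecting_lift:
  assumes \<alpha>: "\<alpha> \<in> cocycles C n"
  obtains y x where "y \<in> carrier (grp B n)" "p n y = \<alpha>"
    "x \<in> cocycles A (Suc n)" "i (Suc n) x = diff B n y"
proof -
  obtain y where y: "y \<in> carrier (grp B n)" "p n y = \<alpha>"
    using p_lift[of \<alpha> n] \<alpha> by (auto simp: cocycles_iff)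
  have "p (Suc n) (diff B n y) = \<one>\<^bsub>grp C (Suc n)\<^esub>"
    using p_diff[OF y(1)] y(2) \<alpha> by (simp add: cocycles_iff)
  then obtain x where x: "x \<in> carrier (grp A (Suc n))" "i (Suc n) x = diff B n y"
    using i_lift[of "diff B n y" "Suc n"] y(1) by auto
  show thesis using that[OF y connecting_cocycle(1)[OF y(1) x] x(2)] .
qed

text \<open>Well-definedness in the form of an equality of sets. Changing the lift by
  \<open>i n a\<close> changes \<open>x\<close> by \<open>diff A n a\<close>; changing the
  representative by a coboundary of \<open>C\<close> lifts to a change by an element that
  \<open>diff B n\<close> kills.\<close>

lemma connecting_map_coclass:
  assumes y: "y \<in> carrier (grp B n)" and x: "x \<in> carrier (grp A (Suc n))" and eq: "i (Suc n) x = diff B n y"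
  shows "connecting_map A B i p n (coclass C n (p n y)) = coclass A (Suc n) x"
proof (intro subset_antisym subsetI)
  fix x' assume "x' \<in> coclass A (Suc n) x"
  then obtain a where a: "a \<in> carrier (grp A n)" "x' = diff A n a \<otimes>\<^bsub>grp A (Suc n)\<^esub> x"
    by (auto simp: coclass_def r_coset_def boundary_iff)
  let ?y = "i n a \<otimes>\<^bsub>grp B n\<^esub> y"
  have "p n ?y = p n y" using a y p_i by simp
  moreover have "p n y \<in> coclass C n (p n y)"
    unfolding coclass_def using y by (intro C.rcos_self subgroup_coboundaries[OF C]) simp
  moreover have "i (Suc n) x' = diff B n ?y" using a x y eq i_diff by simp
  ultimately show "x' \<in> connecting_map A B i p n (coclass C n (p n y))"
    unfolding connecting_map_def using a x y by (auto intro!: bexI[of _ ?y])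
next
  fix x' assume "x' \<in> connecting_map A B i p n (coclass C n (p n y))"
  then obtain y' where x': "x' \<in> carrier (grp A (Suc n))" and y': "y' \<in> carrier (grp B n)"
    "p n y' \<in> coclass C n (p n y)" "i (Suc n) x' = diff B n y'"
    unfolding connecting_map_def by blast
  \<comment> \<open>The discrepancy of the two representatives lifts to a cocycle of
    \<open>B\<close>: to a coboundary in positive degree, to the neutral element in degree
    0.\<close>
  obtain w where w: "w \<in> carrier (grp B n)" "diff B n w = \<one>\<^bsub>grp B (Suc n)\<^esub>" "p n y' = p n (w \<otimes>\<^bsub>grp B n\<^esub> y)"
  proof -
    obtain c where c: "c \<in> coboundaries C n" "p n y' = c \<otimes>\<^bsub>grp C n\<^esub> p n y"
      using y'(2) by (auto simp: coclass_def r_coset_def)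
    show thesis
    proof (cases n)
      case 0
      then have "c = \<one>\<^bsub>grp C n\<^esub>" using c by (simp add: coboundaries_def)
      then show thesis using that[of "\<one>\<^bsub>grp B n\<^esub>"] c y by simp
    next
      case (Suc m)
      then obtain d where d: "d \<in> carrier (grp C m)" "c = diff C m d" using c by (auto simp: boundary_iff)
      then obtain b where b: "b \<in> carrier (grp B m)" "p m b = d" using p_lift by blast
      then have "p n (diff B m b) = c" using p_diff[OF b(1)] d Suc by simp
      moreover have "diff B m b \<in> carrier (grp B n)" using b Suc by simp
      moreover have "diff B n (diff B m b) = \<one>\<^bsub>grp B (Suc n)\<^esub>" using cochain_complexD(3)[OF B b(1)] Suc by simp
      ultimately show thesis using that[of "diff B m b"] c y by simp
    qed
  qed
  let ?v = "w \<otimes>\<^bsub>grp B n\<^esub> y"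
  have v: "?v \<in> carrier (grp B n)" "diff B n ?v = diff B n y" using w y by simp_all
  \<comment> \<open>The two lifts now have the same image, so their quotient comes from some
    \<open>a\<close> in \<open>A\<close>, and \<open>diff A n a\<close> is the difference of
    \<open>x'\<close> and \<open>x\<close>.\<close>
  have "p n (y' \<otimes>\<^bsub>grp B n\<^esub> inv\<^bsub>grp B n\<^esub> ?v) = \<one>\<^bsub>grp C n\<^esub>"
    using w(3) v y' by simp
  then obtain a where a: "a \<in> carrier (grp A n)" "i n a = y' \<otimes>\<^bsub>grp B n\<^esub> inv\<^bsub>grp B n\<^esub> ?v"
    using i_lift[of "y' \<otimes>\<^bsub>grp B n\<^esub> inv\<^bsub>grp B n\<^esub> ?v" n] v y' by auto
  have "i (Suc n) (x' \<otimes>\<^bsub>grp A (Suc n)\<^esub> inv\<^bsub>grp A (Suc n)\<^esub> x) = diff B n y' \<otimes>\<^bsub>grp B (Suc n)\<^esub> inv\<^bsub>grp B (Suc n)\<^esub> diff B n y"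
    using x x' eq y' by simp
  also have "\<dots> = diff B n (y' \<otimes>\<^bsub>grp B n\<^esub> inv\<^bsub>grp B n\<^esub> ?v)"
    unfolding v(2)[symmetric] using v(1) y' by (simp del: B.inv_mult_group dB.hom_mult add: dB.hom_mult[of y' n "inv\<^bsub>grp B n\<^esub> ?v"])
  also have "\<dots> = i (Suc n) (diff A n a)" using i_diff[OF a(1)] a(2) by simp
  finally have "x' \<otimes>\<^bsub>grp A (Suc n)\<^esub> inv\<^bsub>grp A (Suc n)\<^esub> x = diff A n a"
    using inj_onD[OF i_inj[of "Suc n"], of "x' \<otimes>\<^bsub>grp A (Suc n)\<^esub> inv\<^bsub>grp A (Suc n)\<^esub> x" "diff A n a"] x x' a(1)
    by simp
  then have "x' \<otimes>\<^bsub>grp A (Suc n)\<^esub> inv\<^bsub>grp A (Suc n)\<^esub> x \<in> coboundaries A (Suc n)"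
    using a by (auto simp: boundary_iff)
  then show "x' \<in> coclass A (Suc n) x"
    unfolding coclass_def
    using subgroup.rcos_module[OF subgroup_coboundaries[OF A] A.is_group x x'] by simp
qed

lemma connecting_map_hom:
  "connecting_map A B i p n \<in> hom (cohomology C n) (cohomology A (Suc n))"
proof (rule cohomology_homI[OF C A, where R = "\<lambda>\<alpha> x. \<exists>y\<in>carrier (grp B n). p n y = \<alpha> \<and> i (Suc n) x = diff B n y"])
  fix \<alpha> assume "\<alpha> \<in> cocycles C n"
  then obtain y x where yx: "y \<in> carrier (grp B n)" "p n y = \<alpha>"
    "x \<in> cocycles A (Suc n)" "i (Suc n) x = diff B n y"
    by (rule connecting_lift)
  then have "connecting_map A B i p n (coclass C n \<alpha>) = coclass A (Suc n) x"
    using connecting_map_coclass[OF yx(1) _ yx(4)] by (simp add: cocycles_iff)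
  with yx show "\<exists>x\<in>cocycles A (Suc n). (\<exists>y\<in>carrier (grp B n). p n y = \<alpha> \<and> i (Suc n) x = diff B n y) \<and>
      connecting_map A B i p n (coclass C n \<alpha>) = coclass A (Suc n) x" by blast
next
  fix \<alpha> x \<alpha>' x'
  assume x: "x \<in> cocycles A (Suc n)" "x' \<in> cocycles A (Suc n)"
    and "\<exists>y\<in>carrier (grp B n). p n y = \<alpha> \<and> i (Suc n) x = diff B n y"
    and "\<exists>y\<in>carrier (grp B n). p n y = \<alpha>' \<and> i (Suc n) x' = diff B n y"
  then obtain y y' where y: "y \<in> carrier (grp B n)" "p n y = \<alpha>" "i (Suc n) x = diff B n y"
     "y' \<in> carrier (grp B n)" "p n y' = \<alpha>'" "i (Suc n) x' = diff B n y'" by blast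
  have c: "x \<in> carrier (grp A (Suc n))" "x' \<in> carrier (grp A (Suc n))" using x by (auto simp: cocycles_iff)
  have "p n (y \<otimes>\<^bsub>grp B n\<^esub> y') = \<alpha> \<otimes>\<^bsub>grp C n\<^esub> \<alpha>'" using y by simp
  then show "connecting_map A B i p n (coclass C n (\<alpha> \<otimes>\<^bsub>grp C n\<^esub> \<alpha>')) = coclass A (Suc n) (x \<otimes>\<^bsub>grp A (Suc n)\<^esub> x')"
    using connecting_map_coclass[of "y \<otimes>\<^bsub>grp B n\<^esub> y'" n "x \<otimes>\<^bsub>grp A (Suc n)\<^esub> x'"] y c by simp
qed

text \<open>If the image of a cocycle \<open>y\<close> is the coboundary of \<open>d\<close>,
  dividing \<open>y\<close> by the coboundary of a lift of \<open>d\<close> preserves its class and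
  makes its image trivial, so that it comes from \<open>A\<close>.\<close>

lemma exact_at_total:
  "exact_at (cohomology A (Suc m)) (cohomology B (Suc m)) (cohomology C (Suc m))
    (induced_map B i (Suc m)) (induced_map C p (Suc m))"
  unfolding exact_at_def
proof (intro conjI cohomology_group A B C induced_map_hom i p)
  let ?n = "Suc m"
  show "induced_map B i ?n ` carrier (cohomology A ?n) =
      kernel (cohomology B ?n) (cohomology C ?n) (induced_map C p ?n)"
  proof
    show "induced_map B i ?n ` carrier (cohomology A ?n) \<subseteq> kernel (cohomology B ?n) (cohomology C ?n) (induced_map C p ?n)"
    proof
      fix b assume "b \<in> induced_map B i ?n ` carrier (cohomology A ?n)"
      then obtain a where a: "a \<in> cocycles A ?n" "b = induced_map B i ?n (coclass A ?n a)"
        unfolding carrier_cohomology[OF A] by auto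
      have ac: "a \<in> carrier (grp A ?n)" using a by (simp add: cocycles_iff)
      have b: "b = coclass B ?n (i ?n a)" unfolding a(2) by (rule induced_map_coclass[OF A B i ac])
      have "induced_map C p ?n b = coclass C ?n \<one>\<^bsub>grp C ?n\<^esub>"
        unfolding b using induced_map_coclass[OF B C p, of "i ?n a" ?n] ac p_i[OF ac] by simp
      then show "b \<in> kernel (cohomology B ?n) (cohomology C ?n) (induced_map C p ?n)"
        unfolding kernel_def one_cohomology[OF C] carrier_cohomology[OF B]
        using b cochain_map_cocycles[OF A B i a(1)] coclass_one[OF C] by auto
    qed
    show "kernel (cohomology B ?n) (cohomology C ?n) (induced_map C p ?n) \<subseteq> induced_map B i ?n ` carrier (cohomology A ?n)"
    proof
      fix c assume "c \<in> kernel (cohomology B ?n) (cohomology C ?n) (induced_map C p ?n)"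
      then obtain y where y: "y \<in> cocycles B ?n" "c = coclass B ?n y" "induced_map C p ?n c = coboundaries C ?n"
        unfolding kernel_def one_cohomology[OF C] carrier_cohomology[OF B] by auto
      have yc: "y \<in> carrier (grp B ?n)" "diff B ?n y = \<one>\<^bsub>grp B (Suc ?n)\<^esub>" using y(1) by (auto simp: cocycles_iff)
      have "coclass C ?n (p ?n y) = coboundaries C ?n"
        using y(3) unfolding y(2) induced_map_coclass[OF B C p yc(1)] .
      then have "p ?n y \<in> coboundaries C ?n"
        using coclass_eq_coboundaries_iff[OF C] yc(1) by simp
      then obtain d where d: "d \<in> carrier (grp C m)" "p ?n y = diff C m d" by (auto simp: boundary_iff)
      obtain b where b: "b \<in> carrier (grp B m)" "p m b = d" using p_lift[OF d(1)] by blast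
      let ?w = "inv\<^bsub>grp B ?n\<^esub> (diff B m b)"
      let ?z = "y \<otimes>\<^bsub>grp B ?n\<^esub> ?w"
      have w: "?w \<in> carrier (grp B ?n)" "diff B ?n ?w = \<one>\<^bsub>grp B (Suc ?n)\<^esub>"
        using b cochain_complexD(3)[OF B b(1)] by simp_all
      have "p ?n ?z = \<one>\<^bsub>grp C ?n\<^esub>" using yc b d p_diff[OF b(1)] by simp
      then obtain a where a: "a \<in> carrier (grp A ?n)" "i ?n a = ?z"
        using i_lift[of ?z ?n] yc(1) w(1) by auto
      have "i (Suc ?n) (diff A ?n a) = \<one>\<^bsub>grp B (Suc ?n)\<^esub>"
        using i_diff[OF a(1)] a(2) w yc by simp
      then have az: "a \<in> cocycles A ?n" using i_one a by (simp add: cocycles_iff)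
      have "coclass B ?n ?z = coclass B ?n y"
      proof -
        have "?z \<otimes>\<^bsub>grp B ?n\<^esub> inv\<^bsub>grp B ?n\<^esub> y = ?w"
          using yc(1) w(1) B.m_comm[of y ?n ?w] B.m_assoc[of ?w ?n y] by simp
        also have "\<dots> = diff B m (inv\<^bsub>grp B m\<^esub> b)" using b by simp
        also have "\<dots> \<in> coboundaries B ?n" using b by (auto simp: boundary_iff intro!: bexI[of _ "inv\<^bsub>grp B m\<^esub> b"])
        finally show ?thesis using coclass_eq_iff[OF B, of ?z ?n y] yc(1) w(1) by simp
      qed
      then have "c = induced_map B i ?n (coclass A ?n a)"
        unfolding y(2) induced_map_coclass[OF A B i a(1)] a(2) by simp
      then show "c \<in> induced_map B i ?n ` carrier (cohomology A ?n)"
        unfolding carrier_cohomology[OF A] using az by blast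
    qed
  qed
qed

text \<open>If the connecting class is trivial, then \<open>x = diff A n a\<close>, so
  \<open>y\<close> and \<open>i n a\<close> have the same differential. Their quotient is a cocycle
  with the same image as \<open>y\<close>.\<close>

lemma exact_at_quotient:
  "exact_at (cohomology B n) (cohomology C n) (cohomology A (Suc n))
    (induced_map C p n) (connecting_map A B i p n)"
  unfolding exact_at_def
proof (intro conjI cohomology_group A B C induced_map_hom p connecting_map_hom)
  show "induced_map C p n ` carrier (cohomology B n) =
      kernel (cohomology C n) (cohomology A (Suc n)) (connecting_map A B i p n)"
  proof
    show "induced_map C p n ` carrier (cohomology B n) \<subseteq> kernel (cohomology C n) (cohomology A (Suc n)) (connecting_map A B i p n)"
    proof
      fix c assume "c \<in> induced_map C p n ` carrier (cohomology B n)"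
      then obtain y where y: "y \<in> cocycles B n" "c = induced_map C p n (coclass B n y)"
        unfolding carrier_cohomology[OF B] by auto
      have yc: "y \<in> carrier (grp B n)" "diff B n y = \<one>\<^bsub>grp B (Suc n)\<^esub>" using y(1) by (auto simp: cocycles_iff)
      have c: "c = coclass C n (p n y)" unfolding y(2) by (rule induced_map_coclass[OF B C p yc(1)])
      have "connecting_map A B i p n c = coclass A (Suc n) \<one>\<^bsub>grp A (Suc n)\<^esub>"
        unfolding c by (rule connecting_map_coclass[OF yc(1)]) (simp_all add: yc(2))
      then show "c \<in> kernel (cohomology C n) (cohomology A (Suc n)) (connecting_map A B i p n)"
        unfolding kernel_def one_cohomology[OF A] carrier_cohomology[OF C]
        using c cochain_map_cocycles[OF B C p y(1)] coclass_one[OF A] by auto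
    qed
    show "kernel (cohomology C n) (cohomology A (Suc n)) (connecting_map A B i p n) \<subseteq> induced_map C p n ` carrier (cohomology B n)"
    proof
      fix c assume "c \<in> kernel (cohomology C n) (cohomology A (Suc n)) (connecting_map A B i p n)"
      then obtain \<alpha> where \<alpha>: "\<alpha> \<in> cocycles C n" "c = coclass C n \<alpha>" "connecting_map A B i p n c = coboundaries A (Suc n)"
        unfolding kernel_def one_cohomology[OF A] carrier_cohomology[OF C] by auto
      obtain y x where yx: "y \<in> carrier (grp B n)" "p n y = \<alpha>" "x \<in> cocycles A (Suc n)" "i (Suc n) x = diff B n y"
        using connecting_lift[OF \<alpha>(1)] .
      have xc: "x \<in> carrier (grp A (Suc n))" using yx by (simp add: cocycles_iff)
      have "coclass A (Suc n) x = coboundaries A (Suc n)"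
        using \<alpha>(3) connecting_map_coclass[OF yx(1) xc yx(4)] yx(2) \<alpha>(2) by simp
      then have "x \<in> coboundaries A (Suc n)" using coclass_eq_coboundaries_iff[OF A xc] by simp
      then obtain a where a: "a \<in> carrier (grp A n)" "x = diff A n a" by (auto simp: boundary_iff)
      let ?z = "y \<otimes>\<^bsub>grp B n\<^esub> inv\<^bsub>grp B n\<^esub> (i n a)"
      have "diff B n (i n a) = diff B n y" using i_diff[OF a(1)] a(2) yx(4) by simp
      then have z: "?z \<in> cocycles B n" using yx(1) a(1) by (simp add: cocycles_iff)
      have "p n ?z = \<alpha>" using yx a p_i[OF a(1)] \<alpha>(1) by (simp add: cocycles_iff)
      then have "c = induced_map C p n (coclass B n ?z)"
        using induced_map_coclass[OF B C p, of ?z n] z \<alpha>(2) by (simp add: cocycles_iff)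
      then show "c \<in> induced_map C p n ` carrier (cohomology B n)"
        unfolding carrier_cohomology[OF B] using z by blast
    qed
  qed
qed

text \<open>Both inclusions are one equation, \<open>i (Suc n) x = diff B n y\<close>: it says that
  \<open>x\<close> represents the connecting image of \<open>p n y\<close>, and also that
  \<open>x\<close> becomes a coboundary in \<open>B\<close>.\<close>

lemma exact_at_sub:
  "exact_at (cohomology C n) (cohomology A (Suc n)) (cohomology B (Suc n))
    (connecting_map A B i p n) (induced_map B i (Suc n))"
  unfolding exact_at_def
proof (intro conjI cohomology_group A B C induced_map_hom i connecting_map_hom)
  show "connecting_map A B i p n ` carrier (cohomology C n) =
      kernel (cohomology A (Suc n)) (cohomology B (Suc n)) (induced_map B i (Suc n))"
  proof
    show "connecting_map A B i p n ` carrier (cohomology C n) \<subseteq> kernel (cohomology A (Suc n)) (cohomology B (Suc n)) (induced_map B i (Suc n))"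
    proof
      fix c assume "c \<in> connecting_map A B i p n ` carrier (cohomology C n)"
      then obtain \<alpha> where \<alpha>: "\<alpha> \<in> cocycles C n" "c = connecting_map A B i p n (coclass C n \<alpha>)"
        unfolding carrier_cohomology[OF C] by auto
      obtain y x where yx: "y \<in> carrier (grp B n)" "p n y = \<alpha>" "x \<in> cocycles A (Suc n)" "i (Suc n) x = diff B n y"
        using connecting_lift[OF \<alpha>(1)] .
      have xc: "x \<in> carrier (grp A (Suc n))" using yx by (simp add: cocycles_iff)
      have c: "c = coclass A (Suc n) x"
        unfolding \<alpha>(2) yx(2)[symmetric] by (rule connecting_map_coclass[OF yx(1) xc yx(4)])
      have "i (Suc n) x \<in> coboundaries B (Suc n)" using yx by (auto simp: boundary_iff)
      then have "induced_map B i (Suc n) c = coboundaries B (Suc n)"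
        using induced_map_coclass[OF A B i xc] coclass_eq_coboundaries_iff[OF B] xc c by simp
      then show "c \<in> kernel (cohomology A (Suc n)) (cohomology B (Suc n)) (induced_map B i (Suc n))"
        unfolding kernel_def one_cohomology[OF B] carrier_cohomology[OF A] using c yx(3) by auto
    qed
    show "kernel (cohomology A (Suc n)) (cohomology B (Suc n)) (induced_map B i (Suc n)) \<subseteq> connecting_map A B i p n ` carrier (cohomology C n)"
    proof
      fix c assume "c \<in> kernel (cohomology A (Suc n)) (cohomology B (Suc n)) (induced_map B i (Suc n))"
      then obtain x where x: "x \<in> cocycles A (Suc n)" "c = coclass A (Suc n) x" "induced_map B i (Suc n) c = coboundaries B (Suc n)"
        unfolding kernel_def one_cohomology[OF B] carrier_cohomology[OF A] by auto
      have xc: "x \<in> carrier (grp A (Suc n))" using x by (simp add: cocycles_iff)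
      have "i (Suc n) x \<in> coboundaries B (Suc n)"
        using x(2,3) induced_map_coclass[OF A B i xc] coclass_eq_coboundaries_iff[OF B] xc by simp
      then obtain y where y: "y \<in> carrier (grp B n)" "i (Suc n) x = diff B n y" by (auto simp: boundary_iff)
      have "c = connecting_map A B i p n (coclass C n (p n y))"
        unfolding x(2) by (rule connecting_map_coclass[OF y(1) xc y(2), symmetric])
      then show "c \<in> connecting_map A B i p n ` carrier (cohomology C n)"
        unfolding carrier_cohomology[OF C] using connecting_cocycle(2)[OF y(1) xc y(2)] by blast
    qed
  qed
qed

end

section \<open>Algebra of the group coboundary\<close>

text \<open>The coboundary without its first summand, recursively in the list of group elements. The
  cancellation in \<open>d \<circ> d = 0\<close> becomes the induction \<open>bar_sum_bar_sum\<close>.\<close>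

fun bar_sum :: "('g \<Rightarrow> 'g \<Rightarrow> 'g) \<Rightarrow> ('g list \<Rightarrow> 'v::real_vector) \<Rightarrow> 'g list \<Rightarrow> 'v" where
  "bar_sum m \<alpha> [] = 0"
| "bar_sum m \<alpha> [g] = - \<alpha> []"
| "bar_sum m \<alpha> (g # h # gs) = - \<alpha> (m g h # gs) - bar_sum m (\<lambda>xs. \<alpha> (g # xs)) (h # gs)"

text \<open>The term \<open>i = 1\<close> merges the first two entries. All later terms keep the
  first entry and are terms of the tail with index lowered by one, whence the minus sign before the
  recursive call.\<close>

lemma bar_sum_eq_sum:
  "length gs = Suc n \<Longrightarrow> bar_sum m \<alpha> gs =
     (\<Sum>i = 1..n. (- 1) ^ i *\<^sub>R \<alpha> (take (i - 1) gs @ [m (gs ! (i - 1)) (gs ! i)] @ drop (i + 1) gs))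
       + (- 1) ^ (n + 1) *\<^sub>R \<alpha> (take n gs)"
proof (induction n arbitrary: gs \<alpha>)
  case 0
  then show ?case by (auto simp: length_Suc_conv)
next
  case (Suc n)
  then obtain g h xs where gs: "gs = g # h # xs" "length (h # xs) = Suc n"
    by (auto simp: length_Suc_conv)
  define f where "f i = \<alpha> (take (i - 1) gs @ [m (gs ! (i - 1)) (gs ! i)] @ drop (i + 1) gs)" for i
  have "(\<Sum>i = 1..Suc n. (- 1) ^ i *\<^sub>R f i) = - f 1 + (\<Sum>i = Suc 1..Suc n. (- 1) ^ i *\<^sub>R f i)"
    by (subst sum.atLeast_Suc_atMost) auto
  also have "(\<Sum>i = Suc 1..Suc n. (- 1) ^ i *\<^sub>R f i) = (\<Sum>i = 1..n. (- 1) ^ Suc i *\<^sub>R f (Suc i))"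
    by (rule sum.shift_bounds_cl_Suc_ivl)
  also have "\<dots> = - (\<Sum>i = 1..n. (- 1) ^ i *\<^sub>R f (Suc i))"
    by (simp add: sum_negf)
  also have "(\<Sum>i = 1..n. (- 1) ^ i *\<^sub>R f (Suc i)) =
     (\<Sum>i = 1..n. (- 1) ^ i *\<^sub>R \<alpha> (g # take (i - 1) (h # xs) @ [m ((h # xs) ! (i - 1)) ((h # xs) ! i)] @ drop (i + 1) (h # xs)))"
    by (rule sum.cong) (auto simp: f_def gs(1) take_Cons' nth_Cons' numeral_2_eq_2)
  finally have "(\<Sum>i = 1..Suc n. (- 1) ^ i *\<^sub>R f i) = - f 1 -
     (\<Sum>i = 1..n. (- 1) ^ i *\<^sub>R \<alpha> (g # take (i - 1) (h # xs) @ [m ((h # xs) ! (i - 1)) ((h # xs) ! i)] @ drop (i + 1) (h # xs)))"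
    by simp
  then show ?case
    using Suc.IH[OF gs(2), of "\<lambda>xs. \<alpha> (g # xs)"] unfolding f_def by (simp add: gs(1) numeral_2_eq_2)
qed

lemma bar_sum_linear: "linear L \<Longrightarrow> bar_sum m (\<lambda>xs. L (\<alpha> xs)) gs = L (bar_sum m \<alpha> gs)"
  by (induction m \<alpha> gs rule: bar_sum.induct) (simp_all add: linear_0 linear_neg linear_diff)

lemma bar_sum_add: "bar_sum m (\<lambda>xs. \<alpha> xs + \<beta> xs) gs = bar_sum m \<alpha> gs + bar_sum m \<beta> gs"
  by (induction m \<alpha> gs arbitrary: \<beta> rule: bar_sum.induct) simp_all

lemma bar_sum_uminus: "bar_sum m (\<lambda>xs. - \<alpha> xs) gs = - bar_sum m \<alpha> gs"
  by (induction m \<alpha> gs rule: bar_sum.induct) simp_all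

text \<open>All lists at which \<alpha> is evaluated are one entry shorter and stay in
  \<open>S\<close> by closure; identities between cochains are available on such tuples
  only.\<close>

lemma bar_sum_cong:
  assumes "\<And>a b. a \<in> S \<Longrightarrow> b \<in> S \<Longrightarrow> m a b \<in> S"
  shows "set gs \<subseteq> S \<Longrightarrow> (\<And>xs. Suc (length xs) = length gs \<Longrightarrow> set xs \<subseteq> S \<Longrightarrow> \<alpha> xs = \<beta> xs) \<Longrightarrow>
    bar_sum m \<alpha> gs = bar_sum m \<beta> gs"
proof (induction gs arbitrary: \<alpha> \<beta> rule: induct_list012)
  case (3 g h gs)
  have "bar_sum m (\<lambda>xs. \<alpha> (g # xs)) (h # gs) = bar_sum m (\<lambda>xs. \<beta> (g # xs)) (h # gs)"
    using 3 by (intro "3.IH") auto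
  moreover have "\<alpha> (m g h # gs) = \<beta> (m g h # gs)"
    using 3(3) assms by (intro 3(4)) auto
  ultimately show ?case by simp
qed auto

lemma bar_sum_map:
  assumes "\<And>a b. a \<in> S \<Longrightarrow> b \<in> S \<Longrightarrow> m a b \<in> S" "\<And>a b. a \<in> S \<Longrightarrow> b \<in> S \<Longrightarrow> F (m a b) = m' (F a) (F b)"
  shows "set gs \<subseteq> S \<Longrightarrow> bar_sum m (\<lambda>xs. \<alpha> (map F xs)) gs = bar_sum m' \<alpha> (map F gs)"
  by (induction gs arbitrary: \<alpha> rule: induct_list012)
     (use assms in \<open>auto\<close>)

text \<open>The part of \<open>d \<circ> d = 0\<close> that is free of the representation. The
  induction hypothesis is applied to \<alpha> with \<open>g\<close> put in front, and associativity
  identifies the two ways of merging the first three entries.\<close>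

lemma bar_sum_bar_sum:
  assumes closed: "\<And>a b. a \<in> S \<Longrightarrow> b \<in> S \<Longrightarrow> m a b \<in> S"
    and assoc: "\<And>a b c. a \<in> S \<Longrightarrow> b \<in> S \<Longrightarrow> c \<in> S \<Longrightarrow> m (m a b) c = m a (m b c)"
  shows "g \<in> S \<Longrightarrow> h \<in> S \<Longrightarrow> set gs \<subseteq> S \<Longrightarrow>
    bar_sum m (\<lambda>xs. bar_sum m \<alpha> (g # xs)) (h # gs) = - bar_sum m \<alpha> (m g h # gs)"
proof (induction gs arbitrary: \<alpha> g h)
  case Nil
  then show ?case by simp
next
  case (Cons k gs)
  have IH: "bar_sum m (\<lambda>xs. bar_sum m (\<lambda>ys. \<alpha> (g # ys)) (h # xs)) (k # gs) = - bar_sum m (\<lambda>ys. \<alpha> (g # ys)) (m h k # gs)"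
    using Cons.prems by (intro Cons.IH) auto
  have "bar_sum m (\<lambda>xs. bar_sum m \<alpha> (g # h # xs)) (k # gs) =
     - bar_sum m (\<lambda>xs. \<alpha> (m g h # xs)) (k # gs) - bar_sum m (\<lambda>xs. bar_sum m (\<lambda>ys. \<alpha> (g # ys)) (h # xs)) (k # gs)"
    using bar_sum_add[of m "\<lambda>xs. - \<alpha> (m g h # xs)" "\<lambda>xs. - bar_sum m (\<lambda>ys. \<alpha> (g # ys)) (h # xs)" "k # gs"]
    by (simp add: bar_sum_uminus)
  then show ?case
    using IH assoc[of g h k] Cons.prems by simp
qed

text \<open>All faces keep \<open>e\<close> except the one that merges it into its right neighbour,
  or drops it if it stands alone.\<close>

lemma bar_sum_one_Cons:
  assumes "\<And>x. x \<in> S \<Longrightarrow> m e x = x" "set gs \<subseteq> S" "\<And>xs. e \<in> set xs \<Longrightarrow> \<alpha> xs = 0"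
  shows "bar_sum m \<alpha> (e # gs) = - \<alpha> gs"
proof (cases gs)
  case (Cons h hs)
  have "bar_sum m (\<lambda>xs. \<alpha> (e # xs)) (h # hs) = bar_sum m (\<lambda>xs. (0::'b)) (h # hs)"
    using assms(3) by simp
  also have "\<dots> = 0" using bar_sum_linear[of "\<lambda>_. 0" m "\<lambda>_. 0::'b" "h # hs"] by (simp add: linear_iff)
  finally show ?thesis using Cons assms by simp
qed simp

text \<open>Merging \<open>e\<close> to the left and to the right gives the same list with opposite
  signs; if \<open>e\<close> stands last, dropping it replaces the merge to the right. All other
  faces contain \<open>e\<close>.\<close>

lemma bar_sum_one:
  assumes l: "\<And>x. x \<in> S \<Longrightarrow> m e x = x" and r: "\<And>x. x \<in> S \<Longrightarrow> m x e = x"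
  shows "g \<in> S \<Longrightarrow> set gs \<subseteq> S \<Longrightarrow> e \<in> set gs \<Longrightarrow> (\<And>xs. e \<in> set xs \<Longrightarrow> \<alpha> xs = 0) \<Longrightarrow>
    bar_sum m \<alpha> (g # gs) = 0"
proof (induction gs arbitrary: g \<alpha>)
  case (Cons h gs)
  show ?case
  proof (cases "h = e")
    case True
    have "bar_sum m (\<lambda>xs. \<alpha> (g # xs)) (e # gs) = - \<alpha> (g # gs)"
      using Cons.prems l by (intro bar_sum_one_Cons[of S]) auto
    then show ?thesis using True r[OF Cons.prems(1)] by simp
  next
    case False
    have "bar_sum m (\<lambda>xs. \<alpha> (g # xs)) (h # gs) = 0"
      using Cons.prems False by (intro Cons.IH) auto
    then show ?thesis using Cons.prems False by simp
  qed
qed simp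

section \<open>The coboundary operator of a linear representation\<close>

lemma tuples_Suc: "gs \<in> tuples G (Suc n) \<longleftrightarrow> (\<exists>g xs. gs = g # xs \<and> g \<in> carrier G \<and> xs \<in> tuples G n)"
  by (cases gs) (auto simp: tuples_def)

lemma group_coboundary_Cons:
  assumes "g \<in> carrier G" "xs \<in> tuples G n"
  shows "group_coboundary G \<Theta> n \<alpha> (g # xs) = \<Theta> g (\<alpha> xs) + bar_sum (\<otimes>\<^bsub>G\<^esub>) \<alpha> (g # xs)"
proof -
  have "length (g # xs) = Suc n" "g # xs \<in> tuples G (Suc n)" using assms by (auto simp: tuples_def)
  then show ?thesis
    by (simp add: group_coboundary_def bar_sum_eq_sum[of "g # xs" n])
qed

lemma group_coboundary_off: "gs \<notin> tuples G (Suc n) \<Longrightarrow> group_coboundary G \<Theta> n \<alpha> gs = 0"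
  by (simp add: group_coboundary_def)

text \<open>The algebra of a representation apart from smoothness, so that \<Theta> and its twist by
  the difference operator are two instances.\<close>

locale linear_rep = group G for G :: "'a monoid" (structure) +
  fixes \<Theta> :: "'a \<Rightarrow> 'v::real_vector \<Rightarrow> 'v"
  assumes lin: "g \<in> carrier G \<Longrightarrow> linear (\<Theta> g)"
    and rep_mult: "g \<in> carrier G \<Longrightarrow> h \<in> carrier G \<Longrightarrow> \<Theta> (g \<otimes> h) v = \<Theta> g (\<Theta> h v)"
    and rep_one: "\<Theta> \<one> v = v"
begin

lemma bar_cong:
  assumes "gs \<in> tuples G (Suc n)" "\<And>xs. xs \<in> tuples G n \<Longrightarrow> \<alpha> xs = \<beta> xs"
  shows "bar_sum (\<otimes>) \<alpha> gs = bar_sum (\<otimes>) \<beta> gs"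
  by (rule bar_sum_cong[of "carrier G"]) (use assms in \<open>auto simp: tuples_def\<close>)

lemma group_coboundary_cong:
  assumes "\<And>xs. xs \<in> tuples G n \<Longrightarrow> \<alpha> xs = \<beta> xs"
  shows "group_coboundary G \<Theta> n \<alpha> = group_coboundary G \<Theta> n \<beta>"
proof
  fix gs
  show "group_coboundary G \<Theta> n \<alpha> gs = group_coboundary G \<Theta> n \<beta> gs"
  proof (cases "gs \<in> tuples G (Suc n)")
    case True
    then obtain g xs where "gs = g # xs" "g \<in> carrier G" "xs \<in> tuples G n" by (auto simp: tuples_Suc)
    then show ?thesis using bar_cong[OF True assms] assms by (simp add: group_coboundary_Cons)
  qed (simp add: group_coboundary_off)
qed

lemma group_coboundary_add:
  "group_coboundary G \<Theta> n (\<lambda>xs. \<alpha> xs + \<beta> xs) gs = group_coboundary G \<Theta> n \<alpha> gs + group_coboundary G \<Theta> n \<beta> gs"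
  by (cases "gs \<in> tuples G (Suc n)")
     (auto simp: tuples_Suc group_coboundary_Cons group_coboundary_off bar_sum_add linear_add[OF lin])

lemma group_coboundary_scale:
  "group_coboundary G \<Theta> n (\<lambda>xs. c *\<^sub>R \<alpha> xs) gs = c *\<^sub>R group_coboundary G \<Theta> n \<alpha> gs"
proof -
  have "linear (\<lambda>v::'v. c *\<^sub>R v)" by (rule linearI) (simp_all add: algebra_simps)
  from bar_sum_linear[OF this] show ?thesis
    by (cases "gs \<in> tuples G (Suc n)")
       (auto simp: tuples_Suc group_coboundary_Cons group_coboundary_off linear_scale[OF lin] scaleR_add_right)
qed

lemma group_coboundary_zero: "group_coboundary G \<Theta> n (\<lambda>_. 0) = (\<lambda>_. 0)"
  using group_coboundary_scale[of n 0 "\<lambda>_. 0"] by (simp add: fun_eq_iff)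

lemma group_coboundary_uminus:
  "group_coboundary G \<Theta> n (\<lambda>xs. - \<alpha> xs) gs = - group_coboundary G \<Theta> n \<alpha> gs"
  using group_coboundary_scale[of n "- 1" \<alpha> gs] by simp

lemma group_coboundary_diff:
  "group_coboundary G \<Theta> n (\<lambda>xs. \<alpha> xs - \<beta> xs) gs = group_coboundary G \<Theta> n \<alpha> gs - group_coboundary G \<Theta> n \<beta> gs"
  using group_coboundary_add[of n \<alpha> "\<lambda>xs. - \<beta> xs" gs] group_coboundary_uminus[of n \<beta> gs] by simp

text \<open>Terms that contain the representation cancel by linearity and \<open>rep_mult\<close>;
  those without it cancel by \<open>bar_sum_bar_sum\<close>.\<close>

lemma group_coboundary_twice: "group_coboundary G \<Theta> (Suc n) (group_coboundary G \<Theta> n \<alpha>) = (\<lambda>_. 0)"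
proof
  fix gs
  show "group_coboundary G \<Theta> (Suc n) (group_coboundary G \<Theta> n \<alpha>) gs = 0"
  proof (cases "gs \<in> tuples G (Suc (Suc n))")
    case True
    then obtain g h xs where gs: "gs = g # h # xs" "g \<in> carrier G" "h \<in> carrier G" "xs \<in> tuples G n"
      by (auto simp: tuples_Suc)
    have hx: "h # xs \<in> tuples G (Suc n)" using gs by (auto simp: tuples_def)
    let ?d = "group_coboundary G \<Theta> n \<alpha>" and ?S = "bar_sum (\<otimes>)"
    have "?S (\<lambda>ys. ?d (g # ys)) (h # xs) = ?S (\<lambda>ys. \<Theta> g (\<alpha> ys) + ?S \<alpha> (g # ys)) (h # xs)"
      by (rule bar_cong[OF hx]) (simp add: group_coboundary_Cons gs)
    also have "\<dots> = \<Theta> g (?S \<alpha> (h # xs)) + ?S (\<lambda>ys. ?S \<alpha> (g # ys)) (h # xs)"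
      by (simp add: bar_sum_add bar_sum_linear lin gs)
    also have "?S (\<lambda>ys. ?S \<alpha> (g # ys)) (h # xs) = - ?S \<alpha> (g \<otimes> h # xs)"
      using gs by (intro bar_sum_bar_sum[of "carrier G"]) (auto simp: m_assoc tuples_def)
    finally have "?S (\<lambda>ys. ?d (g # ys)) (h # xs) = \<Theta> g (?S \<alpha> (h # xs)) - ?S \<alpha> (g \<otimes> h # xs)" by simp
    then show ?thesis
      using gs hx by (simp add: group_coboundary_Cons rep_mult linear_add[OF lin])
  qed (simp add: group_coboundary_off)
qed

text \<open>Cochains vanish off tuples, so the hypothesis may range over all lists. A unit in front
  leaves one face, which cancels the first summand because \<open>\<Theta> \<one>\<close> is the
  identity; a unit behind makes the first summand zero and the faces cancel among
  themselves.\<close>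

lemma group_coboundary_normalized:
  assumes \<alpha>: "\<And>xs. \<one> \<in> set xs \<Longrightarrow> \<alpha> xs = 0" and gs: "\<one> \<in> set gs"
  shows "group_coboundary G \<Theta> n \<alpha> gs = 0"
proof (cases "gs \<in> tuples G (Suc n)")
  case True
  then obtain g xs where x: "gs = g # xs" "g \<in> carrier G" "xs \<in> tuples G n" by (auto simp: tuples_Suc)
  then have xs: "set xs \<subseteq> carrier G" by (auto simp: tuples_def)
  show ?thesis
  proof (cases "g = \<one>")
    case True
    have "bar_sum (\<otimes>) \<alpha> (\<one> # xs) = - \<alpha> xs"
      using xs \<alpha> by (intro bar_sum_one_Cons[of "carrier G"]) auto
    then show ?thesis using x True by (simp add: group_coboundary_Cons rep_one)
  next
    case False
    then have "\<one> \<in> set xs" using gs x by simp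
    moreover from this have "bar_sum (\<otimes>) \<alpha> (g # xs) = 0"
      using x xs \<alpha> by (intro bar_sum_one[of "carrier G"]) auto
    ultimately show ?thesis using x \<alpha> linear_0[OF lin] by (simp add: group_coboundary_Cons)
  qed
qed (simp add: group_coboundary_off)

end

section \<open>Anticommutation of \<open>K_map\<close> with the coboundary operators\<close>

locale difference_rep_alg = linear_rep G \<Theta>
    for G :: "'a monoid" (structure) and \<Theta> :: "'a \<Rightarrow> 'v::real_vector \<Rightarrow> 'v" +
  fixes D :: "'a \<Rightarrow> 'a" and T :: "'v \<Rightarrow> 'v"
  assumes D_closed: "g \<in> carrier G \<Longrightarrow> D g \<in> carrier G"
    and D_mult: "g \<in> carrier G \<Longrightarrow> h \<in> carrier G \<Longrightarrow> D (g \<otimes> h) = D g \<otimes> g \<otimes> D h \<otimes> inv g"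
    and T_lin: "linear T"
    and intertwine: "g \<in> carrier G \<Longrightarrow> T (\<Theta> g u) + \<Theta> g u = \<Theta> (D g \<otimes> g) (T u) + \<Theta> (D g \<otimes> g) u"
begin

definition F :: "'a \<Rightarrow> 'a" where "F g = D g \<otimes> g"

lemma F_closed: "g \<in> carrier G \<Longrightarrow> F g \<in> carrier G"
  by (simp add: F_def D_closed)

text \<open>The factor \<open>inv g\<close> that ends the product rule of \<open>D\<close> cancels
  the \<open>g\<close> of \<open>g \<otimes> h\<close>.\<close>

lemma F_mult: "g \<in> carrier G \<Longrightarrow> h \<in> carrier G \<Longrightarrow> F (g \<otimes> h) = F g \<otimes> F h"
  by (simp add: F_def D_closed D_mult m_assoc inv_solve_left flip: m_assoc[of "inv g" g h])

lemma D_one: "D \<one> = \<one>"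
  using D_mult[of \<one> \<one>] D_closed[of \<one>] by simp

lemma F_one: "F \<one> = \<one>"
  by (simp add: F_def D_one)

abbreviation "\<Theta>D \<equiv> twisted_rep G D \<Theta>"

lemma \<Theta>D_eq: "\<Theta>D g = \<Theta> (F g)"
  by (simp add: twisted_rep_def F_def)

sublocale tw: linear_rep G \<Theta>D
  by (rule linear_rep.intro[OF group_axioms], rule linear_rep_axioms.intro)
     (simp_all add: \<Theta>D_eq F_closed F_mult F_one rep_mult rep_one lin)

abbreviation "d \<equiv> group_coboundary G \<Theta>"
abbreviation "dD \<equiv> group_coboundary G \<Theta>D"

lemma map_F_tuples: "gs \<in> tuples G n \<Longrightarrow> map F gs \<in> tuples G n"
  by (auto simp: tuples_def F_closed)

text \<open>Pullback along \<open>F\<close> respects every face because \<open>F\<close> is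
  multiplicative, and it respects the action because \<open>\<Theta>D\<close> is \<Theta> after
  \<open>F\<close>.\<close>

lemma dD_pullback:
  assumes "gs \<in> tuples G (Suc n)"
  shows "dD n (\<lambda>xs. \<alpha> (map F xs)) gs = d n \<alpha> (map F gs)"
proof -
  obtain g xs where x: "gs = g # xs" "g \<in> carrier G" "xs \<in> tuples G n" using assms by (auto simp: tuples_Suc)
  have "bar_sum (\<otimes>) (\<lambda>xs. \<alpha> (map F xs)) gs = bar_sum (\<otimes>) \<alpha> (map F gs)"
    using assms by (intro bar_sum_map[of "carrier G"]) (auto simp: F_mult tuples_def)
  then show ?thesis
    using x map_F_tuples[OF x(3)] by (simp add: group_coboundary_Cons F_closed \<Theta>D_eq)
qed

text \<open>The compatibility condition of a difference representation says that
  \<open>T + id\<close> intertwines \<Theta> with \<open>\<Theta>D\<close>; for the other summands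
  linearity suffices.\<close>

lemma dD_intertwine:
  assumes "gs \<in> tuples G (Suc n)"
  shows "dD n (\<lambda>xs. T (\<alpha> xs) + \<alpha> xs) gs = T (d n \<alpha> gs) + d n \<alpha> gs"
proof -
  obtain g xs where x: "gs = g # xs" "g \<in> carrier G" "xs \<in> tuples G n" using assms by (auto simp: tuples_Suc)
  have "\<Theta>D g (T (\<alpha> xs) + \<alpha> xs) = T (\<Theta> g (\<alpha> xs)) + \<Theta> g (\<alpha> xs)"
    using intertwine[OF x(2), of "\<alpha> xs"] linear_add[OF tw.lin[OF x(2)]] by (simp add: \<Theta>D_eq F_def)
  then show ?thesis
    using x by (simp add: group_coboundary_Cons bar_sum_add bar_sum_linear[OF T_lin] linear_add[OF T_lin])
qed

lemma K_hat_eq: "K_hat G D T n \<alpha> = (\<lambda>gs. (- 1) ^ n *\<^sub>R (\<alpha> (map F gs) - (T (\<alpha> gs) + \<alpha> gs)))"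
  by (simp add: K_hat_def F_def[abs_def] algebra_simps fun_eq_iff)

text \<open>Without its sign the operator would commute with the differentials; the change from
  \<open>(- 1) ^ n\<close> to \<open>(- 1) ^ Suc n\<close> yields the minus.\<close>

lemma dD_K_hat:
  assumes "gs \<in> tuples G (Suc n)"
  shows "dD n (K_hat G D T n \<alpha>) gs = - K_hat G D T (Suc n) (d n \<alpha>) gs"
  unfolding K_hat_eq
  using assms by (simp add: tw.group_coboundary_scale tw.group_coboundary_diff dD_pullback dD_intertwine)

text \<open>Restriction of a 2-cochain to the graph of \<open>D\<close>: the operator of degree -1
  whose commutator with the differentials is \<open>K_prime\<close>.\<close>

definition graph_cochain :: "('a list \<Rightarrow> 'v) \<Rightarrow> 'a list \<Rightarrow> 'v" where
  "graph_cochain \<alpha> xs = \<alpha> [D (xs ! 0), xs ! 0]"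

lemma tuples_1: "gs \<in> tuples G 1 \<longleftrightarrow> (\<exists>g\<in>carrier G. gs = [g])"
  and tuples_2: "gs \<in> tuples G 2 \<longleftrightarrow> (\<exists>g\<in>carrier G. \<exists>h\<in>carrier G. gs = [g, h])"
  by (auto simp: tuples_def length_Suc_conv numeral_2_eq_2)

text \<open>The three terms are those of \<open>d 1 \<alpha>\<close> at the pair
  \<open>[D g, g]\<close>, with opposite signs.\<close>

lemma K_prime_1:
  "gs \<in> tuples G 1 \<Longrightarrow> K_prime G D \<Theta> 1 \<alpha> gs = - graph_cochain (d 1 \<alpha>) gs"
  using D_closed
  by (auto simp: tuples_1 K_prime_def graph_cochain_def group_coboundary_Cons tuples_1[simplified])

lemma K_prime_2:
  "gs \<in> tuples G 2 \<Longrightarrow> K_prime G D \<Theta> 2 \<alpha> gs = dD 1 (graph_cochain \<alpha>) gs"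
  by (auto simp: tuples_2 K_prime_def graph_cochain_def group_coboundary_Cons tuples_1[simplified] twisted_rep_def)

text \<open>For \<open>n = 1\<close> both sides are \<open>dD\<close> of minus the graph restriction
  of \<open>d 1 \<alpha>\<close>. For \<open>n = 2\<close> the left side is \<open>dD\<close>
  applied twice and the right side is zero by definition; from 3 on both sides vanish.\<close>

lemma dD_K_prime:
  assumes gs: "gs \<in> tuples G (Suc n)" and n: "n \<ge> 1"
  shows "dD n (K_prime G D \<Theta> n \<alpha>) gs = - K_prime G D \<Theta> (Suc n) (d n \<alpha>) gs"
proof -
  consider "n = 1" | "n = 2" | "n \<ge> 3" using n by linarith
  then show ?thesis
  proof cases
    case 1
    have "dD 1 (K_prime G D \<Theta> 1 \<alpha>) = dD 1 (\<lambda>xs. - graph_cochain (d 1 \<alpha>) xs)"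
      by (rule tw.group_coboundary_cong) (simp add: K_prime_1[simplified])
    then show ?thesis
      using 1 gs K_prime_2[of gs "d 1 \<alpha>"] by (simp add: tw.group_coboundary_uminus numeral_2_eq_2)
  next
    case 2
    have "dD 2 (K_prime G D \<Theta> 2 \<alpha>) = dD 2 (dD 1 (graph_cochain \<alpha>))"
      by (rule tw.group_coboundary_cong) (rule K_prime_2)
    then show ?thesis
      using 2 tw.group_coboundary_twice[of 1] by (simp add: numeral_2_eq_2 K_prime_def)
  next
    case 3
    then have "K_prime G D \<Theta> n \<alpha> = (\<lambda>_. 0)" by (auto simp: K_prime_def)
    then show ?thesis using 3 by (simp add: tw.group_coboundary_zero) (simp add: K_prime_def)
  qed
qed

text \<open>The mixed term in the second component of the squared differential of
  \<open>total_complex\<close>.\<close>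

lemma dD_K_map:
  assumes n: "n \<ge> 1"
  shows "dD n (K_map G D T \<Theta> n \<alpha>) gs + K_map G D T \<Theta> (Suc n) (d n \<alpha>) gs = 0"
proof (cases "gs \<in> tuples G (Suc n)")
  case True
  have "dD n (K_map G D T \<Theta> n \<alpha>) = dD n (\<lambda>xs. K_prime G D \<Theta> n \<alpha> xs + K_hat G D T n \<alpha> xs)"
    by (rule tw.group_coboundary_cong) (simp add: K_map_def)
  then show ?thesis
    using True by (simp add: tw.group_coboundary_add dD_K_prime[OF True n] dD_K_hat K_map_def)
qed (simp add: group_coboundary_off K_map_def)

text \<open>\<open>D\<close> and \<open>F\<close> fix the unit. In degree 2 the terms of
  \<open>K_prime\<close> do not all vanish singly: the middle term cancels the last one if
  \<open>g = \<one>\<close> and the first one if \<open>h = \<one>\<close>.\<close>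

lemma K_map_normalized:
  assumes \<alpha>: "\<And>xs. \<one> \<in> set xs \<Longrightarrow> \<alpha> xs = 0" and gs: "\<one> \<in> set gs"
  shows "K_map G D T \<Theta> n \<alpha> gs = 0"
proof (cases "gs \<in> tuples G n")
  case True
  have "\<one> \<in> set (map F gs)" using gs F_one by force
  then have "K_hat G D T n \<alpha> gs = 0"
    unfolding K_hat_eq using \<alpha> gs linear_0[OF T_lin] by simp
  moreover have "K_prime G D \<Theta> n \<alpha> gs = 0"
  proof -
    consider "n = 1" | "n = 2" | "n \<noteq> 1" "n \<noteq> 2" by blast
    then show ?thesis
    proof cases
      case 1
      with True gs have "gs = [\<one>]" using tuples_1 by auto
      then show ?thesis using 1 \<alpha> D_one rep_one by (simp add: K_prime_def)
    next
      case 2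
      with True obtain g h where gh: "gs = [g, h]" "g \<in> carrier G" "h \<in> carrier G" using tuples_2 by auto
      with gs consider "g = \<one>" | "h = \<one>" by auto
      then show ?thesis
        using gh 2 \<alpha> D_one rep_one linear_0[OF lin] D_closed
        by cases (simp_all add: K_prime_def)
    next
      case 3
      then show ?thesis by (simp add: K_prime_def)
    qed
  qed
  ultimately show ?thesis by (simp add: K_map_def)
qed (simp add: K_map_def)

end

section \<open>The cochain complexes of a difference Lie group\<close>

locale difference_lie_rep =
  fixes G :: "'g monoid" (structure) and M :: "'g mfd" and D :: "'g \<Rightarrow> 'g"
    and T :: "'v::real_vector \<Rightarrow> 'v" and \<Theta> :: "'g \<Rightarrow> 'v \<Rightarrow> 'v"
  assumes lie: "difference_lie_group G M D" and rep: "difference_rep G M D T \<Theta>"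
begin

lemma G: "group G" and M: "smooth_manifold M" and topM: "topspace (mtop M) = carrier G"
  and mult_smooth: "smooth_map (mfd_power M 2) M (\<lambda>gs. gs ! 0 \<otimes> gs ! 1)"
  and D_smooth: "smooth_map M M D"
  and D_mult: "g \<in> carrier G \<Longrightarrow> h \<in> carrier G \<Longrightarrow> D (g \<otimes> h) = D g \<otimes> g \<otimes> D h \<otimes> inv g"
  using lie unfolding difference_lie_group_def lie_group_def difference_operator_def by blast+

lemma fin: "fin_dim TYPE('v)" and T_lin: "linear T" and \<Theta>_hom: "\<Theta> \<in> hom G GL"
  and \<Theta>_smooth: "smooth_map M GL_mfd \<Theta>"
  and intertwine: "g \<in> carrier G \<Longrightarrow> T (\<Theta> g u) + \<Theta> g u = \<Theta> (D g \<otimes> g) (T u) + \<Theta> (D g \<otimes> g) u"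
  using rep unfolding difference_rep_def by blast+

lemma cM: "charted M"
  by (rule smooth_manifold_charted[OF M])

lemma cP: "charted (mfd_power M n)"
  by (rule charted_power[OF cM])

lemma topP: "topspace (mtop (mfd_power M n)) = tuples G n"
  by (simp add: topspace_power tuples_def topM)

lemma \<Theta>_GL: "g \<in> carrier G \<Longrightarrow> \<Theta> g \<in> carrier GL"
  using \<Theta>_hom by (rule hom_in_carrier)

lemma D_closed: "g \<in> carrier G \<Longrightarrow> D g \<in> carrier G"
  using D_smooth topM by (auto simp: smooth_map_iff continuous_map_def)

sublocale difference_rep_alg G \<Theta> D T
proof -
  interpret group G by (rule G)
  have mult: "\<Theta> (g \<otimes> h) = \<Theta> g \<circ> \<Theta> h" if "g \<in> carrier G" "h \<in> carrier G" for g h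
    using hom_mult[OF \<Theta>_hom that] by (simp add: GL_def)
  \<comment> \<open>Multiplicativity makes \<open>\<Theta> \<one>\<close> idempotent, and an
    injective idempotent map is the identity.\<close>
  have one: "\<Theta> \<one> v = v" for v
  proof -
    have "inj (\<Theta> \<one>)" using \<Theta>_GL[OF one_closed] by (simp add: GL_def bij_is_inj)
    moreover have "\<Theta> \<one> (\<Theta> \<one> v) = \<Theta> \<one> v" using mult[of \<one> \<one>] by (simp add: fun_eq_iff)
    ultimately show ?thesis by (rule injD)
  qed
  show "difference_rep_alg G \<Theta> D T"
    by (intro difference_rep_alg.intro linear_rep.intro linear_rep_axioms.intro
          difference_rep_alg_axioms.intro group_axioms)
      (use \<Theta>_GL mult one D_closed D_mult T_lin intertwine in \<open>simp_all add: GL_def\<close>)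
qed

section \<open>Smoothness and normalization of the cochain operations\<close>

lemma nth_smooth: "j < n \<Longrightarrow> smooth_map (mfd_power M n) M (\<lambda>xs. xs ! j)"
  by (rule smooth_map_power_nth[OF M])

lemma smooth_map_mult:
  assumes A: "charted A" and f: "smooth_map A M f" and g: "smooth_map A M g"
  shows "smooth_map A M (\<lambda>x. f x \<otimes> g x)"
proof -
  have "smooth_map A (mfd_power M 2) (\<lambda>x. [f x, g x])"
  proof (rule smooth_map_into_power)
    fix j :: nat assume "j < 2"
    then consider "j = 0" | "j = 1" by linarith
    then show "smooth_map A M (\<lambda>x. [f x, g x] ! j)" by cases (simp_all add: f g)
  qed simp
  from smooth_map_compose[OF A cP cM this mult_smooth] show ?thesis by simp
qed

lemma smooth_map_D: "charted A \<Longrightarrow> smooth_map A M f \<Longrightarrow> smooth_map A M (\<lambda>x. D (f x))"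
  by (rule smooth_map_compose[OF _ cM cM _ D_smooth])

lemma smooth_map_F: "charted A \<Longrightarrow> smooth_map A M f \<Longrightarrow> smooth_map A M (\<lambda>x. F (f x))"
  unfolding F_def by (intro smooth_map_mult smooth_map_D)

lemma \<Theta>_vec: "smooth_vec M (\<lambda>g. \<Theta> g u)"
  by (rule smooth_map_GL_entries[OF cM fin \<Theta>_smooth]) (simp add: topM \<Theta>_GL)

lemma \<Theta>_apply:
  assumes A: "charted A" and g: "smooth_map A M g" and f: "smooth_vec A f"
  shows "smooth_vec A (\<lambda>x. \<Theta> (g x) (f x))"
proof (rule smooth_vec_apply[OF A fin _ _ f])
  show "linear (\<Theta> (g x))" if "x \<in> topspace (mtop A)" for x
    using that g lin topM by (auto simp: smooth_map_iff continuous_map_def)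
  show "smooth_vec A (\<lambda>x. \<Theta> (g x) u)" for u
    by (rule smooth_vec_compose[OF A cM g \<Theta>_vec])
qed

text \<open>Normalization on tuples, combined with vanishing off tuples, gives normalization on all
  lists, the form used by the algebraic lemmas.\<close>

lemma cochain_iff:
  assumes "n \<ge> 1"
  shows "\<alpha> \<in> carrier (cochain_group G M n) \<longleftrightarrow> smooth_vec (mfd_power M n) \<alpha> \<and>
     (\<forall>gs. \<one> \<in> set gs \<longrightarrow> \<alpha> gs = (0::'v)) \<and> (\<forall>gs. gs \<notin> tuples G n \<longrightarrow> \<alpha> gs = 0)"
  using assms by (auto simp: cochain_group_def smooth_map_vector_iff[OF cP fin])

lemma cochain_0: "\<alpha> \<in> carrier (cochain_group G M 0) \<longleftrightarrow> \<alpha> = (\<lambda>_. 0)"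
  by (simp add: cochain_group_def)

lemma cochain_mult: "\<alpha> \<otimes>\<^bsub>cochain_group G M n\<^esub> \<beta> = (\<lambda>gs. \<alpha> gs + \<beta> gs)"
  and cochain_one: "\<one>\<^bsub>cochain_group G M n\<^esub> = (\<lambda>_. 0)"
  by (simp_all add: cochain_group_def)

lemma zero_cochain: "(\<lambda>_. 0 :: 'v) \<in> carrier (cochain_group G M n)"
  by (cases n) (simp_all add: cochain_0 cochain_iff smooth_vec_zero)

lemma add_cochain:
  "\<alpha> \<in> carrier (cochain_group G M n) \<Longrightarrow> \<beta> \<in> carrier (cochain_group G M n) \<Longrightarrow>
    (\<lambda>gs. \<alpha> gs + \<beta> gs :: 'v) \<in> carrier (cochain_group G M n)"
  by (cases n) (simp_all add: cochain_0 cochain_iff smooth_vec_add)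

lemma uminus_cochain:
  "\<alpha> \<in> carrier (cochain_group G M n) \<Longrightarrow> (\<lambda>gs. - \<alpha> gs :: 'v) \<in> carrier (cochain_group G M n)"
  by (cases n) (simp_all add: cochain_0 cochain_iff smooth_vec_minus)

lemma cochain_comm_group: "comm_group (cochain_group G M n :: ('g list \<Rightarrow> 'v) monoid)"
proof (rule comm_groupI)
  fix \<alpha> assume "\<alpha> \<in> carrier (cochain_group G M n :: ('g list \<Rightarrow> 'v) monoid)"
  then show "\<exists>\<beta>\<in>carrier (cochain_group G M n). \<beta> \<otimes>\<^bsub>cochain_group G M n\<^esub> \<alpha> = \<one>\<^bsub>cochain_group G M n\<^esub>"
    by (intro bexI[of _ "\<lambda>gs. - \<alpha> gs"] uminus_cochain) (simp add: cochain_mult cochain_one)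
qed (simp_all add: cochain_mult cochain_one zero_cochain add_cochain algebra_simps)

text \<open>Entry \<open>j\<close> of the face is \<open>gs ! j\<close>, a product of two
  neighbours, or \<open>gs ! Suc j\<close>, as \<open>j\<close> is below, at or above
  \<open>i - 1\<close>.\<close>

lemma face_smooth:
  assumes i: "1 \<le> i" "i \<le> n"
  shows "smooth_map (mfd_power M (Suc n)) (mfd_power M n)
    (\<lambda>gs. take (i - 1) gs @ [gs ! (i - 1) \<otimes> gs ! i] @ drop (i + 1) gs)" (is "smooth_map _ _ ?F")
proof (rule smooth_map_into_power)
  show "length (?F gs) = n" if "gs \<in> topspace (mtop (mfd_power M (Suc n)))" for gs
    using that i by (auto simp: topspace_power)
  fix j assume j: "j < n"
  consider "j < i - 1" | "j = i - 1" | "j \<ge> i" by linarith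
  then show "smooth_map (mfd_power M (Suc n)) M (\<lambda>gs. ?F gs ! j)"
  proof cases
    case 1
    show ?thesis
      by (rule smooth_map_cong[OF cP cM nth_smooth[of j]])
         (use 1 i j in \<open>auto simp: topspace_power nth_append\<close>)
  next
    case 2
    show ?thesis
      by (rule smooth_map_cong[OF cP cM smooth_map_mult[OF cP nth_smooth[of "i - 1"] nth_smooth[of i]]])
         (use 2 i j in \<open>auto simp: topspace_power nth_append\<close>)
  next
    case 3
    show ?thesis
      by (rule smooth_map_cong[OF cP cM nth_smooth[of "Suc j"]])
         (use 3 i j in \<open>auto simp: topspace_power nth_append nth_Cons' Suc_diff_le\<close>)
  qed
qed

lemma tl_smooth: "smooth_map (mfd_power M (Suc n)) (mfd_power M n) tl"
proof (rule smooth_map_into_power)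
  fix j assume j: "j < n"
  show "smooth_map (mfd_power M (Suc n)) M (\<lambda>gs. tl gs ! j)"
    by (rule smooth_map_cong[OF cP cM nth_smooth[of "Suc j"]]) (use j in \<open>auto simp: topspace_power nth_tl\<close>)
qed (auto simp: topspace_power)

lemma take_smooth: "smooth_map (mfd_power M (Suc n)) (mfd_power M n) (take n)"
proof (rule smooth_map_into_power)
  fix j assume j: "j < n"
  show "smooth_map (mfd_power M (Suc n)) M (\<lambda>gs. take n gs ! j)"
    by (rule smooth_map_cong[OF cP cM nth_smooth[of j]]) (use j in \<open>auto simp: topspace_power\<close>)
qed (auto simp: topspace_power)

text \<open>The action \<open>\<Psi>\<close> stays abstract so that one proof serves both \<Theta>
  and \<open>\<Theta>D\<close>. The other summands are \<alpha> composed with smooth maps between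
  powers.\<close>

lemma coboundary_smooth:
  assumes \<Psi>: "\<And>f. smooth_vec (mfd_power M (Suc n)) f \<Longrightarrow> smooth_vec (mfd_power M (Suc n)) (\<lambda>gs. \<Psi> (gs ! 0) (f gs))"
    and \<alpha>: "smooth_vec (mfd_power M n) \<alpha>"
  shows "smooth_vec (mfd_power M (Suc n)) (group_coboundary G \<Psi> n \<alpha>)"
proof (rule smooth_vec_cong[OF cP])
  note compose = smooth_vec_compose[OF cP cP _ \<alpha>]
  show "smooth_vec (mfd_power M (Suc n)) (\<lambda>gs. \<Psi> (gs ! 0) (\<alpha> (tl gs))
       + (\<Sum>i = 1..n. (- 1) ^ i *\<^sub>R \<alpha> (take (i - 1) gs @ [gs ! (i - 1) \<otimes> gs ! i] @ drop (i + 1) gs))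
       + (- 1) ^ (n + 1) *\<^sub>R \<alpha> (take n gs))"
    by (intro smooth_vec_add smooth_vec_sum smooth_vec_scale \<Psi> compose tl_smooth take_smooth face_smooth) auto
qed (simp add: topP group_coboundary_def)

lemma coboundary_cochain:
  assumes \<Psi>: "linear_rep G \<Psi>" "\<And>f. smooth_vec (mfd_power M (Suc n)) f \<Longrightarrow>
      smooth_vec (mfd_power M (Suc n)) (\<lambda>gs. \<Psi> (gs ! 0) (f gs))"
    and \<alpha>: "\<alpha> \<in> carrier (cochain_group G M n)"
  shows "group_coboundary G \<Psi> n \<alpha> \<in> carrier (cochain_group G M (Suc n) :: ('g list \<Rightarrow> 'v) monoid)"
proof (cases "n = 0")
  case True
  then show ?thesis
    using \<alpha> linear_rep.group_coboundary_zero[OF \<Psi>(1), of 0] zero_cochain by (simp add: cochain_0)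
next
  case False
  then have \<alpha>: "smooth_vec (mfd_power M n) \<alpha>" "\<And>gs. \<one> \<in> set gs \<Longrightarrow> \<alpha> gs = 0"
    using \<alpha> cochain_iff[of n \<alpha>] by auto
  show ?thesis
    using coboundary_smooth[OF \<Psi>(2) \<alpha>(1)] linear_rep.group_coboundary_normalized[OF \<Psi>(1) \<alpha>(2)]
    by (simp add: cochain_iff group_coboundary_off)
qed

lemma d_cochain: "\<alpha> \<in> carrier (cochain_group G M n) \<Longrightarrow> d n \<alpha> \<in> carrier (cochain_group G M (Suc n))"
  by (rule coboundary_cochain[OF linear_rep_axioms]) (auto intro!: \<Theta>_apply cP nth_smooth)

lemma dD_cochain: "\<alpha> \<in> carrier (cochain_group G M n) \<Longrightarrow> dD n \<alpha> \<in> carrier (cochain_group G M (Suc n))"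
  by (rule coboundary_cochain[OF tw.linear_rep_axioms])
     (auto simp: \<Theta>D_eq intro!: \<Theta>_apply smooth_map_F cP nth_smooth)

lemma list_smooth:
  assumes "\<And>f. f \<in> set fs \<Longrightarrow> smooth_map A M f"
  shows "smooth_map A (mfd_power M (length fs)) (\<lambda>x. map (\<lambda>f. f x) fs)"
  by (rule smooth_map_into_power) (use assms in auto)

lemma K_map_cochain:
  assumes \<alpha>: "\<alpha> \<in> carrier (cochain_group G M n)"
  shows "K_map G D T \<Theta> n \<alpha> \<in> carrier (cochain_group G M n)"
proof (cases "n = 0")
  case True
  then have "K_map G D T \<Theta> n \<alpha> = (\<lambda>_. 0)"
    using \<alpha> linear_0[OF T_lin] by (auto simp: cochain_0 K_map_def K_prime_def K_hat_def)
  then show ?thesis by (simp add: zero_cochain)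
next
  case False
  then have sm: "smooth_vec (mfd_power M n) \<alpha>" and nm: "\<And>gs. \<one> \<in> set gs \<Longrightarrow> \<alpha> gs = 0"
    using \<alpha> cochain_iff[of n \<alpha>] by auto
  let ?N = "mfd_power M n"
  \<comment> \<open>The condition on \<open>n\<close> identifies the power on which \<alpha> is
    smooth with the target of the list map.\<close>
  have \<alpha>1: "smooth_vec ?N (\<lambda>x. \<alpha> [f x])" if "n = 1" "smooth_map ?N M f" for f
    using smooth_vec_compose[OF cP cP list_smooth[of "[f]" ?N], of \<alpha>] sm that by simp
  have \<alpha>2: "smooth_vec ?N (\<lambda>x. \<alpha> [f x, g x])" if "n = 2" "smooth_map ?N M f" "smooth_map ?N M g" for f g
    using smooth_vec_compose[OF cP cP list_smooth[of "[f, g]" ?N], of \<alpha>] sm that by (auto simp: numeral_2_eq_2)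
  have hat: "smooth_vec ?N (K_hat G D T n \<alpha>)"
  proof -
    have "smooth_map ?N ?N (map F)"
    proof (rule smooth_map_into_power)
      fix j assume j: "j < n"
      show "smooth_map ?N M (\<lambda>gs. map F gs ! j)"
        by (rule smooth_map_cong[OF cP cM smooth_map_F[OF cP nth_smooth[of j]]])
           (use j in \<open>auto simp: topspace_power\<close>)
    qed (simp add: topspace_power)
    then show ?thesis
      unfolding K_hat_eq
      by (intro smooth_vec_scale smooth_vec_diff smooth_vec_add smooth_vec_linear[OF T_lin] sm
          smooth_vec_compose[OF cP cP _ sm])
  qed
  have prime: "smooth_vec ?N (K_prime G D \<Theta> n \<alpha>)"
  proof -
    consider "n = 1" | "n = 2" | "n \<noteq> 1" "n \<noteq> 2" by blast
    then show ?thesis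
    proof cases
      case 1
      then have 0: "smooth_map ?N M (\<lambda>gs. gs ! 0)" by (intro nth_smooth) simp
      have "smooth_vec ?N (\<lambda>gs. - \<Theta> (D (gs ! 0)) (\<alpha> [gs ! 0]) + \<alpha> [D (gs ! 0) \<otimes> gs ! 0] - \<alpha> [D (gs ! 0)])"
        by (intro smooth_vec_diff smooth_vec_add smooth_vec_minus \<Theta>_apply \<alpha>1 1 cP smooth_map_D smooth_map_mult 0)
      then show ?thesis using 1 by (simp add: K_prime_def[abs_def] Let_def)
    next
      case 2
      then have 0: "smooth_map ?N M (\<lambda>gs. gs ! 0)" and 1: "smooth_map ?N M (\<lambda>gs. gs ! 1)" by (auto intro!: nth_smooth)
      have "smooth_vec ?N (\<lambda>gs. \<alpha> [D (gs ! 0), gs ! 0] - \<alpha> [D (gs ! 0 \<otimes> gs ! 1), gs ! 0 \<otimes> gs ! 1]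
          + \<Theta> (D (gs ! 0) \<otimes> gs ! 0) (\<alpha> [D (gs ! 1), gs ! 1]))"
        by (intro smooth_vec_diff smooth_vec_add \<Theta>_apply \<alpha>2 2 cP smooth_map_D smooth_map_mult 0 1)
      then show ?thesis using 2 by (simp add: K_prime_def[abs_def] Let_def)
    next
      case 3
      then show ?thesis by (simp add: K_prime_def[abs_def] smooth_vec_zero)
    qed
  qed
  have "smooth_vec ?N (K_map G D T \<Theta> n \<alpha>)"
    by (rule smooth_vec_cong[OF cP smooth_vec_add[OF prime hat]]) (simp add: topP K_map_def)
  then show ?thesis
    using False K_map_normalized[OF nm] by (simp add: cochain_iff K_map_def)
qed

lemma K_hat_add: "K_hat G D T n (\<lambda>gs. \<alpha> gs + \<beta> gs) gs = K_hat G D T n \<alpha> gs + K_hat G D T n \<beta> gs"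
  unfolding K_hat_eq by (simp add: linear_add[OF T_lin] algebra_simps)

text \<open>Restricted to tuples because \<open>\<Theta> (D g)\<close> is known to be linear only
  for \<open>g\<close> in the group.\<close>

lemma K_prime_add:
  assumes "gs \<in> tuples G n"
  shows "K_prime G D \<Theta> n (\<lambda>gs. \<alpha> gs + \<beta> gs) gs = K_prime G D \<Theta> n \<alpha> gs + K_prime G D \<Theta> n \<beta> gs"
proof -
  consider "n = 1" | "n = 2" | "n \<noteq> 1" "n \<noteq> 2" by blast
  then show ?thesis
  proof cases
    case 1
    with assms obtain g where "gs = [g]" "g \<in> carrier G" using tuples_1 by auto
    then show ?thesis using 1 linear_add[OF lin[OF D_closed]] by (simp add: K_prime_def algebra_simps)
  next
    case 2
    with assms obtain g h where "gs = [g, h]" "g \<in> carrier G" "h \<in> carrier G" using tuples_2 by auto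
    then show ?thesis using 2 linear_add[OF lin, of "D g \<otimes> g"] D_closed by (simp add: K_prime_def algebra_simps)
  qed (simp add: K_prime_def)
qed

lemma K_map_add: "K_map G D T \<Theta> n (\<lambda>gs. \<alpha> gs + \<beta> gs) gs = K_map G D T \<Theta> n \<alpha> gs + K_map G D T \<Theta> n \<beta> gs"
  by (simp add: K_map_def K_prime_add K_hat_add)

lemma K_map_zero: "K_map G D T \<Theta> n (\<lambda>_. 0) = (\<lambda>_. 0)"
  using K_map_add[of n "\<lambda>_. 0" "\<lambda>_. 0"] by (simp add: fun_eq_iff)

section \<open>The three complexes and their exact sequence\<close>

abbreviation "\<AA> \<equiv> operator_complex G M D \<Theta>"
abbreviation "\<BB> \<equiv> total_complex G M D T \<Theta>"
abbreviation "\<CC> \<equiv> group_complex G M \<Theta>"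

lemma grp_A: "grp \<AA> n = cochain_group G M (n - 1)" and diff_A: "diff \<AA> n = dD (n - 1)"
  by (simp_all add: operator_complex_def)

lemma grp_C: "grp \<CC> n = cochain_group G M n" and diff_C: "diff \<CC> n = d n"
  by (simp_all add: group_complex_def)

lemma grp_B: "grp \<BB> n = cochain_group G M n \<times>\<times> cochain_group G M (n - 1)"
  and diff_B: "diff \<BB> n (\<alpha>, \<beta>) = (d n \<alpha>, \<lambda>gs. dD (n - 1) \<beta> gs + K_map G D T \<Theta> n \<alpha> gs)"
  by (simp_all add: total_complex_def operator_complex_def group_complex_def)

text \<open>For \<open>n = 0\<close> truncation leaves \<open>dD 0\<close> on the zero cochain,
  whose value must lie in \<open>cochain_group G M 0\<close>.\<close>

lemma dD_cochain_pred: "\<beta> \<in> carrier (cochain_group G M (n - 1)) \<Longrightarrow> dD (n - 1) \<beta> \<in> carrier (cochain_group G M n)"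
  using dD_cochain[of \<beta> "n - 1"] tw.group_coboundary_zero[of 0] by (cases n) (auto simp: cochain_0)

lemma complex_C: "cochain_complex \<CC>"
  unfolding cochain_complex_def grp_C diff_C
  by (auto intro!: cochain_comm_group homI d_cochain
      simp: cochain_mult cochain_one group_coboundary_twice group_coboundary_add fun_eq_iff)

lemma complex_A: "cochain_complex \<AA>"
  unfolding cochain_complex_def grp_A diff_A
proof (intro allI conjI ballI)
  fix n
  show "comm_group (cochain_group G M (n - 1) :: ('g list \<Rightarrow> 'v) monoid)" by (rule cochain_comm_group)
  show "dD (n - 1) \<in> hom (cochain_group G M (n - 1)) (cochain_group G M (Suc n - 1))"
    using dD_cochain_pred by (intro homI) (simp_all add: cochain_mult tw.group_coboundary_add fun_eq_iff)
  fix x :: "'g list \<Rightarrow> 'v" assume "x \<in> carrier (cochain_group G M (n - 1))"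
  then show "dD (Suc n - 1) (dD (n - 1) x) = \<one>\<^bsub>cochain_group G M (Suc (Suc n) - 1)\<^esub>"
    using tw.group_coboundary_twice tw.group_coboundary_zero by (cases n) (simp_all add: cochain_0 cochain_one)
qed

lemma complex_B: "cochain_complex \<BB>"
  unfolding cochain_complex_def
proof (intro allI conjI ballI)
  fix n
  let ?C = "\<lambda>n. cochain_group G M n :: ('g list \<Rightarrow> 'v) monoid"
  show "comm_group (grp \<BB> n)"
  proof (rule group.group_comm_groupI)
    show "group (grp \<BB> n)"
      unfolding grp_B by (rule DirProd_group) (rule comm_group.axioms(2)[OF cochain_comm_group])+
  qed (auto simp: grp_B cochain_mult add.commute)
  show "diff \<BB> n \<in> hom (grp \<BB> n) (grp \<BB> (Suc n))"
  proof (rule homI)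
    fix x assume "x \<in> carrier (grp \<BB> n)"
    then show "diff \<BB> n x \<in> carrier (grp \<BB> (Suc n))"
      by (auto simp: grp_B diff_B intro!: d_cochain add_cochain dD_cochain_pred[simplified] K_map_cochain)
  next
    fix x y assume "x \<in> carrier (grp \<BB> n)" "y \<in> carrier (grp \<BB> n)"
    show "diff \<BB> n (x \<otimes>\<^bsub>grp \<BB> n\<^esub> y) = diff \<BB> n x \<otimes>\<^bsub>grp \<BB> (Suc n)\<^esub> diff \<BB> n y"
      by (cases x; cases y)
         (simp add: grp_B diff_B cochain_mult group_coboundary_add tw.group_coboundary_add K_map_add fun_eq_iff)
  qed
  fix x assume x: "x \<in> carrier (grp \<BB> n)"
  obtain \<alpha> \<beta> where ab: "x = (\<alpha>, \<beta>)" by (cases x)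
  have \<beta>: "\<beta> \<in> carrier (?C (n - 1))" and \<alpha>: "\<alpha> \<in> carrier (?C n)" using x by (auto simp: ab grp_B)
  \<comment> \<open>The second component of the squared differential: \<beta> drops out by
    \<open>dD \<circ> dD = 0\<close> and \<alpha> by anticommutation. For \<open>n = 0\<close> the
    two indices of \<open>dD\<close> coincide, but both cochains are zero.\<close>
  have "dD n (\<lambda>gs. dD (n - 1) \<beta> gs + K_map G D T \<Theta> n \<alpha> gs) gs + K_map G D T \<Theta> (Suc n) (d n \<alpha>) gs = 0" for gs
  proof (cases n)
    case 0
    then show ?thesis
      using \<alpha> \<beta> by (simp add: cochain_0 tw.group_coboundary_zero group_coboundary_zero K_map_zero)
  next
    case (Suc m)
    then have "dD n (dD (n - 1) \<beta>) gs = 0" using tw.group_coboundary_twice by simp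
    then show ?thesis using dD_K_map[of n \<alpha> gs] Suc by (simp add: tw.group_coboundary_add)
  qed
  then show "diff \<BB> (Suc n) (diff \<BB> n x) = \<one>\<^bsub>grp \<BB> (Suc (Suc n))\<^esub>"
    by (simp add: ab diff_B grp_B cochain_one group_coboundary_twice)
qed

lemma short_exact_complexes: "short_exact_complexes \<AA> \<BB> \<CC> i_map p_map"
proof -
  note cg = comm_group.axioms(2)[OF cochain_comm_group]
  have i_hom: "i_map n \<in> hom (grp \<AA> n) (grp \<BB> n)" for n
    by (rule homI) (auto simp: grp_A grp_B i_map_def zero_cochain cochain_mult)
  have p_hom: "p_map n \<in> hom (grp \<BB> n) (grp \<CC> n)" for n
    by (rule homI) (auto simp: grp_C grp_B p_map_def)
  have i: "cochain_map \<AA> \<BB> i_map"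
    unfolding cochain_map_def using i_hom
    by (simp add: i_map_def diff_A diff_B group_coboundary_zero K_map_zero)
  have p: "cochain_map \<BB> \<CC> p_map"
    unfolding cochain_map_def using p_hom
    by (auto simp: p_map_def diff_C diff_B grp_B)
  have "i_map n ` carrier (grp \<AA> n) = kernel (grp \<BB> n) (grp \<CC> n) (p_map n)" for n
    by (auto simp: kernel_def i_map_def p_map_def grp_A grp_B grp_C cochain_one zero_cochain image_iff)
  moreover have "inj_on (i_map n) (carrier (grp \<AA> n))" for n
    by (auto simp: inj_on_def i_map_def)
  moreover have "p_map n ` carrier (grp \<BB> n) = carrier (grp \<CC> n)" for n
    using zero_cochain[of "n - 1"] by (force simp: p_map_def grp_B grp_C image_iff)
  ultimately show ?thesis
    unfolding short_exact_complexes_def exact_at_def mon_def epi_def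
    using complex_A complex_B complex_C i p i_hom p_hom
      cochain_complex_group[OF complex_A] cochain_complex_group[OF complex_B] cochain_complex_group[OF complex_C] by auto
qed

sublocale ses: short_exact \<AA> \<BB> \<CC> i_map p_map
  by (rule short_exact.intro[OF short_exact_complexes])

lemma connecting_K:
  assumes \<alpha>: "\<alpha> \<in> cocycles \<CC> n"
  shows "K_map G D T \<Theta> n \<alpha> \<in> cocycles \<AA> (Suc n)"
    and "connecting_map \<AA> \<BB> i_map p_map n (coclass \<CC> n \<alpha>) = coclass \<AA> (Suc n) (K_map G D T \<Theta> n \<alpha>)"
proof -
  have a: "\<alpha> \<in> carrier (cochain_group G M n)" "d n \<alpha> = (\<lambda>_. 0)"
    using \<alpha> by (auto simp: cocycles_iff grp_C diff_C cochain_one)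
  have y: "(\<alpha>, \<lambda>_. 0) \<in> carrier (grp \<BB> n)" using a zero_cochain by (simp add: grp_B)
  have x: "K_map G D T \<Theta> n \<alpha> \<in> carrier (grp \<AA> (Suc n))" using K_map_cochain[OF a(1)] by (simp add: grp_A)
  \<comment> \<open>The first component of the differential of the lift is zero because \<alpha> is
    a cocycle, so the lift yields exactly \<open>K_map\<close> and no coboundary correction.\<close>
  have eq: "i_map (Suc n) (K_map G D T \<Theta> n \<alpha>) = diff \<BB> n (\<alpha>, \<lambda>_. 0)"
    by (simp add: i_map_def diff_B a(2) tw.group_coboundary_zero)
  show "K_map G D T \<Theta> n \<alpha> \<in> cocycles \<AA> (Suc n)" by (rule ses.connecting_cocycle(1)[OF y x eq])
  show "connecting_map \<AA> \<BB> i_map p_map n (coclass \<CC> n \<alpha>) = coclass \<AA> (Suc n) (K_map G D T \<Theta> n \<alpha>)"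
    using ses.connecting_map_coclass[OF y x eq] by (simp add: p_map_def)
qed

text \<open>The operator complex is zero in degree 1, so the source is a trivial group. This gives
  exactness at the left end of the long sequence.\<close>

lemma i_mon_1: "induced_map \<BB> i_map 1 \<in> mon (cohomology \<AA> 1) (cohomology \<BB> 1)"
proof -
  have "carrier (cohomology \<AA> 1) \<subseteq> {coclass \<AA> 1 (\<lambda>_. 0)}"
    unfolding carrier_cohomology[OF complex_A] by (auto simp: cocycles_iff grp_A cochain_0)
  then have "inj_on (induced_map \<BB> i_map 1) (carrier (cohomology \<AA> 1))"
    by (auto simp: inj_on_def)
  then show ?thesis
    using induced_map_hom[OF ses.A ses.B ses.i] by (simp add: mon_def)
qed

end

theorem theorem3p6:
  fixes G :: "'g monoid" and M :: "'g mfd" and D :: "'g \<Rightarrow> 'g"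
    and T :: "'v::real_vector \<Rightarrow> 'v" and \<Theta> :: "'g \<Rightarrow> 'v \<Rightarrow> 'v"
  assumes "difference_lie_group G M D"
    and "difference_rep G M D T \<Theta>"
  shows "let A = operator_complex G M D \<Theta>;
             B = total_complex G M D T \<Theta>;
             C = group_complex G M \<Theta>;
             i = induced_map B i_map;
             p = induced_map C p_map;
             k = connecting_map A B i_map p_map
         in short_exact_complexes A B C i_map p_map \<and>
            i 1 \<in> mon (cohomology A 1) (cohomology B 1) \<and>
            (\<forall>n\<ge>1.
               exact_at (cohomology A n) (cohomology B n) (cohomology C n) (i n) (p n) \<and>
               exact_at (cohomology B n) (cohomology C n) (cohomology A (n + 1)) (p n) (k n) \<and>
               exact_at (cohomology C n) (cohomology A (n + 1)) (cohomology B (n + 1)) (k n) (i (n + 1)) \<and>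
               (\<forall>\<beta>\<in>cocycles A n. i n (coclass A n \<beta>) = coclass B n (i_map n \<beta>)) \<and>
               (\<forall>y\<in>cocycles B n. p n (coclass B n y) = coclass C n (p_map n y)) \<and>
               (\<forall>\<alpha>\<in>cocycles C n. K_map G D T \<Theta> n \<alpha> \<in> cocycles A (n + 1) \<and>
                  k n (coclass C n \<alpha>) = coclass A (n + 1) (K_map G D T \<Theta> n \<alpha>)))"
proof -
  interpret difference_lie_rep G M D T \<Theta>
    using assms by (rule difference_lie_rep.intro)
  show ?thesis
    unfolding Let_def add.commute[of _ 1] plus_1_eq_Suc
  proof (intro conjI allI impI ballI)
    fix n :: nat assume "1 \<le> n"
    then show "exact_at (cohomology \<AA> n) (cohomology \<BB> n) (cohomology \<CC> n) (induced_map \<BB> i_map n) (induced_map \<CC> p_map n)"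
      using ses.exact_at_total[of "n - 1"] by simp
    show "exact_at (cohomology \<BB> n) (cohomology \<CC> n) (cohomology \<AA> (Suc n)) (induced_map \<CC> p_map n) (connecting_map \<AA> \<BB> i_map p_map n)"
      by (rule ses.exact_at_quotient)
    show "exact_at (cohomology \<CC> n) (cohomology \<AA> (Suc n)) (cohomology \<BB> (Suc n)) (connecting_map \<AA> \<BB> i_map p_map n) (induced_map \<BB> i_map (Suc n))"
      by (rule ses.exact_at_sub)
    show "induced_map \<BB> i_map n (coclass \<AA> n \<beta>) = coclass \<BB> n (i_map n \<beta>)" if "\<beta> \<in> cocycles \<AA> n" for \<beta>
      using that by (intro induced_map_coclass[OF ses.A ses.B ses.i]) (simp add: cocycles_iff)
    show "induced_map \<CC> p_map n (coclass \<BB> n y) = coclass \<CC> n (p_map n y)" if "y \<in> cocycles \<BB> n" for y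
      using that by (intro induced_map_coclass[OF ses.B ses.C ses.p]) (simp add: cocycles_iff)
  qed (rule short_exact_complexes i_mon_1 connecting_K; assumption)+
qed

end
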